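(* The class $\mathcal F_1$ consists exactly of the functions of the form $$F_{\gamma_1,\gamma_2,x}(a)=e^{i\gamma_1a-\gamma_2a^2/2}\prod_k\frac{e^{-ix_ka}}{1-ix_ka},\qquad a\in\mathbb R,$$ where $\gamma_1\in\mathbb R$, $\gamma_2\ge0$, and $x=(x_1,x_2,\dots)$ is a (finite or infinite) sequence of real numbers with $\sum x_k^2<\infty$. Thus, the characteristic functions of the ergodic $U(\infty)$-invariant Borel probability measures on $H$ are exactly the functions of the form $$f(A)=e^{i\gamma_1\operatorname{tr}A-\gamma_2\operatorname{tr}(A^2)/2}\det\bigg(\prod_k\frac{e^{-ix_kA}}{1-ix_kA}\bigg),\qquad A\in H(\infty),$$ where $\gamma_1,\gamma_2,x_1,x_2,\dots$ are real parameters such that $\gamma_2\ge0$ and $\sum x_k^2<\infty$.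
   Context: $H(n)$ is the real vector space of $n\times n$ complex Hermitian matrices, embedded in $H(n+1)$ by adding a zero row and column; $H(\infty)=\bigcup_n H(n)$ (inductive limit topology: a function on $H(\infty)$ is continuous iff its restriction to each $H(n)$ is). $H=\varprojlim H(n)$ is the space of all $\infty\times\infty$ Hermitian matrices with the projective limit topology (entrywise convergence). $U(\infty)=\bigcup_n U(n)$, with $U(n)\subset U(n+1)$ via $u\mapsto\begin{pmatrix}u&0\\0&1\end{pmatrix}$, acts on $H$ and $H(\infty)$ by conjugations $B\mapsto uBu^{-1}$. The characteristic function of a Borel probability measure $M$ on $H$ is $f_M(A)=\int_He^{i\operatorname{tr}(AB)}M(dB)$, $A\in H(\infty)$. A $U(\infty)$-invariant Borel probability measure $M$ on $H$ is ergodic if every Borel set $Y\subset H$ with $M((u\cdot Y)\,\triangle\,Y)=0$ for all $u\in U(\infty)$ has $M(Y)\in\{0,1\}$. $\mathcal F$ denotes the set of characteristic functions of ergodic $U(\infty)$-invariant Borel probability measures on $H$, and $\mathcal F_1$ is the class of functions on $\mathbb R=H(1)$ of the form $F=f|_{H(1)}$, $f\in\mathcal F$, i.e. $F(a)=f(\operatorname{diag}(a,0,0,\dots))$. Equivalently (by the known multiplicativity theorem: a continuous $U(\infty)$-invariant positive definite $f$ with $f(0)=1$ lies in $\mathcal F$ iff $f(A)=\prod_jF(a_j)$ over the eigenvalues $a_j$ of $A$ for some function $F$ with $F(0)=1$), a function $F$ on $\mathbb R$ belongs to $\mathcal F_1$ iff $F$ is continuous, $F(0)=1$, and $A\mapsto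 F(a_1)F(a_2)\cdots$ ($a_1,a_2,\dots$ the eigenvalues of $A$) is positive definite on the additive group $H(\infty)$. *)

theory Defs
  imports "HOL-Probability.Probability" "Jordan_Normal_Form.Determinant"
begin

section \<open>Infinite matrices\<close>

text \<open>The entrywise convergence topology on infinite matrices is the product topology
  that the library puts on the function type.\<close>

type_synonym cmat = "nat \<Rightarrow> nat \<Rightarrow> complex"

text \<open>In every product below whose value matters, the factors are such that the sums over
  \<open>k\<close> have only finitely many nonzero terms; the same holds for the sums in the traces.\<close>

definition mmul :: "cmat \<Rightarrow> cmat \<Rightarrow> cmat" where
  "mmul A B = (\<lambda>i j. \<Sum>\<^sub>\<infinity>k. A i k * B k j)"

definition mone :: cmat where
  "mone = (\<lambda>i j. if i = j then 1 else 0)"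

definition madj :: "cmat \<Rightarrow> cmat" where
  "madj A = (\<lambda>i j. cnj (A j i))"

definition mtrace :: "cmat \<Rightarrow> complex" where
  "mtrace A = (\<Sum>\<^sub>\<infinity>i. A i i)"

definition mscale :: "complex \<Rightarrow> cmat \<Rightarrow> cmat" where
  "mscale c A = (\<lambda>i j. c * A i j)"

definition mminus :: "cmat \<Rightarrow> cmat \<Rightarrow> cmat" where
  "mminus A B = (\<lambda>i j. A i j - B i j)"

primrec mpow :: "cmat \<Rightarrow> nat \<Rightarrow> cmat" where
  "mpow A 0 = mone"
| "mpow A (Suc m) = mmul (mpow A m) A"

definition mexp :: "cmat \<Rightarrow> cmat" where
  "mexp A = (\<lambda>i j. suminf (\<lambda>m. mpow A m i j / fact m))"

text \<open>Used only for matrices that differ from \<^const>\<open>mone\<close> in a finite corner which is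
  invertible; for these the two-sided inverse exists and is unique.\<close>

definition minv :: "cmat \<Rightarrow> cmat" where
  "minv A = (THE B. mmul A B = mone \<and> mmul B A = mone)"

primrec mprod :: "(nat \<Rightarrow> cmat) \<Rightarrow> nat \<Rightarrow> cmat" where
  "mprod G 0 = mone"
| "mprod G (Suc m) = mmul (mprod G m) (G m)"

definition mprodinf :: "(nat \<Rightarrow> cmat) \<Rightarrow> cmat" where
  "mprodinf G = lim (mprod G)"

text \<open>If \<open>A\<close> differs from \<^const>\<open>mone\<close> only in its upper left \<open>n \<times> n\<close> corner, then the
  determinants of all corners of size at least \<open>n\<close> agree, and this common value is the
  determinant of \<open>A\<close>.\<close>

definition mdet :: "cmat \<Rightarrow> complex" where
  "mdet A = lim (\<lambda>n. Determinant.det (Matrix.mat n n (\<lambda>(i, j). A i j)))"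

section \<open>Hermitian matrices and the unitary action\<close>

definition Herm :: "cmat set" where
  "Herm = {B. madj B = B}"

definition Herm_n :: "nat \<Rightarrow> cmat set" where
  "Herm_n n = {A \<in> Herm. \<forall>i j. n \<le> i \<or> n \<le> j \<longrightarrow> A i j = 0}"

definition Herm_fin :: "cmat set" where
  "Herm_fin = (\<Union>n. Herm_n n)"

definition U_n :: "nat \<Rightarrow> cmat set" where
  "U_n n = {u. mmul u (madj u) = mone \<and> mmul (madj u) u = mone \<and>
               (\<forall>i j. n \<le> i \<or> n \<le> j \<longrightarrow> u i j = mone i j)}"

definition U_fin :: "cmat set" where
  "U_fin = (\<Union>n. U_n n)"

text \<open>Conjugation \<open>B \<mapsto> u B u\<^sup>-\<^sup>1\<close>, where \<open>u\<^sup>-\<^sup>1\<close> is the adjoint of \<open>u\<close>.\<close>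

definition conjugate_by :: "cmat \<Rightarrow> cmat \<Rightarrow> cmat" where
  "conjugate_by u B = mmul (mmul u B) (madj u)"

section \<open>Ergodic measures and their characteristic functions\<close>

definition borel_prob_on_Herm :: "cmat measure \<Rightarrow> bool" where
  "borel_prob_on_Herm M \<longleftrightarrow> prob_space M \<and> sets M = sets (restrict_space borel Herm)"

definition U_invariant :: "cmat measure \<Rightarrow> bool" where
  "U_invariant M \<longleftrightarrow> (\<forall>u\<in>U_fin. distr M M (conjugate_by u) = M)"

definition U_ergodic :: "cmat measure \<Rightarrow> bool" where
  "U_ergodic M \<longleftrightarrow>
     (\<forall>Y\<in>sets M. (\<forall>u\<in>U_fin. measure M (sym_diff (conjugate_by u ` Y) Y) = 0) \<longrightarrow>
        measure M Y = 0 \<or> measure M Y = 1)"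

definition char_fun :: "cmat measure \<Rightarrow> cmat \<Rightarrow> complex" where
  "char_fun M A = (LINT B|M. exp (\<i> * mtrace (mmul A B)))"

text \<open>Functions on \<^const>\<open>Herm_fin\<close> are represented by functions on all matrices with the
  value \<^const>\<open>undefined\<close> outside \<^const>\<open>Herm_fin\<close>.\<close>

definition class_F :: "(cmat \<Rightarrow> complex) set" where
  "class_F = {\<lambda>A\<in>Herm_fin. char_fun M A | M.
                borel_prob_on_Herm M \<and> U_invariant M \<and> U_ergodic M}"

definition diag1 :: "real \<Rightarrow> cmat" where
  "diag1 a = (\<lambda>i j. if i = 0 \<and> j = 0 then complex_of_real a else 0)"

definition class_F1 :: "(real \<Rightarrow> complex) set" where
  "class_F1 = {\<lambda>a. f (diag1 a) | f. f \<in> class_F}"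

section \<open>The parametrised functions\<close>

text \<open>A finite sequence \<open>x\<close> is encoded by appending zeros; each zero contributes a factor
  equal to 1.\<close>

definition F_param :: "real \<Rightarrow> real \<Rightarrow> (nat \<Rightarrow> real) \<Rightarrow> real \<Rightarrow> complex" where
  "F_param \<gamma>1 \<gamma>2 x a =
     exp (\<i> * \<gamma>1 * a - \<gamma>2 * a\<^sup>2 / 2) *
     prodinf (\<lambda>k. exp (- (\<i> * x k * a)) / (1 - \<i> * x k * a))"

definition f_param :: "real \<Rightarrow> real \<Rightarrow> (nat \<Rightarrow> real) \<Rightarrow> cmat \<Rightarrow> complex" where
  "f_param \<gamma>1 \<gamma>2 x A =
     exp (\<i> * \<gamma>1 * mtrace A - \<gamma>2 * mtrace (mmul A A) / 2) *
     mdet (mprodinf (\<lambda>k.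
       mmul (mexp (mscale (- (\<i> * x k)) A)) (minv (mminus mone (mscale (\<i> * x k) A)))))"

end

theory Submission
  imports Defs "Jordan_Normal_Form.Spectral_Radius" "HOL-Combinatorics.Permutations"
    "HOL-Library.Diagonal_Subsequence"
begin

text \<open>Averaging \<open>exp (\<i> tr (A B))\<close> over translates of \<open>A\<close> to disjoint diagonal blocks produces a
  sequence that is Cauchy in \<open>L\<^sup>2\<close> and asymptotically \<open>U(\<infinity>)\<close>-invariant. Hence an invariant measure is
  ergodic iff its characteristic function is multiplicative on block-diagonal matrices, and then it
  is determined by its restriction \<open>F\<close> to \<open>H(1)\<close>.

  To identify \<open>F\<close>, test the \<open>N \<times> N\<close> corner of \<open>B\<close>, with eigenvalues \<open>\<lambda>\<^sub>j\<close>, on a standard complex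
  Gaussian vector \<open>\<xi>\<close>: the expectation over \<open>\<xi>\<close> of \<open>exp (\<i> a \<xi>\<^sup>* B \<xi> / N)\<close> is
  \<open>\<Prod>\<^sub>j 1 / (1 - \<i> a \<lambda>\<^sub>j / N)\<close>, while its mean over \<open>B\<close> tends to \<open>F a\<close> because \<open>\<xi> \<xi>\<^sup>* / N\<close> is a rank one
  matrix with eigenvalue close to 1. Two independent Gaussian vectors are almost orthogonal, so
  multiplicativity makes the variance vanish, and \<open>F\<close> is a limit of finite products
  \<open>\<Prod>\<^sub>j 1 / (1 - \<i> a l\<^sub>j)\<close>. Ordering the \<open>l\<^sub>j\<close> by modulus and extracting convergent subsequences
  gives the \<open>x\<^sub>k\<close>; the part of \<open>\<Sum>\<^sub>j l\<^sub>j\<^sup>2\<close> that is lost in the limit becomes \<open>\<gamma>\<^sub>2\<close>.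

  Conversely, the measure with parameters \<open>\<gamma>\<^sub>1, \<gamma>\<^sub>2, x\<close> is the law of
  \<open>\<gamma>\<^sub>1 1 + \<surd>\<gamma>\<^sub>2 G + \<Sum>\<^sub>k x\<^sub>k (\<xi>\<^sub>k \<xi>\<^sub>k\<^sup>* - 1)\<close> with \<open>G\<close> a Gaussian Hermitian matrix and \<open>\<xi>\<^sub>k\<close> Gaussian
  vectors, all independent.\<close>

text \<open>There is no invariant probability on the whole of U(infinity) to average over, which is
  why translates to disjoint blocks stand in for group averages. All sample sizes are powers
  \<open>4 ^ m\<close>: mean square errors are then geometric, and one summability criterion gives
  the almost sure convergence of the block averages, of the Gaussian norms and of the random series
  that builds the measures. Ergodicity enters only through multiplicativity, to which it is
  equivalent for invariant measures; both inclusions of the classification pass through this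
  equivalence. Vanishing variance yields single matrices whose Gaussian transforms approximate
  \<open>F\<close> at finitely many points at once. Hence the array of the \<open>l_j\<close> does
  not depend on \<open>a\<close>, and convergence is known only at rational \<open>a\<close>. The
  sums of the \<open>l_j\<close> need not converge, so \<open>\<gamma>1\<close> cannot be read off
  as their limit: only the exponentials of these sums converge, and \<open>\<gamma>1\<close> is
  recovered from the continuous character that appears as their limit.\<close>

section \<open>Finite corners and unitary conjugation\<close>

text \<open>Block-plus-diagonal matrices: in products of three matrices two of which are of this kind all
  inner sums are finite, so that the infinite sums in \<^const>\<open>mmul\<close> are associative there.\<close>

definition blk :: "nat \<Rightarrow> cmat \<Rightarrow> bool" where
  "blk n A \<longleftrightarrow> (\<forall>i j. i \<noteq> j \<and> (n \<le> i \<or> n \<le> j) \<longrightarrow> A i j = 0)"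

lemma infsum_nat_lessThan:
  fixes f :: "nat \<Rightarrow> complex"
  assumes "\<And>k. N \<le> k \<Longrightarrow> f k = 0"
  shows "(\<Sum>\<^sub>\<infinity>k. f k) = (\<Sum>k<N. f k)"
proof -
  have "(\<Sum>\<^sub>\<infinity>k. f k) = (\<Sum>\<^sub>\<infinity>k\<in>{..<N}. f k)"
    by (rule infsum_cong_neutral) (use assms in \<open>auto simp: not_less\<close>)
  then show ?thesis by simp
qed

lemma mmul_eq_sum:
  assumes "\<And>k. N \<le> k \<Longrightarrow> A i k * B k j = 0"
  shows "mmul A B i j = (\<Sum>k<N. A i k * B k j)"
  unfolding mmul_def by (rule infsum_nat_lessThan) (fact assms)

lemma mmul_blkL: "blk n A \<Longrightarrow> n \<le> N \<Longrightarrow> i < N \<Longrightarrow> mmul A B i j = (\<Sum>k<N. A i k * B k j)"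
  by (rule mmul_eq_sum) (auto simp: blk_def)

lemma mmul_blkR: "blk n B \<Longrightarrow> n \<le> N \<Longrightarrow> j < N \<Longrightarrow> mmul A B i j = (\<Sum>k<N. A i k * B k j)"
  by (rule mmul_eq_sum) (auto simp: blk_def)

lemma blk_mone [simp]: "blk n mone"
  by (auto simp: blk_def mone_def)

lemma blk_madj [simp]: "blk n (madj A) \<longleftrightarrow> blk n A"
  by (auto simp: blk_def madj_def)

lemma blk_mmul:
  assumes "blk n A" "blk n B" shows "blk n (mmul A B)"
  unfolding blk_def
proof (intro allI impI)
  fix i j :: nat assume *: "i \<noteq> j \<and> (n \<le> i \<or> n \<le> j)"
  have "A i k * B k j = 0" for k
    using assms * unfolding blk_def by (metis mult_eq_0_iff)
  then show "mmul A B i j = 0" by (subst mmul_eq_sum[of 0]) auto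
qed

text \<open>The suffix names the two factors (left, middle, right) that are block-plus-diagonal.
  Here the rows with index below \<open>N\<close> of \<open>A\<close> and of \<open>B\<close> vanish
  from column \<open>N\<close> on, so both sides become finite double sums, and \<open>C\<close> may
  be any infinite matrix.\<close>

lemma mmul_assoc_LM:
  assumes "blk n A" "blk n B"
  shows "mmul (mmul A B) C = mmul A (mmul B C)"
proof (intro ext)
  fix i j
  define N where "N = max n (Suc i)"
  have N: "n \<le> N" "i < N" by (auto simp: N_def)
  have "mmul (mmul A B) C i j = (\<Sum>k<N. mmul A B i k * C k j)"
    by (rule mmul_blkL[OF blk_mmul[OF assms] N])
  also have "\<dots> = (\<Sum>k<N. \<Sum>l<N. A i l * B l k * C k j)"
    by (simp add: mmul_blkL[OF assms(1) N] sum_distrib_right)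
  also have "\<dots> = (\<Sum>l<N. \<Sum>k<N. A i l * B l k * C k j)" by (rule sum.swap)
  also have "\<dots> = (\<Sum>l<N. A i l * mmul B C l j)"
    by (intro sum.cong refl) (simp add: mmul_blkL[OF assms(2) N(1)] sum_distrib_left mult.assoc)
  also have "\<dots> = mmul A (mmul B C) i j" by (rule mmul_blkL[OF assms(1) N, symmetric])
  finally show "mmul (mmul A B) C i j = mmul A (mmul B C) i j" .
qed

lemma mmul_assoc_LR:
  assumes "blk n A" "blk n C"
  shows "mmul (mmul A B) C = mmul A (mmul B C)"
proof (intro ext)
  fix i j
  define N where "N = max n (max (Suc i) (Suc j))"
  have N: "n \<le> N" "i < N" "j < N" by (auto simp: N_def)
  have "mmul (mmul A B) C i j = (\<Sum>k<N. mmul A B i k * C k j)"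
    by (rule mmul_blkR[OF assms(2) N(1,3)])
  also have "\<dots> = (\<Sum>k<N. \<Sum>l<N. A i l * B l k * C k j)"
    by (simp add: mmul_blkL[OF assms(1) N(1,2)] sum_distrib_right)
  also have "\<dots> = (\<Sum>l<N. \<Sum>k<N. A i l * B l k * C k j)" by (rule sum.swap)
  also have "\<dots> = (\<Sum>l<N. A i l * mmul B C l j)"
    by (intro sum.cong refl) (simp add: mmul_blkR[OF assms(2) N(1,3)] sum_distrib_left mult.assoc)
  also have "\<dots> = mmul A (mmul B C) i j" by (rule mmul_blkL[OF assms(1) N(1,2), symmetric])
  finally show "mmul (mmul A B) C i j = mmul A (mmul B C) i j" .
qed

lemma madj_madj [simp]: "madj (madj A) = A"
  by (simp add: madj_def)

lemma madj_mmul: "madj (mmul A B) = mmul (madj B) (madj A)"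
  by (intro ext) (simp add: madj_def mmul_def mult.commute flip: infsum_cnj)

text \<open>The mirror image of \<open>mmul_assoc_LM\<close> under \<open>madj\<close>, which
  reverses products.\<close>

lemma mmul_assoc_MR:
  assumes "blk n B" "blk n C"
  shows "mmul (mmul A B) C = mmul A (mmul B C)"
proof -
  have "madj (mmul (mmul A B) C) = madj (mmul A (mmul B C))"
    using assms by (simp add: madj_mmul mmul_assoc_LM[of n])
  then show ?thesis by (metis madj_madj)
qed

lemma mmul_mone_left [simp]: "mmul mone A = A"
proof (intro ext)
  fix i j show "mmul mone A i j = A i j"
    by (subst mmul_blkL[OF blk_mone[of 0], of "Suc i"])
       (simp_all add: mone_def if_distrib[of "\<lambda>x. x * _"] cong: if_cong)
qed

lemma mmul_mone_right [simp]: "mmul A mone = A"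
proof (intro ext)
  fix i j show "mmul A mone i j = A i j"
    by (subst mmul_blkR[OF blk_mone[of 0], of "Suc j"])
       (simp_all add: mone_def if_distrib[of "\<lambda>x. _ * x"] cong: if_cong)
qed

lemma madj_mone [simp]: "madj mone = mone"
proof (intro ext)
  fix i j show "madj mone i j = mone i j" by (simp add: madj_def mone_def)
qed

lemma U_n_blk: "u \<in> U_n n \<Longrightarrow> blk n u"
  by (auto simp: U_n_def blk_def mone_def)

lemma U_n_mono: "u \<in> U_n n \<Longrightarrow> n \<le> m \<Longrightarrow> u \<in> U_n m"
  by (auto simp: U_n_def)

lemma mone_U_n [simp]: "mone \<in> U_n n"
  by (auto simp: U_n_def)

lemma U_n_madj: "u \<in> U_n n \<Longrightarrow> madj u \<in> U_n n"
  unfolding U_n_def by (simp add: madj_def) (auto simp: mone_def)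

lemma U_n_mmul:
  assumes u: "u \<in> U_n n" and v: "v \<in> U_n n" shows "mmul u v \<in> U_n n"
proof -
  note b = U_n_blk[OF u] U_n_blk[OF v]
  have uu: "mmul u (madj u) = mone" "mmul (madj u) u = mone"
    and vv: "mmul v (madj v) = mone" "mmul (madj v) v = mone"
    using u v by (auto simp: U_n_def)
  have "mmul (mmul u v) (mmul (madj v) (madj u)) = mmul u (mmul (mmul v (madj v)) (madj u))"
    using b by (simp add: mmul_assoc_LM[of n] blk_mmul)
  then have 1: "mmul (mmul u v) (madj (mmul u v)) = mone" by (simp add: vv uu madj_mmul)
  have "mmul (mmul (madj v) (madj u)) (mmul u v) = mmul (madj v) (mmul (mmul (madj u) u) v)"
    using b by (simp add: mmul_assoc_LM[of n] blk_mmul)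
  then have 2: "mmul (madj (mmul u v)) (mmul u v) = mone" by (simp add: vv uu madj_mmul)
  have 3: "mmul u v i j = mone i j" if "n \<le> i \<or> n \<le> j" for i j
  proof (cases "i = j")
    case False
    then show ?thesis using blk_mmul[OF b] that by (auto simp: blk_def mone_def)
  next
    case True
    then have "n \<le> i" using that by auto
    then have "u i k * v k j = (if k = i then 1 else 0)" for k
      using u v True by (auto simp: U_n_def mone_def)
    then have "mmul u v i j = (\<Sum>k<Suc i. if k = i then 1 else 0)"
      by (subst mmul_eq_sum[of "Suc i"]) auto
    then show ?thesis using True by (simp add: mone_def)
  qed
  show ?thesis unfolding U_n_def using 1 2 3 by auto
qed

lemma conjugate_by_eq_sum:
  assumes u: "u \<in> U_n n" and N: "n \<le> N" "i < N" "j < N"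
  shows "conjugate_by u B i j = (\<Sum>k<N. \<Sum>l<N. u i k * B k l * cnj (u j l))"
proof -
  have b: "blk n u" "blk n (madj u)" using U_n_blk[OF u] by auto
  have "conjugate_by u B i j = (\<Sum>l<N. mmul u B i l * cnj (u j l))"
    unfolding conjugate_by_def by (subst mmul_blkR[OF b(2) N(1,3)]) (simp add: madj_def)
  also have "\<dots> = (\<Sum>l<N. \<Sum>k<N. u i k * B k l * cnj (u j l))"
    by (simp add: mmul_blkL[OF b(1) N(1,2)] sum_distrib_right)
  finally show ?thesis by (subst sum.swap) 
qed

lemma conjugate_by_mmul:
  assumes u: "u \<in> U_n n" and v: "v \<in> U_n n"
  shows "conjugate_by u (conjugate_by v B) = conjugate_by (mmul u v) B"
proof -
  have b: "blk n u" "blk n v" using U_n_blk u v by auto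
  show ?thesis
    unfolding conjugate_by_def madj_mmul using b
    by (simp add: mmul_assoc_LM[of n] mmul_assoc_LR[of n] mmul_assoc_MR[of n] blk_mmul)
qed

lemma conjugate_by_mone [simp]: "conjugate_by mone B = B"
  by (simp add: conjugate_by_def)

lemma conjugate_by_madj_cancel:
  assumes u: "u \<in> U_n n"
  shows "conjugate_by (madj u) (conjugate_by u B) = B" "conjugate_by u (conjugate_by (madj u) B) = B"
  using conjugate_by_mmul[OF u U_n_madj[OF u]] conjugate_by_mmul[OF U_n_madj[OF u] u] u
  by (auto simp: U_n_def)

lemma conjugate_by_Herm:
  assumes u: "u \<in> U_n n" and B: "B \<in> Herm" shows "conjugate_by u B \<in> Herm"
proof -
  have b: "blk n u" "blk n (madj u)" using U_n_blk[OF u] by auto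
  show ?thesis using B b
    by (simp add: Herm_def conjugate_by_def madj_mmul mmul_assoc_LR[of n])
qed

lemma conjugate_by_Herm_n:
  assumes u: "u \<in> U_n n" and A: "A \<in> Herm_n n" shows "conjugate_by u A \<in> Herm_n n"
proof -
  have "conjugate_by u A i j = 0" if "n \<le> i \<or> n \<le> j" for i j
  proof -
    define N where "N = max n (max (Suc i) (Suc j))"
    have N: "n \<le> N" "i < N" "j < N" by (auto simp: N_def)
    have "u i k * A k l * cnj (u j l) = 0" for k l
    proof (cases "n \<le> k \<or> n \<le> l")
      case False
      then have "u i k = 0 \<or> u j l = 0" using u that by (auto simp: U_n_def mone_def)
      then show ?thesis by auto
    qed (use A in \<open>auto simp: Herm_n_def\<close>)
    then show ?thesis by (simp add: conjugate_by_eq_sum[OF u N])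
  qed
  moreover have "conjugate_by u A \<in> Herm" using conjugate_by_Herm[OF u] A by (auto simp: Herm_n_def)
  ultimately show ?thesis by (auto simp: Herm_n_def)
qed

lemma conjugate_by_add:
  assumes u: "u \<in> U_n n"
  shows "conjugate_by u (\<lambda>i j. A i j + B i j) = (\<lambda>i j. conjugate_by u A i j + conjugate_by u B i j)"
proof (intro ext)
  fix i j
  define N where "N = max n (max (Suc i) (Suc j))"
  have N: "n \<le> N" "i < N" "j < N" by (auto simp: N_def)
  show "conjugate_by u (\<lambda>i j. A i j + B i j) i j = conjugate_by u A i j + conjugate_by u B i j"
    by (simp add: conjugate_by_eq_sum[OF u N] algebra_simps sum.distrib)
qed

lemma conjugate_by_scale:
  assumes u: "u \<in> U_n n"
  shows "conjugate_by u (\<lambda>i j. c * A i j) = (\<lambda>i j. c * conjugate_by u A i j)"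
proof (intro ext)
  fix i j
  define N where "N = max n (max (Suc i) (Suc j))"
  have N: "n \<le> N" "i < N" "j < N" by (auto simp: N_def)
  show "conjugate_by u (\<lambda>i j. c * A i j) i j = c * conjugate_by u A i j"
    by (simp add: conjugate_by_eq_sum[OF u N] sum_distrib_left algebra_simps)
qed

text \<open>The reason why a fixed unitary does not see far away blocks. It gives the asymptotic
  invariance of the block averages, and it allows one diagonal block to be rotated without touching
  the other.\<close>

lemma conjugate_by_disjoint:
  assumes u: "u \<in> U_n n" and X: "\<And>i j. i < n \<or> j < n \<Longrightarrow> X i j = 0"
  shows "conjugate_by u X = X"
proof (intro ext)
  fix i j
  define N where "N = max n (max (Suc i) (Suc j))"
  have N: "n \<le> N" "i < N" "j < N" by (auto simp: N_def)
  have "u i k * X k l * cnj (u j l) = (if k = i then if l = j then X i j else 0 else 0)" for k l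
  proof (cases "k < n \<or> l < n")
    case True
    then show ?thesis using X[of k l] by auto
  next
    case False
    then have "u i k = mone i k" "u j l = mone j l" using u by (auto simp: U_n_def)
    then show ?thesis by (auto simp: mone_def)
  qed
  moreover have "(\<Sum>k<N. \<Sum>l<N. if k = i then if l = j then X i j else 0 else 0) = X i j"
    using N by (subst sum.swap) simp
  ultimately show "conjugate_by u X i j = X i j"
    unfolding conjugate_by_eq_sum[OF u N] by simp
qed

lemma Herm_cnj: "A \<in> Herm \<Longrightarrow> cnj (A j i) = A i j"
  unfolding Herm_def madj_def by (metis (mono_tags, lifting) mem_Collect_eq)

lemma HermI: "(\<And>i j. cnj (A j i) = A i j) \<Longrightarrow> A \<in> Herm"
  by (auto simp: Herm_def madj_def)

lemma Herm_nD: "A \<in> Herm_n n \<Longrightarrow> n \<le> i \<or> n \<le> j \<Longrightarrow> A i j = 0" "A \<in> Herm_n n \<Longrightarrow> A \<in> Herm"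
  by (auto simp: Herm_n_def)

lemma Herm_n_mono: "A \<in> Herm_n n \<Longrightarrow> n \<le> m \<Longrightarrow> A \<in> Herm_n m"
  by (auto simp: Herm_n_def)

lemma trace_eq_sum:
  assumes A: "A \<in> Herm_n n"
  shows "mtrace (mmul A B) = (\<Sum>i<n. \<Sum>k<n. A i k * B k i)"
proof -
  have m: "mmul A B i j = (\<Sum>k<n. A i k * B k j)" for i j
    by (rule mmul_eq_sum) (use A in \<open>auto simp: Herm_n_def\<close>)
  have "mtrace (mmul A B) = (\<Sum>i<n. mmul A B i i)"
    unfolding mtrace_def by (rule infsum_nat_lessThan) (use A in \<open>auto simp: Herm_n_def m\<close>)
  then show ?thesis by (simp add: m)
qed

lemma sum_swap4:
  fixes g :: "nat \<Rightarrow> nat \<Rightarrow> nat \<Rightarrow> nat \<Rightarrow> 'a :: comm_monoid_add"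
  shows "(\<Sum>i\<in>I. \<Sum>k\<in>K. \<Sum>p\<in>P. \<Sum>q\<in>Q. g i k p q) = (\<Sum>p\<in>P. \<Sum>q\<in>Q. \<Sum>k\<in>K. \<Sum>i\<in>I. g i k p q)"
proof -
  have "(\<Sum>i\<in>I. \<Sum>k\<in>K. \<Sum>p\<in>P. \<Sum>q\<in>Q. g i k p q) = (\<Sum>i\<in>I. \<Sum>p\<in>P. \<Sum>q\<in>Q. \<Sum>k\<in>K. g i k p q)"
    by (rule sum.cong[OF refl], subst sum.swap, rule sum.cong[OF refl], rule sum.swap)
  also have "\<dots> = (\<Sum>p\<in>P. \<Sum>q\<in>Q. \<Sum>i\<in>I. \<Sum>k\<in>K. g i k p q)"
    by (subst sum.swap, rule sum.cong[OF refl], rule sum.swap)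
  also have "\<dots> = (\<Sum>p\<in>P. \<Sum>q\<in>Q. \<Sum>k\<in>K. \<Sum>i\<in>I. g i k p q)"
    by (rule sum.cong[OF refl], rule sum.cong[OF refl], rule sum.swap)
  finally show ?thesis .
qed

text \<open>Cyclicity of the trace. Since \<open>A\<close> and its conjugate live in the
  \<open>n x n\<close> corner, only that corner of the infinite matrix \<open>B\<close> enters, and
  the claim is an exchange of four finite sums.\<close>

lemma trace_conjugate_by:
  assumes u: "u \<in> U_n n" and A: "A \<in> Herm_n n"
  shows "mtrace (mmul (conjugate_by u A) B) = mtrace (mmul A (conjugate_by (madj u) B))"
proof -
  have c1: "conjugate_by u A i k = (\<Sum>p<n. \<Sum>q<n. u i p * A p q * cnj (u k q))" if "i < n" "k < n" for i k
    by (rule conjugate_by_eq_sum[OF u order.refl that])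
  have c2: "conjugate_by (madj u) B q p = (\<Sum>k<n. \<Sum>i<n. cnj (u k q) * B k i * u i p)" if "q < n" "p < n" for q p
    using conjugate_by_eq_sum[OF U_n_madj[OF u] order.refl that, of B] by (simp add: madj_def)
  have "mtrace (mmul (conjugate_by u A) B)
      = (\<Sum>i<n. \<Sum>k<n. (\<Sum>p<n. \<Sum>q<n. u i p * A p q * cnj (u k q)) * B k i)"
    unfolding trace_eq_sum[OF conjugate_by_Herm_n[OF u A]]
    by (rule sum.cong[OF refl], rule sum.cong[OF refl]) (simp only: c1 lessThan_iff)
  also have "\<dots> = (\<Sum>i<n. \<Sum>k<n. \<Sum>p<n. \<Sum>q<n. A p q * (cnj (u k q) * B k i * u i p))"
    by (rule sum.cong[OF refl], rule sum.cong[OF refl])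
       (simp add: sum_distrib_right sum_distrib_left mult_ac)
  also have "\<dots> = (\<Sum>p<n. \<Sum>q<n. \<Sum>k<n. \<Sum>i<n. A p q * (cnj (u k q) * B k i * u i p))"
    by (rule sum_swap4)
  also have "\<dots> = (\<Sum>p<n. \<Sum>q<n. A p q * conjugate_by (madj u) B q p)"
    by (rule sum.cong[OF refl], rule sum.cong[OF refl]) (simp add: c2 sum_distrib_left)
  finally show ?thesis by (simp add: trace_eq_sum[OF A])
qed

definition diagm :: "(nat \<Rightarrow> complex) \<Rightarrow> cmat" where
  "diagm d = (\<lambda>i j. if i = j then d i else 0)"

lemma blk_diagm [simp]: "blk n (diagm d)"
  by (auto simp: blk_def diagm_def)

lemma conjugate_by_diagm:
  assumes u: "u \<in> U_n n" and N: "n \<le> N" "i < N" "j < N"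
  shows "conjugate_by u (diagm d) i j = (\<Sum>k<N. u i k * d k * cnj (u j k))"
  by (simp add: conjugate_by_eq_sum[OF u N] diagm_def if_distrib[of "\<lambda>x. _ * x"] if_distrib[of "\<lambda>x. x * _"] cong: if_cong)

section \<open>Diagonalisation of finite Hermitian matrices\<close>

text \<open>A complex Householder reflection; the condition on \<open>c\<close> says \<open>2 Re c = \<bar>c\<bar>\<^sup>2 \<bar>x\<bar>\<^sup>2\<close>.\<close>

lemma rank_one_unitary:
  fixes x :: "nat \<Rightarrow> complex"
  assumes x: "\<And>i. N \<le> i \<Longrightarrow> x i = 0"
    and c: "c + cnj c = c * cnj c * (\<Sum>l<N. x l * cnj (x l))"
  shows "(\<lambda>i j. mone i j - c * x i * cnj (x j)) \<in> U_n N"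
proof -
  define v where "v = (\<lambda>c i j. mone i j - c * x i * cnj (x j))"
  \<comment> \<open>Stated for every admissible \<open>c\<close>: the condition is symmetric under
    conjugation, so the instance \<open>cnj c\<close> is the other unitarity relation.\<close>
  have vu: "mmul (v c) (v (cnj c)) = mone" if c: "c + cnj c = c * cnj c * (\<Sum>l<N. x l * cnj (x l))" for c
  proof (intro ext)
    fix i j
    define M where "M = max N (max (Suc i) (Suc j))"
    have M: "N \<le> M" "i < M" "j < M" by (auto simp: M_def)
    have b: "blk N (v c)" using x by (auto simp: blk_def v_def mone_def)
    have S: "(\<Sum>l<M. x l * cnj (x l)) = (\<Sum>l<N. x l * cnj (x l))"
      by (rule sum.mono_neutral_right) (use M x in auto)
    have "mmul (v c) (v (cnj c)) i j = (\<Sum>l<M. v c i l * v (cnj c) l j)"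
      by (rule mmul_blkL[OF b M(1,2)])
    also have "\<dots> = (\<Sum>l<M. (if l = i then mone i j - cnj c * x i * cnj (x j) else 0)
                  - (if l = j then c * x i * cnj (x j) else 0)
                  + c * cnj c * x i * cnj (x j) * (x l * cnj (x l)))"
      by (rule sum.cong[OF refl]) (auto simp: v_def mone_def algebra_simps)
    also have "\<dots> = mone i j - cnj c * x i * cnj (x j) - c * x i * cnj (x j)
                  + c * cnj c * x i * cnj (x j) * (\<Sum>l<N. x l * cnj (x l))"
      using M by (simp add: sum.distrib sum_subtractf S flip: sum_distrib_left)
    also have "\<dots> = mone i j - (c + cnj c) * (x i * cnj (x j))
        + (c * cnj c * (\<Sum>l<N. x l * cnj (x l))) * (x i * cnj (x j))"
      by (simp add: algebra_simps)
    also have "\<dots> = mone i j" by (simp only: c) simp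
    finally show "mmul (v c) (v (cnj c)) i j = mone i j" .
  qed
  have adj: "madj (v c) = v (cnj c)"
    by (intro ext) (auto simp: madj_def v_def mone_def)
  have "mmul (v c) (v (cnj c)) = mone" by (rule vu[OF c])
  moreover have "mmul (v (cnj c)) (v c) = mone" using vu[of "cnj c"] c by (simp add: add.commute mult_ac)
  moreover have "v c i j = mone i j" if "N \<le> i \<or> N \<le> j" for i j
    using that x by (auto simp: v_def)
  ultimately have "v c \<in> U_n N" unfolding U_n_def by (auto simp: adj)
  then show ?thesis by (simp add: v_def)
qed

text \<open>A reflection along \<open>e_k - w\<close> carries the basis vector \<open>e_k\<close> to
  \<open>w\<close>. The last clause records that coordinates at which \<open>w\<close> vanishes are
  left alone; it is used later to compress the tail of a vector while fixing the first axis.\<close>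

lemma unitary_with_column:
  assumes k: "k < N" and w: "\<And>i. N \<le> i \<Longrightarrow> w i = 0" and w1: "(\<Sum>i<N. w i * cnj (w i)) = 1"
  shows "\<exists>u\<in>U_n N. (\<forall>i. u i k = w i) \<and> (\<forall>i j. w i = 0 \<and> i \<noteq> k \<longrightarrow> u i j = mone i j \<and> u j i = mone j i)"
proof (cases "w k = 1")
  case True
  have "(\<Sum>i\<in>{..<N}-{k}. (cmod (w i))\<^sup>2) = 0"
  proof -
    have "complex_of_real (\<Sum>i<N. (cmod (w i))\<^sup>2) = 1"
      using w1 by (simp add: complex_norm_square del: of_real_power)
    then have "(\<Sum>i<N. (cmod (w i))\<^sup>2) = 1" by (metis of_real_eq_1_iff)
    then show ?thesis using k True by (subst (asm) sum.remove[of _ k]) auto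
  qed
  then have "w i = 0" if "i < N" "i \<noteq> k" for i
    using that by (subst (asm) sum_nonneg_eq_0_iff) auto
  then have "w i = mone i k" for i using w True k by (cases "i < N") (auto simp: mone_def)
  then show ?thesis by (intro bexI[of _ mone]) auto
next
  case False
  define x where "x = (\<lambda>i. mone i k - w i)"
  \<comment> \<open>Chosen so that \<open>c * cnj (x k) = 1\<close>: column \<open>k\<close> of the
    reflection is then \<open>e_k - x = w\<close>. The denominator vanishes exactly when
    \<open>w k = 1\<close>, and there the unit norm has already forced
    \<open>w = e_k\<close>.\<close>
  define c where "c = 1 / (1 - cnj (w k))"
  have x0: "x i = 0" if "N \<le> i" for i using that w k by (auto simp: x_def mone_def)
  have nz: "1 - w k \<noteq> 0" "1 - cnj (w k) \<noteq> 0" using False by (auto simp: complex_eq_iff)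
  have "(\<Sum>l<N. x l * cnj (x l))
      = (\<Sum>l<N. (if l = k then 1 - w k - cnj (w k) else 0) + w l * cnj (w l))"
    by (rule sum.cong[OF refl]) (auto simp: x_def mone_def algebra_simps)
  also have "\<dots> = (1 - w k) + (1 - cnj (w k))" using k by (simp add: sum.distrib w1)
  finally have S: "(\<Sum>l<N. x l * cnj (x l)) = (1 - w k) + (1 - cnj (w k))" .
  have "c + cnj c = c * cnj c * (\<Sum>l<N. x l * cnj (x l))"
    unfolding S c_def using nz by (simp add: divide_simps)
  from rank_one_unitary[OF x0 this] have u: "(\<lambda>i j. mone i j - c * x i * cnj (x j)) \<in> U_n N" .
  have "mone i k - c * x i * cnj (x k) = w i" for i
  proof -
    have "c * cnj (x k) = 1" using nz by (simp add: x_def c_def mone_def)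
    then have "c * x i * cnj (x k) = x i" by (metis mult.assoc mult.commute mult_1)
    then have "mone i k - c * x i * cnj (x k) = mone i k - x i" by (rule arg_cong)
    then show ?thesis by (simp add: x_def)
  qed
  moreover have "x i = 0" if "w i = 0" "i \<noteq> k" for i using that by (simp add: x_def mone_def)
  ultimately show ?thesis using u by (intro bexI[OF _ u]) auto
qed

text \<open>Complex spectra are non-empty. The eigenvector is normalised and extended by zero, the
  form in which \<open>unitary_with_column\<close> accepts it as a column.\<close>

lemma Herm_n_eigenvector:
  fixes A :: cmat and n :: nat
  assumes n: "n > 0"
  obtains v \<mu> where "\<And>i. n \<le> i \<Longrightarrow> v i = 0" "(\<Sum>i<n. v i * cnj (v i)) = (1::complex)"
    "\<And>i. i < n \<Longrightarrow> (\<Sum>k<n. A i k * v k) = \<mu> * v i"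
proof -
  define a where "a = mat n n (\<lambda>(i, j). A i j)"
  have a: "a \<in> carrier_mat n n" by (simp add: a_def)
  obtain \<mu> where "eigenvalue a \<mu>" using spectrum_non_empty[OF a n] by (auto simp: spectrum_def)
  then obtain y where y: "y \<in> carrier_vec n" "y \<noteq> 0\<^sub>v n" "a *\<^sub>v y = \<mu> \<cdot>\<^sub>v y"
    using a by (auto simp: eigenvalue_def eigenvector_def)
  define r where "r = (\<Sum>i<n. (cmod (y $ i))\<^sup>2)"
  have "\<exists>i<n. y $ i \<noteq> 0" using y by (metis carrier_vecD eq_vecI index_zero_vec)
  then have r: "r > 0" unfolding r_def
    by (metis (no_types, lifting) finite_lessThan lessThan_iff norm_eq_zero power2_less_eq_zero_iff
        power_eq_0_iff sum_pos2 zero_le_power2 zero_less_norm_iff zero_less_power)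
  define v where "v = (\<lambda>i. if i < n then y $ i / sqrt r else 0)"
  have "(\<Sum>i<n. v i * cnj (v i)) = (\<Sum>i<n. complex_of_real ((cmod (y $ i))\<^sup>2 / r))"
  proof (rule sum.cong[OF refl])
    fix i assume "i \<in> {..<n}"
    then have "v i * cnj (v i) = complex_of_real ((cmod (v i))\<^sup>2)" "cmod (v i) = cmod (y $ i) / sqrt r"
      using r by (simp only: complex_norm_square, simp add: v_def norm_divide)
    then show "v i * cnj (v i) = complex_of_real ((cmod (y $ i))\<^sup>2 / r)"
      using r by (simp add: power_divide)
  qed
  also have "\<dots> = complex_of_real (\<Sum>i<n. (cmod (y $ i))\<^sup>2 / r)" by simp
  also have "(\<Sum>i<n. (cmod (y $ i))\<^sup>2 / r) = 1"
    using r by (simp add: r_def flip: sum_divide_distrib)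
  finally have 1: "(\<Sum>i<n. v i * cnj (v i)) = 1" by simp
  have 2: "(\<Sum>k<n. A i k * v k) = \<mu> * v i" if i: "i < n" for i
  proof -
    have "(a *\<^sub>v y) $ i = \<mu> * y $ i" using y i by simp
    moreover have "(a *\<^sub>v y) $ i = (\<Sum>k<n. A i k * y $ k)"
      using y(1) i by (simp add: a_def scalar_prod_def atLeast0LessThan)
    ultimately show ?thesis using i by (simp add: v_def sum_divide_distrib[symmetric])
  qed
  show ?thesis using that[of v \<mu>] 1 2 by (auto simp: v_def)
qed

text \<open>Deflation: once a unit eigenvector is the last column of a unitary, the conjugated
  matrix has a last column, and by Hermitian symmetry a last row, that vanishes off the diagonal.
  Symmetry also makes the diagonal entry real.\<close>

theorem Herm_n_diagonalise:
  assumes "A \<in> Herm_n n"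
  shows "\<exists>u\<in>U_n n. \<exists>d :: nat \<Rightarrow> real. (\<forall>k\<ge>n. d k = 0) \<and> A = conjugate_by u (diagm (\<lambda>k. of_real (d k)))"
  using assms
proof (induction n arbitrary: A)
  case 0
  then have "A i j = 0" for i j by (auto simp: Herm_n_def)
  then have "A = diagm (\<lambda>k. of_real ((\<lambda>_. 0) k))" by (intro ext) (simp add: diagm_def)
  then show ?case by (intro bexI[of _ mone] exI[of _ "\<lambda>_. 0"]) auto
next
  case (Suc n)
  obtain v \<mu> where v: "\<And>i. Suc n \<le> i \<Longrightarrow> v i = 0" "(\<Sum>i<Suc n. v i * cnj (v i)) = 1"
    "\<And>i. i < Suc n \<Longrightarrow> (\<Sum>k<Suc n. A i k * v k) = \<mu> * v i"
    using Herm_n_eigenvector[of "Suc n" A thesis] by blast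
  obtain u1 where u1: "u1 \<in> U_n (Suc n)" "\<And>i. u1 i n = v i"
    using unitary_with_column[OF lessI v(1,2)] by blast
  define A' where "A' = conjugate_by (madj u1) A"
  have A': "A' \<in> Herm_n (Suc n)" unfolding A'_def
    by (rule conjugate_by_Herm_n[OF U_n_madj[OF u1(1)] Suc.prems])
  have col: "A' i n = \<mu> * mone i n" if i: "i < Suc n" for i
  proof -
    have "A' i n = (\<Sum>k<Suc n. \<Sum>l<Suc n. cnj (u1 k i) * A k l * v l)"
      unfolding A'_def using conjugate_by_eq_sum[OF U_n_madj[OF u1(1)] order.refl i lessI, of A]
      by (simp add: madj_def u1(2))
    also have "\<dots> = (\<Sum>k<Suc n. cnj (u1 k i) * (\<Sum>l<Suc n. A k l * v l))"
      by (simp only: sum_distrib_left mult.assoc)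
    also have "\<dots> = (\<Sum>k<Suc n. \<mu> * (cnj (u1 k i) * u1 k n))"
      by (rule sum.cong[OF refl]) (simp only: v(3) lessThan_iff, simp add: u1(2))
    also have "\<dots> = \<mu> * (\<Sum>k<Suc n. madj u1 i k * u1 k n)"
      by (simp only: sum_distrib_left madj_def)
    also have "\<dots> = \<mu> * mmul (madj u1) u1 i n"
      by (subst mmul_blkL[OF U_n_blk[OF U_n_madj[OF u1(1)]] order.refl i]) simp
    finally show ?thesis using u1(1) by (simp add: U_n_def)
  qed
  have "cnj \<mu> = \<mu>" using col[of n] Herm_cnj[OF Herm_nD(2)[OF A'], of n n] by (simp add: mone_def)
  then obtain m where m: "\<mu> = of_real m" by (metis Reals_cnj_iff Reals_cases)
  \<comment> \<open>\<open>A'\<close> is the direct sum of its leading corner \<open>A2\<close> and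
    of the entry \<open>m\<close> at position \<open>n\<close>. The latter, as \<open>X\<close>, is
    fixed by \<open>u2\<close>, which moves only the first \<open>n\<close> coordinates.\<close>
  define A2 where "A2 = (\<lambda>i j. if i < n \<and> j < n then A' i j else 0)"
  have "A2 \<in> Herm_n n" using Herm_cnj[OF Herm_nD(2)[OF A']]
    by (auto simp: A2_def Herm_n_def intro!: HermI)
  then obtain u2 d where u2: "u2 \<in> U_n n" "\<And>k. k \<ge> n \<Longrightarrow> d k = 0"
    "A2 = conjugate_by u2 (diagm (\<lambda>k. of_real (d k)))" using Suc.IH by blast
  define X where "X = diagm (\<lambda>k. if k = n then of_real m else 0)"
  have split: "diagm (\<lambda>k. of_real ((d(n := m)) k)) = (\<lambda>i j. diagm (\<lambda>k. of_real (d k)) i j + X i j)"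
    using u2(2) by (intro ext) (auto simp: X_def diagm_def)
  have X: "conjugate_by u2 X = X"
    by (rule conjugate_by_disjoint[OF u2(1)]) (auto simp: X_def diagm_def)
  have row: "A' n i = \<mu> * mone i n" if "i < Suc n" for i
    using Herm_cnj[OF Herm_nD(2)[OF A'], of i n] col[OF that] \<open>cnj \<mu> = \<mu>\<close> by (simp add: mone_def split: if_splits)
  have "A2 i j + X i j = A' i j" for i j
    using col[of i] row[of j] Herm_nD(1)[OF A', of i j]
    by (cases "i < n"; cases "j < n"; cases "i = n"; cases "j = n") (auto simp: A2_def X_def diagm_def m mone_def)
  then have "A' = conjugate_by u2 (diagm (\<lambda>k. of_real ((d(n := m)) k)))"
    unfolding split conjugate_by_add[OF u2(1)] X u2(3)[symmetric] by (intro ext) simp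
  then have "conjugate_by u1 A' = conjugate_by (mmul u1 u2) (diagm (\<lambda>k. of_real ((d(n := m)) k)))"
    using conjugate_by_mmul[OF u1(1) U_n_mono[OF u2(1)]] by simp
  moreover have "conjugate_by u1 A' = A" unfolding A'_def by (rule conjugate_by_madj_cancel(2)[OF u1(1)])
  ultimately show ?case using U_n_mmul[OF u1(1) U_n_mono[OF u2(1)]] u2(2)
    by (intro bexI[of _ "mmul u1 u2"] exI[of _ "d(n := m)"]) auto
qed

section \<open>Permutation matrices and translates of diagonal blocks\<close>

lemma permutation_unitary:
  assumes \<pi>: "\<And>i. \<pi> (\<rho> i) = i" "\<And>i. \<rho> (\<pi> i) = i" and fix_\<pi>: "\<And>i. N \<le> i \<Longrightarrow> \<pi> i = i"
  defines "u \<equiv> (\<lambda>i j. if i = \<pi> j then 1 else 0) :: cmat"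
  shows "u \<in> U_n N" "conjugate_by u A i j = A (\<rho> i) (\<rho> j)"
proof -
  have eq: "i = \<pi> j \<longleftrightarrow> j = \<rho> i" for i j using \<pi> by metis
  have u: "u i j = (if j = \<rho> i then 1 else 0)" for i j by (simp add: u_def eq)
  have fix_\<rho>: "\<rho> i = i" if "N \<le> i" for i using fix_\<pi>[OF that] \<pi> by metis
  have less: "\<rho> i < M" "\<pi> i < M" if "N \<le> M" "i < M" for i M
    using that fix_\<pi>[of "\<rho> i"] fix_\<rho>[of "\<pi> i"] \<pi>  by (metis leD le_trans not_le)+
  have out: "u i j = mone i j" if "N \<le> i \<or> N \<le> j" for i j
    using that fix_\<pi> fix_\<rho> unfolding mone_def by (metis u_def u)
  have b: "blk N u" using out by (auto simp: blk_def mone_def)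
  have "mmul u (madj u) = mone"
  proof (intro ext)
    fix i j
    define M where "M = max N (Suc i)"
    have M: "N \<le> M" "i < M" by (auto simp: M_def)
    have "mmul u (madj u) i j = (\<Sum>k<M. if k = \<rho> i then u j (\<rho> i) else 0)"
      unfolding mmul_blkL[OF b M] by (rule sum.cong[OF refl]) (auto simp: u madj_def)
    then show "mmul u (madj u) i j = mone i j" using less(1)[OF M] \<pi> by (auto simp: u mone_def) (metis)
  qed
  moreover have "mmul (madj u) u = mone"
  proof (intro ext)
    fix i j
    define M where "M = max N (Suc i)"
    have M: "N \<le> M" "i < M" by (auto simp: M_def)
    have b': "blk N (madj u)" using b by simp
    have "mmul (madj u) u i j = (\<Sum>k<M. if k = \<pi> i then u (\<pi> i) j else 0)"
      unfolding mmul_blkL[OF b' M] by (rule sum.cong[OF refl]) (auto simp: u_def madj_def)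
    then show "mmul (madj u) u i j = mone i j" using less(2)[OF M] \<pi> by (auto simp: u mone_def)
  qed
  ultimately show U: "u \<in> U_n N" using out by (auto simp: U_n_def)
  define M where "M = max N (max (Suc i) (Suc j))"
  have M: "N \<le> M" "i < M" "j < M" by (auto simp: M_def)
  have "conjugate_by u A i j = (\<Sum>k<M. \<Sum>l<M. if l = \<rho> j then if k = \<rho> i then A (\<rho> i) (\<rho> j) else 0 else 0)"
    unfolding conjugate_by_eq_sum[OF U M]
    by (rule sum.cong[OF refl], rule sum.cong[OF refl]) (auto simp: u)
  then show "conjugate_by u A i j = A (\<rho> i) (\<rho> j)" using less(1)[OF M(1)] M by simp
qed

definition shiftm :: "nat \<Rightarrow> cmat \<Rightarrow> cmat" where
  "shiftm L A = (\<lambda>i j. if L \<le> i \<and> L \<le> j then A (i - L) (j - L) else 0)"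

lemma shiftm_0 [simp]: "shiftm 0 A = A"
  by (simp add: shiftm_def)

lemma shiftm_Herm_n:
  assumes "A \<in> Herm_n n" shows "shiftm L A \<in> Herm_n (L + n)"
proof -
  have "shiftm L A \<in> Herm" using Herm_cnj[OF Herm_nD(2)[OF assms]] by (intro HermI) (auto simp: shiftm_def)
  then show ?thesis using Herm_nD(1)[OF assms] 
    unfolding Herm_n_def shiftm_def by (force simp: le_diff_conv2)
qed

text \<open>Write an index as \<open>b * n + r\<close> with \<open>r < n\<close>: permuting the
  block numbers and keeping the remainders is a finite permutation. A single unitary serves all
  \<open>A\<close> and all blocks, so that several blocks can be moved simultaneously.\<close>

lemma block_permutation:
  assumes n: "n > 0" and \<sigma>: "\<sigma> permutes {..<m}"
  shows "\<exists>u\<in>U_n (m * n). \<forall>A\<in>Herm_n n. \<forall>b. conjugate_by u (shiftm (b * n) A) = shiftm (\<sigma> b * n) A"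
proof -
  define \<pi> where "\<pi> = (\<lambda>i. \<sigma> (i div n) * n + i mod n)"
  define \<rho> where "\<rho> = (\<lambda>i. inv_into UNIV \<sigma> (i div n) * n + i mod n)"
  have 1: "\<pi> (\<rho> i) = i" "\<rho> (\<pi> i) = i" for i
    using n permutes_inverses[OF \<sigma>] by (simp_all add: \<pi>_def \<rho>_def)
  have 2: "\<pi> i = i" if "m * n \<le> i" for i
  proof -
    have "m \<le> i div n" using that n by (simp add: less_eq_div_iff_mult_less_eq)
    then show ?thesis using permutes_not_in[OF \<sigma>, of "i div n"] by (simp add: \<pi>_def)
  qed
  note u = permutation_unitary[where \<pi> = \<pi> and \<rho> = \<rho> and N = "m * n", OF 1 2]
  have "shiftm (b * n) A (\<rho> i) (\<rho> j) = shiftm (\<sigma> b * n) A i j" if A: "A \<in> Herm_n n" for A b i j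
  proof -
    have key: "shiftm (c * n) A i j = (if i div n = c \<and> j div n = c then A (i mod n) (j mod n) else 0)" for c i j
    proof (cases "i div n = c \<and> j div n = c")
      case True
      then have "i = c * n + i mod n" "j = c * n + j mod n" by (metis div_mult_mod_eq)+
      then show ?thesis using True unfolding shiftm_def
        by (metis add_diff_cancel_left' le_add1)
    next
      case False
      have "c * n + n \<le> i \<or> c * n + n \<le> j \<or> i < c * n \<or> j < c * n"
      proof (rule ccontr)
        assume "\<not> ?thesis"
        then have "i div n = c" "j div n = c"
          by (auto intro!: div_nat_eqI simp: algebra_simps)
        then show False using False by simp
      qed
      then show ?thesis using False Herm_nD(1)[OF A, of "i - c * n" "j - c * n"]
        by (auto simp: shiftm_def le_diff_conv2 add.commute)
    qed
    have "\<rho> i div n = inv_into UNIV \<sigma> (i div n)" "\<rho> i mod n = i mod n" for i using n by (simp_all add: \<rho>_def)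
    moreover have "inv_into UNIV \<sigma> k = b \<longleftrightarrow> k = \<sigma> b" for k using permutes_inv_eq[OF \<sigma>] by metis
    ultimately show ?thesis by (simp add: key)
  qed
  then show ?thesis using u by (intro bexI[OF _ u(1)]) (auto intro!: ext)
qed

lemma tendsto_funI:
  fixes X :: "nat \<Rightarrow> 'i \<Rightarrow> 'b :: topological_space"
  assumes "\<And>i. (\<lambda>m. X m i) \<longlonglongrightarrow> L i" shows "X \<longlonglongrightarrow> L"
  using assms unfolding limitin_canonical_iff[symmetric] euclidean_product_topology[symmetric]
    limitin_componentwise by auto

section \<open>Functional calculus of the parametrised functions\<close>

text \<open>Functional calculus in a fixed eigenbasis: every operation occurring in
  \<open>f_param\<close> acts on matrices of this form through the diagonal \<open>d\<close>
  alone.\<close>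

abbreviation (input) conjd :: "cmat \<Rightarrow> (nat \<Rightarrow> complex) \<Rightarrow> cmat" where
  "conjd u d \<equiv> conjugate_by u (diagm d)"

lemma conjd_one: "u \<in> U_n n \<Longrightarrow> conjd u (\<lambda>_. 1) = mone"
proof -
  assume u: "u \<in> U_n n"
  have "diagm (\<lambda>_. 1) = mone" by (intro ext) (simp add: diagm_def mone_def)
  then show ?thesis using u by (simp add: conjugate_by_def U_n_def)
qed

lemma mmul_diagm: "mmul (diagm d) (diagm e) = diagm (\<lambda>k. d k * e k)"
proof (intro ext)
  fix i j
  have "mmul (diagm d) (diagm e) i j = (\<Sum>k<Suc i. if k = i then d i * diagm e i j else 0)"
    unfolding mmul_blkL[OF blk_diagm le0 lessI]
    by (rule sum.cong[OF refl]) (simp add: diagm_def)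
  then show "mmul (diagm d) (diagm e) i j = diagm (\<lambda>k. d k * e k) i j"
    by (simp add: diagm_def)
qed

lemma conjd_mmul:
  assumes u: "u \<in> U_n n"
  shows "mmul (conjd u d) (conjd u e) = conjd u (\<lambda>k. d k * e k)"
proof -
  have b: "blk n u" "blk n (madj u)" "blk n (diagm d)" "blk n (diagm e)" using U_n_blk[OF u] by auto
  have "mmul (conjd u d) (conjd u e)
      = mmul u (mmul (diagm d) (mmul (mmul (madj u) u) (mmul (diagm e) (madj u))))"
    unfolding conjugate_by_def using b by (simp add: mmul_assoc_LM[of n] blk_mmul)
  also have "\<dots> = mmul u (mmul (diagm (\<lambda>k. d k * e k)) (madj u))"
    using u mmul_assoc_LM[OF b(3,4), symmetric] by (simp add: U_n_def mmul_diagm)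
  also have "\<dots> = conjd u (\<lambda>k. d k * e k)"
    unfolding conjugate_by_def using b by (simp add: mmul_assoc_LM[of n])
  finally show ?thesis .
qed

lemma conjd_blk: "u \<in> U_n n \<Longrightarrow> blk n (conjd u d)"
  unfolding conjugate_by_def by (intro blk_mmul) (auto simp: U_n_blk)

lemma conjd_mpow: "u \<in> U_n n \<Longrightarrow> mpow (conjd u d) m = conjd u (\<lambda>k. d k ^ m)"
  by (induction m) (simp_all add: conjd_one conjd_mmul mult.commute)

text \<open>The cutoff does not depend on \<open>d\<close>, so series and limits in \<open>d\<close>
  pass entrywise through one and the same finite sum.\<close>

lemma conjd_eq_sum_common:
  assumes u: "u \<in> U_n n"
  obtains N where "n \<le> N" "\<And>d. conjd u d i j = (\<Sum>k<N. u i k * d k * cnj (u j k))"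
proof
  define N where "N = max n (max (Suc i) (Suc j))"
  have N: "n \<le> N" "i < N" "j < N" by (auto simp: N_def)
  show "n \<le> N" by fact
  show "conjd u d i j = (\<Sum>k<N. u i k * d k * cnj (u j k))" for d
    by (rule conjugate_by_diagm[OF u N])
qed

lemma conjd_mexp:
  assumes u: "u \<in> U_n n" shows "mexp (conjd u d) = conjd u (\<lambda>k. exp (d k))"
proof (intro ext)
  fix i j
  obtain N where N: "n \<le> N" "\<And>d. conjd u d i j = (\<Sum>k<N. u i k * d k * cnj (u j k))"
    using conjd_eq_sum_common[OF u] by blast
  have "d k ^ m / fact m = d k ^ m /\<^sub>R fact m" for k m
    by (simp add: scaleR_conv_of_real field_simps)
  then have "(\<lambda>m. d k ^ m / fact m) sums exp (d k)" for k
    using exp_converges[of "d k"] by simp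
  then have "(\<lambda>m. \<Sum>k<N. u i k * (d k ^ m / fact m) * cnj (u j k)) sums (\<Sum>k<N. u i k * exp (d k) * cnj (u j k))"
    by (intro sums_sum sums_mult2 sums_mult)
  then have "(\<lambda>m. mpow (conjd u d) m i j / fact m) sums conjd u (\<lambda>k. exp (d k)) i j"
    unfolding conjd_mpow[OF u] N(2) sum_divide_distrib by simp
  then show "mexp (conjd u d) i j = conjd u (\<lambda>k. exp (d k)) i j"
    unfolding mexp_def by (simp add: sums_iff)
qed

lemma conjd_minv:
  assumes u: "u \<in> U_n n" and d: "\<And>k. d k \<noteq> 0" shows "minv (conjd u d) = conjd u (\<lambda>k. 1 / d k)"
proof -
  let ?A = "conjd u d" and ?C = "conjd u (\<lambda>k. 1 / d k)"
  have 1: "mmul ?A ?C = mone" "mmul ?C ?A = mone"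
    using d by (simp_all add: conjd_mmul[OF u] conjd_one[OF u])
  \<comment> \<open>\<open>minv\<close> needs uniqueness among all infinite matrices; associativity
    holds for arbitrary \<open>B\<close> because the two factors to its left are
    block-plus-diagonal.\<close>
  have "B = ?C" if "mmul ?A B = mone" for B
  proof -
    have "B = mmul (mmul ?C ?A) B" by (simp add: 1)
    also have "\<dots> = mmul ?C (mmul ?A B)"
      using conjd_blk[OF u] by (intro mmul_assoc_LM) auto
    finally show ?thesis by (simp add: that)
  qed
  then show ?thesis unfolding minv_def using 1 by (intro the_equality conjI; blast)
qed

lemma conjd_mscale: "u \<in> U_n n \<Longrightarrow> mscale c (conjd u d) = conjd u (\<lambda>k. c * d k)"
proof -
  assume u: "u \<in> U_n n"
  have "diagm (\<lambda>k. c * d k) = (\<lambda>i j. c * diagm d i j)" by (intro ext) (simp add: diagm_def)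
  then show ?thesis by (simp add: mscale_def conjugate_by_scale[OF u])
qed

lemma conjd_mminus: "u \<in> U_n n \<Longrightarrow> mminus (conjd u d) (conjd u e) = conjd u (\<lambda>k. d k - e k)"
proof (intro ext)
  fix i j assume u: "u \<in> U_n n"
  obtain N where N: "n \<le> N" "\<And>d. conjd u d i j = (\<Sum>k<N. u i k * d k * cnj (u j k))"
    using conjd_eq_sum_common[OF u] by blast
  show "mminus (conjd u d) (conjd u e) i j = conjd u (\<lambda>k. d k - e k) i j"
    by (simp add: mminus_def N(2) algebra_simps sum_subtractf)
qed

lemma conjd_mprod: "u \<in> U_n n \<Longrightarrow> mprod (\<lambda>m. conjd u (g m)) K = conjd u (\<lambda>k. \<Prod>m<K. g m k)"
  by (induction K) (simp_all add: conjd_one conjd_mmul)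

lemma conjd_mprodinf:
  assumes u: "u \<in> U_n n" and g: "\<And>k. (\<lambda>K. \<Prod>m<K. g m k) \<longlonglongrightarrow> P k"
  shows "mprodinf (\<lambda>m. conjd u (g m)) = conjd u P"
  unfolding mprodinf_def
proof (rule limI, intro tendsto_funI)
  fix i j
  obtain N where N: "n \<le> N" "\<And>d. conjd u d i j = (\<Sum>k<N. u i k * d k * cnj (u j k))"
    using conjd_eq_sum_common[OF u] by blast
  show "(\<lambda>K. mprod (\<lambda>m. conjd u (g m)) K i j) \<longlonglongrightarrow> conjd u P i j"
    unfolding conjd_mprod[OF u] N(2)
    by (rule tendsto_sum, rule tendsto_mult[OF tendsto_mult[OF tendsto_const g] tendsto_const])
qed

text \<open>Truncation at \<open>N \<ge> n\<close> is multiplicative on block-plus-diagonal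
  matrices, so the truncated unitaries still have determinants with product 1, and the sequence of
  corner determinants is constant from \<open>n\<close> on.\<close>

lemma conjd_mdet:
  assumes u: "u \<in> U_n n" and d: "\<And>k. n \<le> k \<Longrightarrow> d k = 1"
  shows "mdet (conjd u d) = (\<Prod>k<n. d k)"
proof -
  define T where "T = (\<lambda>(N::nat) (A::cmat). Matrix.mat N N (\<lambda>(i, j). A i j))"
  have T: "T N A \<in> carrier_mat N N" for N A by (simp add: T_def)
  have Tm: "T N (mmul A B) = T N A * T N B" if "blk n A" "n \<le> N" for N A B
    by (rule eq_matI) (simp_all add: T_def scalar_prod_def atLeast0LessThan mmul_blkL[OF that])
  have "Determinant.det (T N (conjd u d)) = (\<Prod>k<n. d k)" if N: "n \<le> N" for N
  proof -
    have b: "blk n u" "blk n (madj u)" using U_n_blk[OF u] by auto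
    have e: "T N (conjd u d) = T N u * T N (diagm d) * T N (madj u)"
      unfolding conjugate_by_def using b by (simp add: Tm[OF _ N] blk_mmul)
    have "T N u * T N (madj u) = T N mone" using u Tm[OF b(1) N, of "madj u"] by (simp add: U_n_def)
    moreover have "T N mone = 1\<^sub>m N" by (rule eq_matI) (auto simp: T_def mone_def)
    ultimately have "Determinant.det (T N u) * Determinant.det (T N (madj u)) = 1"
      by (metis T Determinant.det_mult Determinant.det_one)
    moreover have "Determinant.det (T N (conjd u d)) =
        Determinant.det (T N u) * Determinant.det (T N (diagm d)) * Determinant.det (T N (madj u))"
      unfolding e using T by (metis Determinant.det_mult mult_carrier_mat)
    ultimately have "Determinant.det (T N (conjd u d)) = Determinant.det (T N (diagm d))"
      by (metis mult.assoc mult.commute mult.right_neutral)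
    also have "\<dots> = prod_list (diag_mat (T N (diagm d)))"
      by (rule det_upper_triangular[OF _ T]) (auto simp: T_def diagm_def)
    also have "\<dots> = (\<Prod>k<N. d k)"
      by (simp add: T_def diag_mat_def diagm_def prod.distinct_set_conv_list[symmetric] atLeast0LessThan
          cong: map_cong)
    also have "\<dots> = (\<Prod>k<n. d k)"
      by (rule prod.mono_neutral_right) (use N d in auto)
    finally show ?thesis .
  qed
  then have "(\<lambda>N. Determinant.det (T N (conjd u d))) \<longlonglongrightarrow> (\<Prod>k<n. d k)"
    by (intro tendsto_eventually eventually_sequentiallyI[of n]) auto
  then show ?thesis unfolding mdet_def T_def by (rule limI)
qed

lemma conjd_mtrace:
  assumes u: "u \<in> U_n n" and d: "\<And>k. n \<le> k \<Longrightarrow> d k = 0"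
  shows "mtrace (conjd u d) = (\<Sum>k<n. d k)"
proof -
  have e: "conjd u d i i = (\<Sum>k<n. u i k * d k * cnj (u i k))" for i
  proof -
    have "conjd u d i i = (\<Sum>k<max n (Suc i). u i k * d k * cnj (u i k))"
      by (rule conjugate_by_diagm[OF u]) auto
    also have "\<dots> = (\<Sum>k<n. u i k * d k * cnj (u i k))"
      by (rule sum.mono_neutral_right) (use d in auto)
    finally show ?thesis .
  qed
  have "mtrace (conjd u d) = (\<Sum>i<n. conjd u d i i)"
    unfolding mtrace_def
  proof (rule infsum_nat_lessThan)
    fix i assume "n \<le> i"
    then show "conjd u d i i = 0" using u
      unfolding e by (intro sum.neutral) (auto simp: U_n_def mone_def)
  qed
  also have "\<dots> = (\<Sum>k<n. d k * (\<Sum>i<n. cnj (u i k) * u i k))"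
    unfolding e by (subst sum.swap) (simp add: sum_distrib_left mult_ac)
  also have "\<dots> = (\<Sum>k<n. d k)"
  proof (rule sum.cong[OF refl])
    fix k assume k: "k \<in> {..<n}"
    have "mmul (madj u) u k k = (\<Sum>i<n. cnj (u i k) * u i k)"
      using mmul_blkL[OF U_n_blk[OF U_n_madj[OF u]] order.refl, of k u k] k
      by (simp add: madj_def[of u])
    then show "d k * (\<Sum>i<n. cnj (u i k) * u i k) = d k"
      using u by (simp add: U_n_def mone_def)
  qed
  finally show ?thesis .
qed

text \<open>Both sides only involve the eigenvalues: traces become sums, the determinant becomes a
  product, and the infinite matrix product is taken eigenvalue by eigenvalue. The factors have no
  poles since \<open>1 - \<i> * x * a\<close> has real part 1.\<close>

lemma f_param_eq_prod:
  assumes u: "u \<in> U_n n" and d: "\<And>k. n \<le> k \<Longrightarrow> d k = 0"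
    and conv: "\<And>a. (\<lambda>K. \<Prod>k<K. exp (- (\<i> * x k * a)) / (1 - \<i> * x k * complex_of_real a))
        \<longlonglongrightarrow> prodinf (\<lambda>k. exp (- (\<i> * x k * a)) / (1 - \<i> * x k * a))"
  shows "f_param \<gamma>1 \<gamma>2 x (conjd u (\<lambda>k. complex_of_real (d k))) = (\<Prod>k<n. F_param \<gamma>1 \<gamma>2 x (d k))"
proof -
  let ?A = "conjd u (\<lambda>k. complex_of_real (d k))"
  define E where "E = (\<lambda>m k. exp (- (\<i> * x m * d k)) / (1 - \<i> * x m * complex_of_real (d k)))"
  define P where "P = (\<lambda>k. prodinf (\<lambda>m. E m k))"
  have nz: "1 - \<i> * complex_of_real y * complex_of_real a \<noteq> 0" for y a
    by (simp add: complex_eq_iff)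
  have one: "mminus mone (conjd u e) = conjd u (\<lambda>k. 1 - e k)" for e
    using conjd_mminus[OF u, of "\<lambda>_. 1" e] by (simp add: conjd_one[OF u])
  have "mmul (mexp (mscale (- (\<i> * x m)) ?A)) (minv (mminus mone (mscale (\<i> * x m) ?A))) = conjd u (E m)" for m
    using nz[of "x m"] by (simp add: conjd_mscale[OF u] one conjd_mexp[OF u] conjd_minv[OF u] conjd_mmul[OF u] E_def mult.assoc)
  then have 1: "mprodinf (\<lambda>m. mmul (mexp (mscale (- (\<i> * x m)) ?A)) (minv (mminus mone (mscale (\<i> * x m) ?A)))) = conjd u P"
    using conjd_mprodinf[OF u, of E P] conv unfolding P_def E_def by simp
  have "P k = 1" if "n \<le> k" for k
    using d[OF that] by (simp add: P_def E_def)
  then have 2: "mdet (conjd u P) = (\<Prod>k<n. P k)" by (rule conjd_mdet[OF u])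
  have 3: "mtrace ?A = (\<Sum>k<n. of_real (d k))" "mtrace (mmul ?A ?A) = (\<Sum>k<n. of_real (d k) * of_real (d k))"
    using d by (auto simp: conjd_mmul[OF u] intro!: conjd_mtrace[OF u])
  have "f_param \<gamma>1 \<gamma>2 x ?A = exp (\<Sum>k<n. \<i> * \<gamma>1 * d k - \<gamma>2 * (d k)\<^sup>2 / 2) * (\<Prod>k<n. P k)"
    unfolding f_param_def 1 2 3
    by (simp add: sum_subtractf sum_distrib_left sum_divide_distrib power2_eq_square)
  also have "\<dots> = (\<Prod>k<n. F_param \<gamma>1 \<gamma>2 x (d k))"
    by (simp add: exp_sum F_param_def P_def E_def prod.distrib)
  finally show ?thesis .
qed

section \<open>Joint characteristic functions determine joint laws\<close>

text \<open>Coordinates are converted from exponentials to indicators one at a time by the one-dimensional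
  uniqueness theorem. It needs positive weights, which is why the remaining exponential enters through
  \<open>1 + cos\<close> and \<open>1 + sin\<close>.\<close>

lemma weighted_char_eq_imp_indicator_eq:
  fixes X :: "'a \<Rightarrow> real" and Y :: "'b \<Rightarrow> real" and W :: "'a \<Rightarrow> real" and V :: "'b \<Rightarrow> real"
  assumes "prob_space M" "prob_space N"
    and [measurable]: "X \<in> borel_measurable M" "Y \<in> borel_measurable N"
      "W \<in> borel_measurable M" "V \<in> borel_measurable N"
    and W: "\<And>w. 0 \<le> W w" "\<And>w. W w \<le> C" and V: "\<And>w. 0 \<le> V w" "\<And>w. V w \<le> C"
    and eq: "\<And>s. (LINT w|M. W w *\<^sub>R iexp (s * X w)) = (LINT w|N. V w *\<^sub>R iexp (s * Y w))"
    and S[measurable]: "S \<in> sets borel"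
  shows "(LINT w|M. W w * indicator S (X w)) = (LINT w|N. V w * indicator S (Y w))"
proof -
  interpret M: prob_space M by fact
  interpret N: prob_space N by fact
  have iW: "integrable M W" by (rule M.integrable_const_bound[of _ C]) (use W in auto)
  have iV: "integrable N V" by (rule N.integrable_const_bound[of _ C]) (use V in auto)
  have "complex_of_real (LINT w|M. W w) = complex_of_real (LINT w|N. V w)"
    using eq[of 0] by (simp add: scaleR_conv_of_real)
  then have c: "(LINT w|M. W w) = (LINT w|N. V w)" by (simp only: of_real_eq_iff)
  define c where "c = (LINT w|M. W w)"
  have "c \<ge> 0" unfolding c_def by (rule Bochner_Integration.integral_nonneg) (rule W)
  show ?thesis
  \<comment> \<open>\<open>c\<close> is the common total mass of the two weights. If it is zero the
    weights vanish almost everywhere; otherwise dividing by it gives probability measures, to which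
    the uniqueness theorem applies.\<close>
  proof (cases "c = 0")
    case True
    then have "AE w in M. W w = 0"
      using integral_nonneg_eq_0_iff_AE[OF iW] W c_def by auto
    then have 1: "(LINT w|M. W w * indicator S (X w)) = (LINT w|M. 0)"
      by (intro integral_cong_AE) auto
    have "AE w in N. V w = 0"
      using integral_nonneg_eq_0_iff_AE[OF iV] V c True c_def by auto
    then have "(LINT w|N. V w * indicator S (Y w)) = (LINT w|N. 0)"
      by (intro integral_cong_AE) auto
    with 1 show ?thesis by simp
  next
    case False
    then have cp: "c > 0" using \<open>c \<ge> 0\<close> by simp
    define P where "P = distr (density M (\<lambda>w. W w / c)) borel X"
    define Q where "Q = distr (density N (\<lambda>w. V w / c)) borel Y"
    have intP: "(LINT x|P. f x) = (LINT w|M. (W w / c) *\<^sub>R f (X w))"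
      if [measurable]: "f \<in> borel_measurable borel" for f :: "real \<Rightarrow> 'c::{banach, second_countable_topology}"
      unfolding P_def using W cp by (simp add: integral_distr integral_density)
    have intQ: "(LINT x|Q. f x) = (LINT w|N. (V w / c) *\<^sub>R f (Y w))"
      if [measurable]: "f \<in> borel_measurable borel" for f :: "real \<Rightarrow> 'c::{banach, second_countable_topology}"
      unfolding Q_def using V cp by (simp add: integral_distr integral_density)
    have "prob_space (density M (\<lambda>w. ennreal (W w / c)))"
    proof (rule prob_spaceI)
      have "(\<integral>\<^sup>+ x. ennreal (W x / c) \<partial>M) = ennreal (LINT w|M. W w / c)"
        by (rule nn_integral_eq_integral) (use iW W cp in auto)
      also have "(LINT w|M. W w / c) = 1" using cp by (simp add: c_def)
      finally show "emeasure (density M (\<lambda>w. ennreal (W w / c))) (space (density M (\<lambda>w. ennreal (W w / c)))) = 1"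
        by (simp add: emeasure_density cong: nn_integral_cong)
    qed
    then have P: "real_distribution P" unfolding P_def real_distribution_def real_distribution_axioms_def
      by (auto intro!: prob_space.prob_space_distr)
    have "prob_space (density N (\<lambda>w. ennreal (V w / c)))"
    proof (rule prob_spaceI)
      have "(\<integral>\<^sup>+ x. ennreal (V x / c) \<partial>N) = ennreal (LINT w|N. V w / c)"
        by (rule nn_integral_eq_integral) (use iV V cp in auto)
      also have "(LINT w|N. V w / c) = 1" using cp c by (simp add: c_def)
      finally show "emeasure (density N (\<lambda>w. ennreal (V w / c))) (space (density N (\<lambda>w. ennreal (V w / c)))) = 1"
        by (simp add: emeasure_density cong: nn_integral_cong)
    qed
    then have Q: "real_distribution Q" unfolding Q_def real_distribution_def real_distribution_axioms_def
      by (auto intro!: prob_space.prob_space_distr)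
    have "char P = char Q"
    proof
      fix s
      have "char P s = (1 / c) *\<^sub>R (LINT w|M. W w *\<^sub>R iexp (s * X w))"
        unfolding char_def by (subst intP) (auto simp flip: integral_scaleR_right)
      also have "\<dots> = char Q s"
        unfolding char_def eq by (subst intQ) (auto simp flip: integral_scaleR_right)
      finally show "char P s = char Q s" .
    qed
    then have "P = Q" by (rule Levy_uniqueness[OF P Q])
    have "(LINT w|M. W w * indicator S (X w)) = c * (LINT x|P. indicator S x)"
      using cp by (subst intP) auto
    also have "\<dots> = (LINT w|N. V w * indicator S (Y w))"
      unfolding \<open>P = Q\<close> using cp by (subst intQ) auto
    finally show ?thesis .
  qed
qed

lemma integral_lin3:
  fixes F G H :: "'a \<Rightarrow> complex"
  assumes "integrable M F" "integrable M G" "integrable M H"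
  shows "(LINT w|M. F w + c * G w + d * H w) = (LINT w|M. F w) + c * (LINT w|M. G w) + d * (LINT w|M. H w)"
  using assms by simp

text \<open>The positive weights are combinations of pure exponentials with arguments
  \<open>a\<close>, \<open>a + b\<close> and \<open>a - b\<close>, so identities known for pure
  exponentials extend to them.\<close>

lemma iexp_re: "(1 + cos b) *\<^sub>R iexp a = iexp a + (1/2) * iexp (a + b) + (1/2) * iexp (a - b)"
  by (rule complex_eqI) (simp_all add: Re_exp Im_exp cos_add sin_add cos_diff sin_diff field_simps)

lemma iexp_im: "(1 + sin b) *\<^sub>R iexp a = iexp a + (-\<i>/2) * iexp (a + b) + (\<i>/2) * iexp (a - b)"
  by (rule complex_eqI) (simp_all add: Re_exp Im_exp cos_add sin_add cos_diff sin_diff field_simps)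

locale same_joint_char = M: prob_space M + N: prob_space N
  for M :: "'a measure" and N :: "'b measure" +
  fixes X :: "'i \<Rightarrow> 'a \<Rightarrow> real" and Y :: "'i \<Rightarrow> 'b \<Rightarrow> real"
  assumes X[measurable]: "\<And>i. X i \<in> borel_measurable M"
    and Y[measurable]: "\<And>i. Y i \<in> borel_measurable N"
    and char_eq: "\<And>J t. finite J \<Longrightarrow>
      (LINT w|M. iexp (\<Sum>j\<in>J. t j * X j w)) = (LINT w|N. iexp (\<Sum>j\<in>J. t j * Y j w))"
begin

lemma indicator_char_eq:
  assumes "finite K" "finite J" "K \<inter> J = {}" "\<And>k. k \<in> K \<Longrightarrow> S k \<in> sets borel"
  shows "(LINT w|M. (\<Prod>k\<in>K. indicator (S k) (X k w)) *\<^sub>R iexp (\<Sum>j\<in>J. t j * X j w))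
       = (LINT w|N. (\<Prod>k\<in>K. indicator (S k) (Y k w)) *\<^sub>R iexp (\<Sum>j\<in>J. t j * Y j w))"
  using assms
proof (induction K arbitrary: J t rule: finite_induct)
  case empty
  then show ?case using char_eq by simp
next
  case (insert k K)
  define P where "P = (\<lambda>w. \<Prod>k\<in>K. indicator (S k) (X k w) :: real)"
  define Q where "Q = (\<lambda>w. \<Prod>k\<in>K. indicator (S k) (Y k w) :: real)"
  define a where "a = (\<lambda>w. \<Sum>j\<in>J. t j * X j w)"
  define b where "b = (\<lambda>w. \<Sum>j\<in>J. t j * Y j w)"
  have S[measurable]: "S k \<in> sets borel" and SK[measurable]: "\<And>k. k \<in> K \<Longrightarrow> S k \<in> sets borel"
    using insert.prems by auto
  have P[measurable]: "P \<in> borel_measurable M" unfolding P_def by measurable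
  have Q[measurable]: "Q \<in> borel_measurable N" unfolding Q_def by measurable
  have a[measurable]: "a \<in> borel_measurable M" unfolding a_def by measurable
  have b[measurable]: "b \<in> borel_measurable N" unfolding b_def by measurable
  have P01: "0 \<le> P w" "P w \<le> 1" for w unfolding P_def by (auto intro!: prod_nonneg prod_le_1 simp: indicator_def)
  have Q01: "0 \<le> Q w" "Q w \<le> 1" for w unfolding Q_def by (auto intro!: prod_nonneg prod_le_1 simp: indicator_def)
  have kJ: "k \<notin> J" using insert.prems by auto
  \<comment> \<open>Two free coefficients: \<open>s\<close> probes the coordinate \<open>k\<close>
    that is about to become an indicator, and \<open>r = 0, 1, -1\<close> are the three frequencies
    in \<open>iexp_re\<close> and \<open>iexp_im\<close>.\<close>
  have IH: "(LINT w|M. P w *\<^sub>R iexp (s * X k w + r * a w)) = (LINT w|N. Q w *\<^sub>R iexp (s * Y k w + r * b w))" for s r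
  proof -
    have "(\<Sum>j\<in>insert k J. ((\<lambda>j. r * t j)(k := s)) j * X j w) = s * X k w + r * a w" for w
      using kJ insert.prems by (auto simp: a_def sum_distrib_left mult.assoc intro!: sum.cong)
    moreover have "(\<Sum>j\<in>insert k J. ((\<lambda>j. r * t j)(k := s)) j * Y j w) = s * Y k w + r * b w" for w
      using kJ insert.prems by (auto simp: b_def sum_distrib_left mult.assoc intro!: sum.cong)
    ultimately show ?thesis
      using insert.IH[of "insert k J" "(\<lambda>j. r * t j)(k := s)"] insert.prems insert.hyps
      unfolding P_def Q_def by auto
  qed
  have iM: "integrable M (\<lambda>w. P w *\<^sub>R iexp (s * X k w + r * a w))" for s r
    by (rule M.integrable_const_bound[of _ 1]) (use P01 in auto)
  have iN: "integrable N (\<lambda>w. Q w *\<^sub>R iexp (s * Y k w + r * b w))" for s r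
    by (rule N.integrable_const_bound[of _ 1]) (use Q01 in auto)
  have rM: "integrable M (\<lambda>w. P w * f (a w) * indicator (S k) (X k w))"
    if [measurable]: "f \<in> borel_measurable borel" and "\<And>x. \<bar>f x\<bar> \<le> 1" for f :: "real \<Rightarrow> real"
    by (rule M.integrable_const_bound[of _ 1]) (use P01 that in \<open>auto simp: abs_mult indicator_def mult_le_one\<close>)
  have rN: "integrable N (\<lambda>w. Q w * f (b w) * indicator (S k) (Y k w))"
    if [measurable]: "f \<in> borel_measurable borel" and "\<And>x. \<bar>f x\<bar> \<le> 1" for f :: "real \<Rightarrow> real"
    by (rule N.integrable_const_bound[of _ 1]) (use Q01 that in \<open>auto simp: abs_mult indicator_def mult_le_one\<close>)
  have bnd: "0 \<le> p * (1 + cos x)" "p * (1 + cos x) \<le> 2" "0 \<le> p * (1 + sin x)" "p * (1 + sin x) \<le> 2"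
    if "0 \<le> p" "p \<le> 1" for p x :: real
  proof -
    have "0 \<le> 1 + cos x" "1 + cos x \<le> 2" "0 \<le> 1 + sin x" "1 + sin x \<le> 2"
      using cos_ge_minus_one[of x] cos_le_one[of x] sin_ge_minus_one[of x] sin_le_one[of x] by linarith+
    then show "0 \<le> p * (1 + cos x)" "p * (1 + cos x) \<le> 2" "0 \<le> p * (1 + sin x)" "p * (1 + sin x) \<le> 2"
      using that mult_mono[of p 1 "1 + cos x" 2] mult_mono[of p 1 "1 + sin x" 2] by auto
  qed
  have e1: "(LINT w|M. P w * indicator (S k) (X k w)) = (LINT w|N. Q w * indicator (S k) (Y k w))"
    by (rule weighted_char_eq_imp_indicator_eq[where C = 1])
       (use P01 Q01 IH[of _ 0] in \<open>auto intro: M.prob_space_axioms N.prob_space_axioms\<close>)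
  have ecos: "(LINT w|M. P w * (1 + cos (a w)) * indicator (S k) (X k w)) =
              (LINT w|N. Q w * (1 + cos (b w)) * indicator (S k) (Y k w))"
  proof (rule weighted_char_eq_imp_indicator_eq[where C = 2])
    have p: "(P w * (1 + cos (a w))) *\<^sub>R iexp (s * X k w) = P w *\<^sub>R iexp (s * X k w + 0 * a w) +
       (1/2) * (P w *\<^sub>R iexp (s * X k w + 1 * a w)) + (1/2) * (P w *\<^sub>R iexp (s * X k w + (-1) * a w))" for s w
      unfolding scaleR_scaleR[symmetric] iexp_re by (simp add: scaleR_add_right)
    have q: "(Q w * (1 + cos (b w))) *\<^sub>R iexp (s * Y k w) = Q w *\<^sub>R iexp (s * Y k w + 0 * b w) +
       (1/2) * (Q w *\<^sub>R iexp (s * Y k w + 1 * b w)) + (1/2) * (Q w *\<^sub>R iexp (s * Y k w + (-1) * b w))" for s w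
      unfolding scaleR_scaleR[symmetric] iexp_re by (simp add: scaleR_add_right)
    show "(LINT w|M. (P w * (1 + cos (a w))) *\<^sub>R iexp (s * X k w)) = (LINT w|N. (Q w * (1 + cos (b w))) *\<^sub>R iexp (s * Y k w))" for s
      unfolding p q integral_lin3[OF iM iM iM] integral_lin3[OF iN iN iN] IH ..
  qed (insert bnd[OF P01] bnd[OF Q01], auto intro: M.prob_space_axioms N.prob_space_axioms)
  have esin: "(LINT w|M. P w * (1 + sin (a w)) * indicator (S k) (X k w)) =
              (LINT w|N. Q w * (1 + sin (b w)) * indicator (S k) (Y k w))"
  proof (rule weighted_char_eq_imp_indicator_eq[where C = 2])
    have p: "(P w * (1 + sin (a w))) *\<^sub>R iexp (s * X k w) = P w *\<^sub>R iexp (s * X k w + 0 * a w) +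
       (-\<i>/2) * (P w *\<^sub>R iexp (s * X k w + 1 * a w)) + (\<i>/2) * (P w *\<^sub>R iexp (s * X k w + (-1) * a w))" for s w
      unfolding scaleR_scaleR[symmetric] iexp_im by (simp add: scaleR_add_right scaleR_diff_right)
    have q: "(Q w * (1 + sin (b w))) *\<^sub>R iexp (s * Y k w) = Q w *\<^sub>R iexp (s * Y k w + 0 * b w) +
       (-\<i>/2) * (Q w *\<^sub>R iexp (s * Y k w + 1 * b w)) + (\<i>/2) * (Q w *\<^sub>R iexp (s * Y k w + (-1) * b w))" for s w
      unfolding scaleR_scaleR[symmetric] iexp_im by (simp add: scaleR_add_right scaleR_diff_right)
    show "(LINT w|M. (P w * (1 + sin (a w))) *\<^sub>R iexp (s * X k w)) = (LINT w|N. (Q w * (1 + sin (b w))) *\<^sub>R iexp (s * Y k w))" for s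
      unfolding p q integral_lin3[OF iM iM iM] integral_lin3[OF iN iN iN] IH ..
  qed (insert bnd[OF P01] bnd[OF Q01], auto intro: M.prob_space_axioms N.prob_space_axioms)
  \<comment> \<open>Subtracting \<open>e1\<close> removes the 1 that had been added for positivity
    and leaves the real or imaginary part of the remaining exponential.\<close>
  have cs: "(LINT w|M. P w * f (a w) * indicator (S k) (X k w)) = (LINT w|N. Q w * f (b w) * indicator (S k) (Y k w))"
    if "(LINT w|M. P w * (1 + f (a w)) * indicator (S k) (X k w)) = (LINT w|N. Q w * (1 + f (b w)) * indicator (S k) (Y k w))"
     and f: "f \<in> borel_measurable borel" "\<And>x. \<bar>f x\<bar> \<le> 1" for f
    using that(1) e1 rM[OF f] rN[OF f] rM[of "\<lambda>_. 1"] rN[of "\<lambda>_. 1"]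
    by (simp add: distrib_left distrib_right)
  have M_eq: "(\<Prod>k\<in>insert k K. indicator (S k) (X k w)) *\<^sub>R iexp (a w) =
      of_real (P w * cos (a w) * indicator (S k) (X k w)) + \<i> * of_real (P w * sin (a w) * indicator (S k) (X k w))" for w
    using insert.hyps by (simp add: P_def exp_Euler scaleR_conv_of_real algebra_simps flip: cos_of_real sin_of_real)
  have N_eq: "(\<Prod>k\<in>insert k K. indicator (S k) (Y k w)) *\<^sub>R iexp (b w) =
      of_real (Q w * cos (b w) * indicator (S k) (Y k w)) + \<i> * of_real (Q w * sin (b w) * indicator (S k) (Y k w))" for w
    using insert.hyps by (simp add: Q_def exp_Euler scaleR_conv_of_real algebra_simps flip: cos_of_real sin_of_real)
  have cM: "integrable M (\<lambda>w. complex_of_real (P w * cos (a w) * indicator (S k) (X k w)))"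
    "integrable M (\<lambda>w. \<i> * complex_of_real (P w * sin (a w) * indicator (S k) (X k w)))"
    using rM[of cos] rM[of sin] by (auto intro!: integrable_of_real integrable_mult_right simp del: of_real_mult)
  have cN: "integrable N (\<lambda>w. complex_of_real (Q w * cos (b w) * indicator (S k) (Y k w)))"
    "integrable N (\<lambda>w. \<i> * complex_of_real (Q w * sin (b w) * indicator (S k) (Y k w)))"
    using rN[of cos] rN[of sin] by (auto intro!: integrable_of_real integrable_mult_right simp del: of_real_mult)
  show ?case
    unfolding a_def[symmetric, THEN fun_cong] b_def[symmetric, THEN fun_cong] M_eq N_eq
      Bochner_Integration.integral_add[OF cM] Bochner_Integration.integral_add[OF cN]
    using cs[OF ecos] cs[OF esin] by (simp del: of_real_mult)
qed

lemma distr_eq: "distr M (PiM UNIV (\<lambda>_. borel)) (\<lambda>w i. X i w) = distr N (PiM UNIV (\<lambda>_. borel)) (\<lambda>w i. Y i w)"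
proof (rule measure_eqI_PiM_infinite)
  have mX[measurable]: "(\<lambda>w i. X i w) \<in> measurable M (PiM UNIV (\<lambda>_. borel))"
    by (rule measurable_PiM_single') auto
  have mY[measurable]: "(\<lambda>w i. Y i w) \<in> measurable N (PiM UNIV (\<lambda>_. borel))"
    by (rule measurable_PiM_single') auto
  show "finite_measure (distr M (PiM UNIV (\<lambda>_. borel)) (\<lambda>w i. X i w))"
    by (rule M.finite_measure_distr) simp
  fix A :: "'i \<Rightarrow> real set" and J :: "'i set"
  assume J: "finite J" and "\<And>i. i \<in> J \<Longrightarrow> A i \<in> sets borel"
  then have A[measurable]: "\<And>i. i \<in> J \<Longrightarrow> A i \<in> sets borel" by auto
  let ?E = "prod_emb UNIV (\<lambda>_. borel) J (Pi\<^sub>E J A) :: ('i \<Rightarrow> real) set"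
  have E_sets[measurable]: "?E \<in> sets (PiM UNIV (\<lambda>_. borel))"
    using J by (intro sets_PiM_I) auto
  have E: "f \<in> ?E \<longleftrightarrow> (\<forall>j\<in>J. f j \<in> A j)" for f by (auto simp: prod_emb_def PiE_iff)
  have ind: "(\<Prod>j\<in>J. indicator (A j) (f j)) = (indicator ?E f :: real)" for f
    using J by (auto simp: indicator_def E prod_eq_1_iff)
  have "(LINT w|M. (indicator ?E (\<lambda>i. X i w)) *\<^sub>R (1::complex)) = (LINT w|N. (indicator ?E (\<lambda>i. Y i w)) *\<^sub>R 1)"
    using indicator_char_eq[OF J finite.emptyI, of A] A by (simp add: ind)
  then have "complex_of_real (LINT w|M. indicator ?E (\<lambda>i. X i w)) = complex_of_real (LINT w|N. indicator ?E (\<lambda>i. Y i w))"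
    by (simp add: scaleR_conv_of_real)
  then have e: "(LINT w|M. indicator ?E (\<lambda>i. X i w) :: real) = (LINT w|N. indicator ?E (\<lambda>i. Y i w))"
    by (simp only: of_real_eq_iff)
  have mD: "measure D ?E = (LINT w|D. indicator ?E w)" if "sets D = sets (PiM UNIV (\<lambda>_. borel))" for D
    using sets_eq_imp_space_eq[OF that] by (simp add: space_PiM)
  have "measure (distr M (PiM UNIV (\<lambda>_. borel)) (\<lambda>w i. X i w)) ?E
      = measure (distr N (PiM UNIV (\<lambda>_. borel)) (\<lambda>w i. Y i w)) ?E"
    unfolding mD[OF sets_distr] integral_distr[OF mX borel_measurable_indicator[OF E_sets]]
      integral_distr[OF mY borel_measurable_indicator[OF E_sets]] by (rule e)
  then show "emeasure (distr M (PiM UNIV (\<lambda>_. borel)) (\<lambda>w i. X i w)) ?E = emeasure (distr N (PiM UNIV (\<lambda>_. borel)) (\<lambda>w i. Y i w)) ?E"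
    by (simp add: finite_measure.emeasure_eq_measure M.finite_measure_distr N.finite_measure_distr)
qed auto

end

section \<open>Coordinates on Hermitian matrices and uniqueness of characteristic functions\<close>

text \<open>One real coordinate per index pair: the real part of a Hermitian matrix is symmetric and the
  imaginary part is antisymmetric, so their sum determines the matrix, and \<open>tr (A B)\<close> becomes the
  Euclidean inner product.\<close>

definition hcoord :: "cmat \<Rightarrow> nat \<times> nat \<Rightarrow> real" where
  "hcoord A = (\<lambda>(i, j). Re (A i j) + Im (A i j))"

definition hmat :: "(nat \<times> nat \<Rightarrow> real) \<Rightarrow> cmat" where
  "hmat b = (\<lambda>i j. Complex ((b (i, j) + b (j, i)) / 2) ((b (i, j) - b (j, i)) / 2))"

lemma hmat_Herm [simp]: "hmat b \<in> Herm"
  by (rule HermI) (simp add: hmat_def complex_eq_iff field_simps)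

lemma hcoord_hmat [simp]: "hcoord (hmat b) = b"
  by (intro ext) (auto simp: hcoord_def hmat_def field_simps)

lemma hmat_hcoord [simp]: "A \<in> Herm \<Longrightarrow> hmat (hcoord A) = A"
proof (intro ext)
  fix i j assume "A \<in> Herm"
  then have "Re (A j i) = Re (A i j)" "Im (A j i) = - Im (A i j)"
    using Herm_cnj[of A i j] by (metis cnj.sel)+
  then show "hmat (hcoord A) i j = A i j" by (simp add: hmat_def hcoord_def complex_eq_iff)
qed

lemma trace_eq_hcoord:
  assumes A: "A \<in> Herm_n n" and B: "B \<in> Herm"
  shows "mtrace (mmul A B) = of_real (\<Sum>p\<in>{..<n}\<times>{..<n}. hcoord A p * hcoord B p)"
proof -
  have A': "Re (A j i) = Re (A i j)" "Im (A j i) = - Im (A i j)" for i j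
    using Herm_cnj[OF Herm_nD(2)[OF A], of i j] by (metis cnj.sel)+
  have B': "Re (B j i) = Re (B i j)" "Im (B j i) = - Im (B i j)" for i j
    using Herm_cnj[OF B, of i j] by (metis cnj.sel)+
  \<comment> \<open>The two sides do not agree term by term; only the terms for
    \<open>(i, k)\<close> and \<open>(k, i)\<close> together do, hence the symmetrisation.\<close>
  have swap: "(\<Sum>i<n. \<Sum>k<n. g i k) = (\<Sum>i<n. \<Sum>k<n. (g i k + g k i) / 2)" for g :: "nat \<Rightarrow> nat \<Rightarrow> real"
  proof -
    have "(\<Sum>i<n. \<Sum>k<n. g i k) = (\<Sum>i<n. \<Sum>k<n. g k i)" by (rule sum.swap)
    then show ?thesis by (simp add: sum.distrib flip: sum_divide_distrib)
  qed
  have "Im (mtrace (mmul A B)) = (\<Sum>i<n. \<Sum>k<n. Re (A i k) * Im (B k i) + Im (A i k) * Re (B k i))"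
    by (simp add: trace_eq_sum[OF A])
  also have "\<dots> = 0"
  proof (subst swap, intro sum.neutral ballI)
    fix i k
    show "(Re (A i k) * Im (B k i) + Im (A i k) * Re (B k i) + (Re (A k i) * Im (B i k) + Im (A k i) * Re (B i k))) / 2 = 0"
      by (simp add: A'[of i k] B'[of i k])
  qed
  finally have im: "Im (mtrace (mmul A B)) = 0" .
  have "Re (mtrace (mmul A B)) = (\<Sum>i<n. \<Sum>k<n. Re (A i k) * Re (B k i) - Im (A i k) * Im (B k i))"
    by (simp add: trace_eq_sum[OF A])
  also have "\<dots> = (\<Sum>i<n. \<Sum>k<n. hcoord A (i, k) * hcoord B (i, k))"
  proof (subst (1 2) swap, intro sum.cong refl)
    fix i k
    show "(Re (A i k) * Re (B k i) - Im (A i k) * Im (B k i) + (Re (A k i) * Re (B i k) - Im (A k i) * Im (B i k))) / 2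
      = (hcoord A (i, k) * hcoord B (i, k) + hcoord A (k, i) * hcoord B (k, i)) / 2"
      by (simp add: hcoord_def A'[of i k] B'[of i k] algebra_simps)
  qed
  also have "\<dots> = (\<Sum>p\<in>{..<n}\<times>{..<n}. hcoord A p * hcoord B p)"
    by (simp add: sum.cartesian_product case_prod_beta)
  finally show ?thesis using im by (simp add: complex_eq_iff)
qed

lemma hcoord_measurable [measurable]: "(\<lambda>B. hcoord B p) \<in> borel_measurable borel"
proof -
  have [measurable]: "(\<lambda>B :: cmat. B i j) \<in> borel_measurable borel" for i j
    by (rule measurable_product_then_coordinatewise) (rule measurable_product_then_coordinatewise, simp)
  show ?thesis unfolding hcoord_def by (cases p) measurable
qed

lemma hmat_measurable: "hmat \<in> measurable (PiM UNIV (\<lambda>_. borel)) borel"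
proof -
  have "(\<lambda>b. hmat b i j) \<in> measurable (PiM UNIV (\<lambda>_. borel)) borel" for i j
    unfolding hmat_def Complex_eq by measurable
  then show ?thesis by (intro measurable_coordinatewise_then_product)
qed

lemma borel_prob_on_HermD:
  assumes "borel_prob_on_Herm M"
  shows "prob_space M" "space M = Herm" "sets M = sets (restrict_space borel Herm)"
    "\<And>f N. f \<in> measurable borel N \<Longrightarrow> f \<in> measurable M N"
proof -
  show s: "sets M = sets (restrict_space borel Herm)" and "prob_space M" using assms by (auto simp: borel_prob_on_Herm_def)
  show "space M = Herm" using sets_eq_imp_space_eq[OF s] by (simp add: space_restrict_space)
  show "f \<in> measurable M N" if "f \<in> measurable borel N" for f N
    using measurable_restrict_space1[OF that] measurable_cong_sets[OF s refl] by auto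
qed

text \<open>Every finite linear form in the coordinates is a trace pairing with a finite Hermitian
  matrix, so \<open>char_fun\<close> knows all joint characteristic functions of the
  coordinates.\<close>

lemma Herm_n_of_coords:
  assumes "finite J"
  shows "\<exists>n A. A \<in> Herm_n n \<and> (\<forall>B. (\<Sum>p\<in>{..<n}\<times>{..<n}. hcoord A p * hcoord B p) = (\<Sum>p\<in>J. t p * hcoord B p))"
proof -
  define b where "b = (\<lambda>p. if p \<in> J then t p else 0)"
  obtain n where n: "J \<subseteq> {..<n} \<times> {..<n}"
  proof -
    have "finite (fst ` J \<union> snd ` J)" using assms by auto
    then obtain n where "fst ` J \<union> snd ` J \<subseteq> {..<n}" using finite_nat_iff_bounded by blast
    then have "J \<subseteq> {..<n} \<times> {..<n}" by force
    then show ?thesis using that by blast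
  qed
  have "hmat b \<in> Herm_n n" unfolding Herm_n_def using n
    by (auto simp: b_def complex_eq_iff) (auto simp: hmat_def)
  moreover have "(\<Sum>p\<in>{..<n}\<times>{..<n}. hcoord (hmat b) p * hcoord B p) = (\<Sum>p\<in>J. t p * hcoord B p)" for B
    by (rule sum.mono_neutral_cong_right) (use n in \<open>auto simp: b_def\<close>)
  ultimately show ?thesis by blast
qed

theorem char_fun_unique:
  assumes M: "borel_prob_on_Herm M" and N: "borel_prob_on_Herm N"
    and eq: "\<And>A. A \<in> Herm_fin \<Longrightarrow> char_fun M A = char_fun N A"
  shows "M = N"
proof -
  note MD = borel_prob_on_HermD[OF M] and ND = borel_prob_on_HermD[OF N]
  have hM[measurable]: "(\<lambda>B. hcoord B p) \<in> borel_measurable M" for p by (rule MD(4)) measurable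
  have hN[measurable]: "(\<lambda>B. hcoord B p) \<in> borel_measurable N" for p by (rule ND(4)) measurable
  have joint: "same_joint_char M N (\<lambda>p B. hcoord B p) (\<lambda>p B. hcoord B p)"
  proof (intro same_joint_char.intro same_joint_char_axioms.intro)
    fix J :: "(nat \<times> nat) set" and t :: "nat \<times> nat \<Rightarrow> real" assume J: "finite J"
    obtain n A where A: "A \<in> Herm_n n" "\<And>B. (\<Sum>p\<in>{..<n}\<times>{..<n}. hcoord A p * hcoord B p) = (\<Sum>p\<in>J. t p * hcoord B p)"
      using Herm_n_of_coords[OF J] by blast
    have c: "char_fun P A = (LINT B|P. iexp (\<Sum>p\<in>J. t p * hcoord B p))"
      if "space P = Herm" for P :: "cmat measure"
      unfolding char_fun_def
      by (rule Bochner_Integration.integral_cong[OF refl]) (simp add: that trace_eq_hcoord[OF A(1)] A(2))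
    have "A \<in> Herm_fin" using A(1) by (auto simp: Herm_fin_def)
    then show "(LINT B|M. iexp (\<Sum>p\<in>J. t p * hcoord B p)) = (LINT B|N. iexp (\<Sum>p\<in>J. t p * hcoord B p))"
      using eq c[OF MD(2)] c[OF ND(2)] by simp
  qed (use MD ND in auto)
  have D: "distr M (PiM UNIV (\<lambda>_. borel)) hcoord = distr N (PiM UNIV (\<lambda>_. borel)) hcoord"
    using same_joint_char.distr_eq[OF joint] by simp
  \<comment> \<open>A measure on \<open>Herm\<close> is the image of its coordinate law, because
    \<open>hmat\<close> inverts \<open>hcoord\<close> there; equal coordinate laws therefore give
    equal measures.\<close>
  have recover: "P = distr (distr P (PiM UNIV (\<lambda>_. borel)) hcoord) (restrict_space borel Herm) hmat"
    if P: "borel_prob_on_Herm P" for P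
  proof -
    note PD = borel_prob_on_HermD[OF P]
    have [measurable]: "hcoord \<in> measurable P (PiM UNIV (\<lambda>_. borel))"
      by (rule measurable_PiM_single') (auto intro!: PD(4))
    have [measurable]: "hmat \<in> measurable (PiM UNIV (\<lambda>_. borel)) (restrict_space borel Herm)"
      by (rule measurable_restrict_space2) (auto simp: hmat_measurable)
    have "distr (distr P (PiM UNIV (\<lambda>_. borel)) hcoord) (restrict_space borel Herm) hmat
        = distr P (restrict_space borel Herm) (hmat \<circ> hcoord)"
      by (rule distr_distr) measurable
    also have "\<dots> = distr P P (\<lambda>x. x)"
      by (rule distr_cong) (use PD in auto)
    finally show ?thesis by (simp add: distr_id2)
  qed
  show ?thesis using recover[OF M] recover[OF N] D by simp
qed

section \<open>The one-variable functions and their limits\<close>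

text \<open>The logarithm of \<open>exp (- \<i> t) / (1 - \<i> t)\<close> without its quadratic term. Its derivative is
  \<open>- \<i> t\<^sup>2 / (1 - \<i> t)\<close>, hence a global cubic bound.\<close>

definition logfac :: "real \<Rightarrow> complex" where
  "logfac t = - Ln (1 - \<i> * t) - \<i> * t + t\<^sup>2 / 2"

lemma one_minus_i_nonzero [simp]: "1 - \<i> * complex_of_real t \<noteq> 0"
  by (simp add: complex_eq_iff)

lemma logfac_0 [simp]: "logfac 0 = 0"
  by (simp add: logfac_def)

lemma exp_logfac: "exp (logfac t - of_real (t\<^sup>2 / 2)) = exp (- (\<i> * t)) / (1 - \<i> * t)"
proof -
  have "logfac t - of_real (t\<^sup>2 / 2) = - (\<i> * t) - Ln (1 - \<i> * t)" by (simp add: logfac_def)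
  then show ?thesis by (simp add: exp_diff del: exp_minus)
qed

lemma logfac_has_vector_derivative:
  "(logfac has_vector_derivative (- \<i> * of_real (t\<^sup>2) / (1 - \<i> * of_real t))) (at t within S)"
proof -
  have nr: "1 - \<i> * complex_of_real t \<notin> \<real>\<^sub>\<le>\<^sub>0"
    by (auto simp: complex_nonpos_Reals_iff)
  have "((\<lambda>z. - Ln (1 - \<i> * z) - \<i> * z + z\<^sup>2 / 2) has_field_derivative
      (\<i> / (1 - \<i> * of_real t) - \<i> + of_real t)) (at (complex_of_real t))"
    using nr by (auto intro!: derivative_eq_intros simp: field_simps)
  also have "(\<i> / (1 - \<i> * of_real t) - \<i> + of_real t) = - \<i> * complex_of_real (t\<^sup>2) / (1 - \<i> * of_real t)"
    by (simp add: divide_simps) (simp add: algebra_simps power2_eq_square)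
  finally have "((\<lambda>z. - Ln (1 - \<i> * z) - \<i> * z + z\<^sup>2 / 2) has_field_derivative
      (- \<i> * complex_of_real (t\<^sup>2) / (1 - \<i> * of_real t))) (at (complex_of_real t))" .
  from has_vector_derivative_real_field[OF this]
  show ?thesis unfolding logfac_def by (simp add: has_vector_derivative_at_within)
qed

lemma norm_one_minus_i_ge: "1 \<le> cmod (1 - \<i> * complex_of_real t)"
  using abs_Re_le_cmod[of "1 - \<i> * complex_of_real t"] by simp

lemma norm_logfac_le: "cmod (logfac t) \<le> \<bar>t\<bar> ^ 3"
proof -
  have "norm (logfac t - logfac 0) \<le> \<bar>t\<bar>\<^sup>2 * norm (t - 0)"
  proof (rule differentiable_bound[where S = "closed_segment 0 t" and f' = "\<lambda>s h. h *\<^sub>R (- \<i> * of_real (s\<^sup>2) / (1 - \<i> * of_real s))"])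
    show "(logfac has_derivative (\<lambda>h. h *\<^sub>R (- \<i> * of_real (s\<^sup>2) / (1 - \<i> * of_real s)))) (at s within closed_segment 0 t)" for s
      using logfac_has_vector_derivative[of s] by (simp add: has_vector_derivative_def)
    fix s assume "s \<in> closed_segment 0 t"
    then have "\<bar>s\<bar> \<le> \<bar>t\<bar>" by (auto simp: closed_segment_eq_real_ivl split: if_splits)
    then have "s\<^sup>2 \<le> t\<^sup>2" by (simp add: abs_le_square_iff)
    have "cmod (- \<i> * of_real (s\<^sup>2) / (1 - \<i> * of_real s)) \<le> s\<^sup>2 / 1"
      using norm_one_minus_i_ge[of s] unfolding norm_divide
      by (intro frac_le) (auto simp: norm_mult norm_power)
    then have "onorm (\<lambda>h. h *\<^sub>R (- \<i> * of_real (s\<^sup>2) / (1 - \<i> * of_real s))) \<le> s\<^sup>2"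
      by (intro onorm_le) (simp add: mult.commute[of _ "\<bar>_\<bar>"] mult_left_mono)
    then show "onorm (\<lambda>h. h *\<^sub>R (- \<i> * of_real (s\<^sup>2) / (1 - \<i> * of_real s))) \<le> \<bar>t\<bar>\<^sup>2"
      using \<open>s\<^sup>2 \<le> t\<^sup>2\<close> by simp
  qed auto
  then show ?thesis by (simp add: power3_eq_cube power2_eq_square)
qed

lemma continuous_logfac: "isCont logfac t"
  using logfac_has_vector_derivative[of t UNIV] has_vector_derivative_continuous by blast

lemma summable_cube_of_square:
  fixes x :: "nat \<Rightarrow> real"
  assumes "summable (\<lambda>k. (x k)\<^sup>2)"
  shows "summable (\<lambda>k. \<bar>x k\<bar> ^ 3)"
proof -
  have "(\<lambda>k. (x k)\<^sup>2) \<longlonglongrightarrow> 0" by (rule summable_LIMSEQ_zero[OF assms])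
  then have "eventually (\<lambda>k. (x k)\<^sup>2 < 1) sequentially" by (rule order_tendstoD) simp
  then have "eventually (\<lambda>k. norm (\<bar>x k\<bar> ^ 3) \<le> (x k)\<^sup>2) sequentially"
  proof eventually_elim
    case (elim k)
    then have "\<bar>x k\<bar> \<le> 1" by (simp add: abs_square_less_1 less_imp_le)
    then have "\<bar>x k\<bar> * (x k)\<^sup>2 \<le> 1 * (x k)\<^sup>2" by (intro mult_right_mono) auto
    then show ?case by (simp add: power3_eq_cube power2_eq_square abs_mult mult.assoc)
  qed
  then show ?thesis by (rule summable_comparison_test_ev[OF _ assms])
qed

lemma summable_logfac:
  fixes x :: "nat \<Rightarrow> real"
  assumes "summable (\<lambda>k. (x k)\<^sup>2)"
  shows "summable (\<lambda>k. logfac (a * x k))"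
proof -
  have "summable (\<lambda>k. (a * x k)\<^sup>2)" using summable_mult[OF assms, of "a\<^sup>2"] by (simp add: power_mult_distrib)
  from summable_cube_of_square[OF this] show ?thesis
    by (rule summable_comparison_test'[where N = 0]) (rule norm_logfac_le)
qed

lemma param_factor_eq_exp:
  fixes x a :: real
  shows
  "exp (- (\<i> * x * a)) / (1 - \<i> * x * complex_of_real a) = exp (logfac (a * x) - of_real (a\<^sup>2 * x\<^sup>2 / 2))"
  using exp_logfac[of "a * x"] by (simp add: power_mult_distrib mult_ac)

lemma param_factor_summable:
  fixes x :: "nat \<Rightarrow> real"
  assumes "summable (\<lambda>k. (x k)\<^sup>2)"
  shows "summable (\<lambda>k. logfac (a * x k) - complex_of_real (a\<^sup>2 * (x k)\<^sup>2 / 2))"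
  by (intro summable_diff summable_logfac assms summable_of_real summable_divide summable_mult)

lemma param_prod_tendsto:
  fixes x :: "nat \<Rightarrow> real"
  assumes "summable (\<lambda>k. (x k)\<^sup>2)"
  shows "(\<lambda>K. \<Prod>k<K. exp (- (\<i> * x k * a)) / (1 - \<i> * x k * complex_of_real a))
        \<longlonglongrightarrow> prodinf (\<lambda>k. exp (- (\<i> * x k * a)) / (1 - \<i> * x k * a))"
proof -
  have "(\<lambda>n. \<Prod>k\<le>n. exp (- (\<i> * x k * a)) / (1 - \<i> * x k * complex_of_real a))
        \<longlonglongrightarrow> prodinf (\<lambda>k. exp (- (\<i> * x k * a)) / (1 - \<i> * x k * a))"
    unfolding param_factor_eq_exp
    by (intro convergent_prod_LIMSEQ convergent_prod_exp param_factor_summable assms)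
  then have "(\<lambda>n. \<Prod>k<Suc n. exp (- (\<i> * x k * a)) / (1 - \<i> * x k * complex_of_real a))
        \<longlonglongrightarrow> prodinf (\<lambda>k. exp (- (\<i> * x k * a)) / (1 - \<i> * x k * a))"
    by (simp only: lessThan_Suc_atMost)
  then show ?thesis by (rule LIMSEQ_imp_Suc)
qed

text \<open>The quadratic terms of all factors are merged with \<open>\<gamma>2\<close> into one
  coefficient. This is the shape in which limits of finite products appear: only the total is
  visible as a limit of sums of squares, while the series in \<open>logfac\<close> converges
  absolutely.\<close>

lemma F_param_eq_exp:
  assumes x: "summable (\<lambda>k. (x k)\<^sup>2)"
  shows "F_param \<gamma>1 \<gamma>2 x a = exp (\<i> * \<gamma>1 * a - of_real (a\<^sup>2 / 2 * (\<gamma>2 + (\<Sum>k. (x k)\<^sup>2))) + (\<Sum>k. logfac (a * x k)))"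
proof -
  have "(\<Sum>k. logfac (a * x k) - complex_of_real (a\<^sup>2 * (x k)\<^sup>2 / 2))
      = (\<Sum>k. logfac (a * x k)) - (\<Sum>k. complex_of_real (a\<^sup>2 * (x k)\<^sup>2 / 2))"
    by (intro suminf_diff[symmetric] summable_logfac x summable_of_real summable_divide summable_mult)
  also have "(\<Sum>k. complex_of_real (a\<^sup>2 * (x k)\<^sup>2 / 2)) = of_real (\<Sum>k. a\<^sup>2 * (x k)\<^sup>2 / 2)"
    by (intro suminf_of_real[symmetric] summable_divide summable_mult x)
  also have "(\<Sum>k. a\<^sup>2 * (x k)\<^sup>2 / 2) = a\<^sup>2 / 2 * (\<Sum>k. (x k)\<^sup>2)"
    using suminf_mult[OF x, of "a\<^sup>2 / 2"] by simp
  finally have "prodinf (\<lambda>k. exp (- (\<i> * x k * a)) / (1 - \<i> * x k * a))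
      = exp ((\<Sum>k. logfac (a * x k)) - of_real (a\<^sup>2 / 2 * (\<Sum>k. (x k)\<^sup>2)))"
    unfolding param_factor_eq_exp prodinf_exp[OF param_factor_summable[OF x]] by simp
  then show ?thesis unfolding F_param_def by (simp add: exp_add[symmetric] algebra_simps add_divide_distrib)
qed

section \<open>Continuous characters of the real line\<close>

text \<open>Split \<open>n * t\<close> into its integer part and a remainder in the unit interval,
  on which \<open>k\<close> is bounded. Then \<open>n\<close> times the deviation from linearity is
  bounded uniformly in \<open>n\<close>, so the deviation is zero.\<close>

lemma additive_continuous_imp_linear:
  fixes k :: "real \<Rightarrow> real"
  assumes cont: "continuous_on UNIV k" and add: "\<And>a b. k (a + b) = k a + k b"
  shows "k t = k 1 * t"
proof -
  have k0: "k 0 = 0" using add[of 0 0] by simp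
  have nat: "k (of_nat n * s) = of_nat n * k s" for n s
    by (induction n) (simp_all add: add k0 algebra_simps)
  have int: "k (of_int n * s) = of_int n * k s" for n s
  proof (cases "n \<ge> 0")
    case True
    then show ?thesis using nat[of "nat n" s] by simp
  next
    case False
    have "k (of_nat (nat (-n)) * s) + k (of_int n * s) = k 0"
      unfolding add[symmetric] using False by (simp add: algebra_simps)
    then show ?thesis using False nat[of "nat (-n)" s] k0 by simp
  qed
  obtain B where B: "\<forall>f\<in>{0..1}. \<bar>k f\<bar> \<le> B"
    using compact_imp_bounded[OF compact_continuous_image[OF continuous_on_subset[OF cont] compact_Icc, of 0 1]]
    unfolding bounded_iff by auto
  have *: "of_nat n * \<bar>k t - k 1 * t\<bar> \<le> \<bar>k 1\<bar> + B" for n :: nat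
  proof -
    define m where "m = \<lfloor>of_nat n * t\<rfloor>"
    define f where "f = of_nat n * t - of_int m"
    have f: "0 \<le> f" "f \<le> 1" unfolding f_def m_def by linarith+
    have "of_nat n * k t = k (of_int m * 1 + f)" by (simp add: nat[symmetric] f_def)
    also have "\<dots> = of_int m * k 1 + k f" by (simp only: add int)
    finally have "of_nat n * (k t - k 1 * t) = k f - f * k 1"
      by (simp add: f_def algebra_simps)
    then have "of_nat n * \<bar>k t - k 1 * t\<bar> = \<bar>k f - f * k 1\<bar>"
      by (metis abs_mult abs_of_nat)
    also have "\<dots> \<le> \<bar>k f\<bar> + \<bar>f * k 1\<bar>" by (rule abs_triangle_ineq4)
    also have "\<bar>f * k 1\<bar> \<le> \<bar>k 1\<bar>" using f by (simp add: abs_mult mult_left_le_one_le)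
    also have "\<bar>k f\<bar> \<le> B" using B f by auto
    finally show ?thesis by simp
  qed
  have "\<bar>k t - k 1 * t\<bar> = 0"
  proof (rule ccontr)
    assume "\<bar>k t - k 1 * t\<bar> \<noteq> 0"
    then obtain n :: nat where "of_nat n * \<bar>k t - k 1 * t\<bar> > \<bar>k 1\<bar> + B"
      using ex_less_of_nat_mult[of "\<bar>k t - k 1 * t\<bar>"] by (metis abs_ge_zero order_le_less)
    with *[of n] show False by simp
  qed
  then show ?thesis by simp
qed

text \<open>Lift \<open>e\<close> to a continuous angle \<open>h\<close>. The additivity defect of
  \<open>h\<close> is continuous with values in the multiples of \<open>2 * pi\<close>, hence
  constant, and subtracting \<open>h 0\<close> makes the angle additive.\<close>

lemma continuous_circle_character:
  fixes e :: "real \<Rightarrow> complex"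
  assumes cont: "continuous_on UNIV e" and mult: "\<And>a b. e (a + b) = e a * e b" and norm: "\<And>a. norm (e a) = 1"
  shows "\<exists>\<gamma>::real. \<forall>a. e a = iexp (\<gamma> * a)"
proof -
  have "e a \<noteq> 0" for a using norm[of a] by auto
  then obtain g where g: "continuous_on UNIV g" "\<And>a. e a = exp (g a)"
    by (rule continuous_logarithm_on_contractible[OF cont convex_imp_contractible[OF convex_UNIV]]) auto
  define h where "h = (\<lambda>a. Im (g a))"
  have h: "continuous_on UNIV h" unfolding h_def by (intro continuous_intros g)
  have "Re (g a) = 0" for a using norm[of a] g(2)[of a] by (simp add: norm_exp_eq_Re)
  then have e: "e a = iexp (h a)" for a
    unfolding g(2) h_def by (intro arg_cong[where f = exp]) (simp add: complex_eq_iff)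
  define f where "f = (\<lambda>p. h (fst p + snd p) - h (fst p) - h (snd p))"
  have f: "\<exists>n::int. f p = of_int (2 * n) * pi" for p
  proof -
    have "iexp (f p) = e (fst p + snd p) / e (fst p) / e (snd p)"
      unfolding e f_def by (simp add: exp_diff right_diff_distrib)
    also have "\<dots> = 1" using norm[of "fst p"] norm[of "snd p"] by (auto simp: mult)
    finally show ?thesis by (simp add: exp_eq_1)
  qed
  have contf: "continuous_on UNIV f" unfolding f_def
    by (intro continuous_intros continuous_on_compose2[OF h]) auto
  have "f constant_on UNIV"
  proof (rule continuous_discrete_range_constant[OF connected_UNIV contf], rule exI[of _ "2 * pi"], intro conjI allI impI)
    fix x y assume "y \<in> UNIV \<and> f y \<noteq> f x"
    then obtain m n :: int where "f y = of_int (2 * m) * pi" "f x = of_int (2 * n) * pi" "m \<noteq> n"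
      using f[of x] f[of y] by auto
    then have "f y - f x = of_int (m - n) * (2 * pi)" by (simp add: algebra_simps)
    then have "norm (f y - f x) = \<bar>of_int (m - n)\<bar> * (2 * pi)"
      by (simp only: real_norm_def abs_mult) simp
    moreover have "\<bar>of_int (m - n) :: real\<bar> \<ge> 1" using \<open>m \<noteq> n\<close> by linarith
    ultimately show "2 * pi \<le> norm (f y - f x)" by simp
  qed simp
  then have fc: "f p = f (0, 0)" for p unfolding constant_on_def by (metis UNIV_I)
  define k where "k = (\<lambda>a. h a - h 0)"
  have "k (a + b) = k a + k b" for a b using fc[of "(a, b)"] by (simp add: f_def k_def)
  moreover have "continuous_on UNIV k" unfolding k_def by (intro continuous_intros h)
  ultimately have k: "k a = k 1 * a" for a by (rule additive_continuous_imp_linear[rotated])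
  have "e 0 * e 0 = e 0" "e 0 \<noteq> 0" using mult[of 0 0] norm[of 0] by auto
  then have "e 0 = 1" by simp
  then have "iexp (h 0) = 1" by (simp add: e)
  moreover have "e a = iexp (k a) * iexp (h 0)" for a
    unfolding e k_def by (simp add: exp_add[symmetric] algebra_simps)
  ultimately have "e a = iexp (k 1 * a)" for a using k[of a] by simp
  then show ?thesis by blast
qed

section \<open>Limits of products of simple rational factors\<close>

text \<open>That \<open>l'\<close> rearranges the first \<open>n\<close> terms is expressed through
  products over arbitrary \<open>h\<close>, the only way in which it enters the limit
  theorem.\<close>

lemma sort_finite_sequence:
  fixes l :: "nat \<Rightarrow> real"
  obtains l' where "\<And>j. n \<le> j \<Longrightarrow> l' j = 0" "\<And>i j. i \<le> j \<Longrightarrow> \<bar>l' j\<bar> \<le> \<bar>l' i\<bar>"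
    "\<And>h :: real \<Rightarrow> complex. (\<Prod>j<n. h (l' j)) = (\<Prod>j<n. h (l j))"
proof -
  define xs where "xs = sort_key (\<lambda>x. - \<bar>x\<bar>) (map l [0..<n])"
  define l' where "l' = (\<lambda>j. if j < n then xs ! j else 0)"
  have len: "length xs = n" by (simp add: xs_def)
  have srt: "sorted (map (\<lambda>x. - \<bar>x\<bar>) xs)" by (simp add: xs_def)
  have "\<bar>l' j\<bar> \<le> \<bar>l' i\<bar>" if "i \<le> j" for i j
    using sorted_nth_mono[OF srt that] that by (auto simp: l'_def len)
  moreover have "(\<Prod>j<n. h (l' j)) = (\<Prod>j<n. h (l j))" for h :: "real \<Rightarrow> complex"
  proof -
    have "(\<Prod>j<n. h (l' j)) = (\<Prod>j<n. h (xs ! j))" by (simp add: l'_def)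
    also have "\<dots> = prod_list (map h xs)"
      by (simp add: prod.list_conv_set_nth len atLeast0LessThan)
    also have "\<dots> = prod_mset (image_mset h (mset xs))" by (metis mset_map prod_mset_prod_list)
    also have "mset xs = mset (map l [0..<n])" by (simp add: xs_def)
    also have "prod_mset (image_mset h (mset (map l [0..<n]))) = prod_list (map h (map l [0..<n]))"
      by (metis mset_map prod_mset_prod_list)
    also have "\<dots> = (\<Prod>j<n. h (l j))"
      by (simp add: prod.list_conv_set_nth atLeast0LessThan)
    finally show ?thesis .
  qed
  ultimately show ?thesis using that[of l'] by (auto simp: l'_def)
qed

lemma diagonal_convergent_subsequence:
  fixes u :: "nat \<Rightarrow> nat \<Rightarrow> real"
  assumes bound: "\<And>k j. \<bar>u k j\<bar> \<le> B j"
  obtains r l where "strict_mono (r :: nat \<Rightarrow> nat)" "\<And>j. (\<lambda>k. u (r k) j) \<longlonglongrightarrow> l j"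
proof -
  interpret subseqs "\<lambda>j s. convergent (\<lambda>k. u (s k) j)"
  proof
    fix j and s :: "nat \<Rightarrow> nat"
    have "\<forall>k. u (s k) j \<in> {- B j..B j}" using bound[of _ j] by (auto simp: abs_le_iff minus_le_iff)
    then obtain l r where "strict_mono r" "((\<lambda>k. u (s k) j) \<circ> r) \<longlonglongrightarrow> l"
      by (rule seq_compactE[OF compact_imp_seq_compact[OF compact_Icc]])
    then show "\<exists>r'. strict_mono r' \<and> convergent (\<lambda>k. u ((s \<circ> r') k) j)"
      by (intro exI[of _ r]) (auto simp: o_def convergent_def)
  qed
  \<comment> \<open>The diagonal sequence is a subsequence of the \<open>j\<close>-th chosen one
    only after its first \<open>Suc j\<close> terms; the shift is removed afterwards by
    \<open>LIMSEQ_offset\<close>.\<close>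
  have "convergent (\<lambda>k. u ((diagseq \<circ> (+) (Suc j)) k) j)" for j
  proof (rule diagseq_holds)
    fix r s :: "nat \<Rightarrow> nat" and n assume "strict_mono r" "convergent (\<lambda>k. u (s k) n)"
    then show "convergent (\<lambda>k. u ((s \<circ> r) k) n)"
      using convergent_subseq_convergent[of "\<lambda>k. u (s k) n" r] by (simp add: o_def)
  qed
  moreover have "(\<lambda>k. u ((diagseq \<circ> (+) (Suc j)) k) j) = (\<lambda>k. u (diagseq (k + Suc j)) j)" for j
    by (simp add: add.commute o_def)
  ultimately have "convergent (\<lambda>k. u (diagseq (k + Suc j)) j)" for j by (simp only:)
  then have "\<exists>l. (\<lambda>k. u (diagseq (k + Suc j)) j) \<longlonglongrightarrow> l" for j
    unfolding convergent_def .
  then have "\<exists>l. (\<lambda>k. u (diagseq k) j) \<longlonglongrightarrow> l" for j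
    using LIMSEQ_offset[of "\<lambda>k. u (diagseq k) j" "Suc j"] by blast
  then show ?thesis using that[OF subseq_diagseq] by metis
qed

lemma tannery_seq:
  fixes f :: "nat \<Rightarrow> 'b \<Rightarrow> complex"
  assumes "\<And>j. (f j \<longlongrightarrow> g j) F" "eventually (\<lambda>n. \<forall>j. norm (f j n) \<le> M j) F" "summable M" "F \<noteq> bot"
  shows "((\<lambda>n. \<Sum>j. f j n) \<longlongrightarrow> (\<Sum>j. g j)) F"
proof -
  have "eventually (\<lambda>(j, n). norm (f j n) \<le> M j) (at_top \<times>\<^sub>F F)"
    using eventually_prodI[OF always_eventually[of "\<lambda>_. True"] assms(2), of at_top]
    by (rule eventually_mono) auto
  from tannerys_theorem[OF assms(1) this assms(3,4)] show ?thesis by blast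
qed

lemma continuous_F_param:
  fixes x :: "nat \<Rightarrow> real"
  assumes x: "summable (\<lambda>k. (x k)\<^sup>2)" shows "continuous_on UNIV (F_param \<gamma>1 \<gamma>2 x)"
proof -
  have "((\<lambda>b. \<Sum>k. logfac (b * x k)) \<longlongrightarrow> (\<Sum>k. logfac (a * x k))) (at a)" for a
  proof (rule tannery_seq[where M = "\<lambda>k. (\<bar>a\<bar> + 1) ^ 3 * \<bar>x k\<bar> ^ 3"])
    show "((\<lambda>b. logfac (b * x k)) \<longlongrightarrow> logfac (a * x k)) (at a)" for k
      by (rule isCont_tendsto_compose[OF continuous_logfac]) (intro tendsto_intros)
    have "eventually (\<lambda>b. dist b a < 1) (at a)" by (rule tendstoD) (auto intro: tendsto_ident_at)
    then show "eventually (\<lambda>b. \<forall>k. norm (logfac (b * x k)) \<le> (\<bar>a\<bar> + 1) ^ 3 * \<bar>x k\<bar> ^ 3) (at a)"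
    proof eventually_elim
      case (elim b)
      then have "\<bar>b\<bar> \<le> \<bar>a\<bar> + 1" by (simp add: dist_real_def)
      show ?case
      proof
        fix k
        have "norm (logfac (b * x k)) \<le> \<bar>b\<bar> ^ 3 * \<bar>x k\<bar> ^ 3"
          using norm_logfac_le[of "b * x k"] by (simp add: abs_mult power_mult_distrib)
        also have "\<dots> \<le> (\<bar>a\<bar> + 1) ^ 3 * \<bar>x k\<bar> ^ 3"
          using \<open>\<bar>b\<bar> \<le> \<bar>a\<bar> + 1\<close> by (intro mult_right_mono power_mono) auto
        finally show "norm (logfac (b * x k)) \<le> (\<bar>a\<bar> + 1) ^ 3 * \<bar>x k\<bar> ^ 3" .
      qed
    qed
    show "summable (\<lambda>k. (\<bar>a\<bar> + 1) ^ 3 * \<bar>x k\<bar> ^ 3)" by (intro summable_mult summable_cube_of_square x)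
  qed simp
  then have "isCont (\<lambda>b. \<Sum>k. logfac (b * x k)) a" for a by (simp add: isCont_def)
  then have "isCont (F_param \<gamma>1 \<gamma>2 x) a" for a
    unfolding F_param_eq_exp[OF x, abs_def] by (intro continuous_intros) auto
  then show ?thesis by (simp add: continuous_on_eq_continuous_at)
qed

text \<open>The moduli of the products control the sums of squares \<open>s2\<close>, and these
  control everything except the linear sums \<open>s1\<close>, which may diverge. After dividing by
  the remaining factors, whose limit is \<open>P\<close>, only the exponentials of \<open>s1\<close>
  are left, and their limit is a continuous character.\<close>

theorem limit_of_exponential_products:
  fixes lam :: "nat \<Rightarrow> nat \<Rightarrow> real" and N :: "nat \<Rightarrow> nat" and F :: "real \<Rightarrow> complex"
  assumes F: "continuous_on UNIV F" "F 0 = 1"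
    and conv: "\<And>a. a \<in> \<rat> \<Longrightarrow> (\<lambda>k. \<Prod>j<N k. 1 / (1 - \<i> * of_real (a * lam k j))) \<longlonglongrightarrow> F a"
  shows "\<exists>\<gamma>1 \<gamma>2 x. \<gamma>2 \<ge> 0 \<and> summable (\<lambda>k. (x k)\<^sup>2) \<and> F = F_param \<gamma>1 \<gamma>2 x"
proof -
  define good where "good = (\<lambda>k l. (\<forall>j\<ge>N k. l j = (0::real)) \<and> (\<forall>i j. i \<le> j \<longrightarrow> \<bar>l j\<bar> \<le> \<bar>l i\<bar>) \<and>
      (\<forall>h :: real \<Rightarrow> complex. (\<Prod>j<N k. h (l j)) = (\<Prod>j<N k. h (lam k j))))"
  have "\<exists>l. good k l" for k
    unfolding good_def by (rule sort_finite_sequence[of "N k" "lam k"]) blast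
  then obtain l where "\<And>k. good k (l k)" by metis
  then have l0: "\<And>k j. N k \<le> j \<Longrightarrow> l k j = 0" and lmono: "\<And>k i j. i \<le> j \<Longrightarrow> \<bar>l k j\<bar> \<le> \<bar>l k i\<bar>"
    and lprod: "\<And>k (h :: real \<Rightarrow> complex). (\<Prod>j<N k. h (l k j)) = (\<Prod>j<N k. h (lam k j))"
    unfolding good_def by blast+
  have conv': "(\<lambda>k. \<Prod>j<N k. 1 / (1 - \<i> * of_real (a * l k j))) \<longlonglongrightarrow> F a" if "a \<in> \<rat>" for a
    using conv[OF that] lprod[of "\<lambda>t. 1 / (1 - \<i> * of_real (a * t))"] by simp
  define s2 where "s2 = (\<lambda>k. \<Sum>j<N k. (l k j)\<^sup>2)"
  \<comment> \<open>At a small positive rational \<open>a\<close> the limit \<open>F a\<close> is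
    nonzero, so the inverse squared moduli, which are products of
    \<open>1 + (a * l k j)\<^sup>2\<close>, stay bounded; such a product dominates the sum of its
    squares.\<close>
  obtain C where C: "\<And>k. s2 k \<le> C"
  proof -
    have "isCont F 0" using F by (simp add: continuous_on_eq_continuous_at)
    then have "F \<midarrow>0\<rightarrow> 1" using F(2) by (simp add: isCont_def)
    then obtain d where d: "d > 0" "\<And>a. a \<noteq> 0 \<Longrightarrow> \<bar>a\<bar> < d \<Longrightarrow> dist (F a) 1 < 1"
      using LIM_D[of F 1 0 1] by (auto simp: dist_norm)
    obtain a where a: "a \<in> \<rat>" "0 < a" "a < d" using Rats_dense_in_real[OF d(1)] by auto
    then have "F a \<noteq> 0" using d(2)[of a] by (auto simp: dist_norm)
    then have "(\<lambda>k. inverse ((norm (\<Prod>j<N k. 1 / (1 - \<i> * of_real (a * l k j))))\<^sup>2)) \<longlonglongrightarrow> inverse ((norm (F a))\<^sup>2)"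
      by (intro tendsto_intros conv' a) auto
    then have "Bseq (\<lambda>k. inverse ((norm (\<Prod>j<N k. 1 / (1 - \<i> * of_real (a * l k j))))\<^sup>2))"
      by (intro convergent_imp_Bseq convergentI)
    then obtain K where K: "\<And>k. \<bar>inverse ((norm (\<Prod>j<N k. 1 / (1 - \<i> * of_real (a * l k j))))\<^sup>2)\<bar> \<le> K"
      by (auto simp: Bseq_def)
    have "a\<^sup>2 * s2 k \<le> K" for k
    proof -
      have n: "inverse ((norm (1 / (1 - \<i> * complex_of_real t)))\<^sup>2) = 1 + t\<^sup>2" for t
        by (simp add: norm_divide power_divide cmod_power2)
      have "a\<^sup>2 * s2 k = (\<Sum>j<N k. (a * l k j)\<^sup>2)" by (simp add: s2_def sum_distrib_left power_mult_distrib)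
      also have "\<dots> \<le> (\<Prod>j<N k. 1 + (a * l k j)\<^sup>2)" by (rule sum_le_prod) simp
      also have "\<dots> = inverse ((norm (\<Prod>j<N k. 1 / (1 - \<i> * of_real (a * l k j))))\<^sup>2)"
        unfolding prod_norm[symmetric] prod_power_distrib prod_inversef[symmetric, unfolded o_def] by (simp only: n)
      also have "\<dots> \<le> K" using K[of k] by linarith
      finally show ?thesis .
    qed
    then have "s2 k \<le> K / a\<^sup>2" for k using a by (simp add: field_simps)
    then show ?thesis using that by blast
  qed
  have s2_nonneg: "0 \<le> s2 k" for k unfolding s2_def by (intro sum_nonneg) auto
  have C0: "0 \<le> C" using s2_nonneg[of 0] C[of 0] by linarith
  \<comment> \<open>The sequence is sorted, so \<open>j + 1\<close> squares at least as large as
    that of \<open>l k j\<close> fit into \<open>s2 k\<close>. The cube of this bound decays like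
    the power -3/2, which supplies the summable majorant for \<open>logfac\<close>.\<close>
  have lb: "\<bar>l k j\<bar> \<le> sqrt (C / (j + 1))" for k j
  proof (cases "j < N k")
    case True
    have "(j + 1) * (l k j)\<^sup>2 = (\<Sum>i<j+1. (l k j)\<^sup>2)" by simp
    also have "\<dots> \<le> (\<Sum>i<j+1. (l k i)\<^sup>2)"
      by (intro sum_mono) (use lmono in \<open>auto simp: abs_le_square_iff[symmetric]\<close>)
    also have "\<dots> \<le> s2 k" unfolding s2_def by (intro sum_mono2) (use True in auto)
    also have "\<dots> \<le> C" by (rule C)
    finally have "(l k j)\<^sup>2 \<le> C / (j + 1)" by (simp add: field_simps)
    then show ?thesis by (metis real_sqrt_abs real_sqrt_le_iff)
  next
    case False
    then show ?thesis using l0[of k j] C0 by simp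
  qed
  \<comment> \<open>Index 0 carries the sum of squares, so that one diagonal extraction settles
    \<open>s2\<close> and all single terms together.\<close>
  define u where "u = (\<lambda>k j. case j of 0 \<Rightarrow> s2 k | Suc j \<Rightarrow> l k j)"
  have "\<bar>u k j\<bar> \<le> (case j of 0 \<Rightarrow> C | Suc j \<Rightarrow> sqrt (C / (j + 1)))" for k j
    using C[of k] s2_nonneg[of k] lb by (auto simp: u_def split: nat.split)
  then obtain r lim where r: "strict_mono (r :: nat \<Rightarrow> nat)" "\<And>j. (\<lambda>k. u (r k) j) \<longlonglongrightarrow> lim j"
    using diagonal_convergent_subsequence[of u] by blast
  define c where "c = lim 0"
  define x where "x = (\<lambda>j. lim (Suc j))"
  have s2_lim: "(\<lambda>k. s2 (r k)) \<longlonglongrightarrow> c" using r(2)[of 0] by (simp add: u_def c_def)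
  have l_lim: "(\<lambda>k. l (r k) j) \<longlonglongrightarrow> x j" for j using r(2)[of "Suc j"] by (simp add: u_def x_def)
  have part: "(\<Sum>j<J. (x j)\<^sup>2) \<le> c" for J
  proof (rule LIMSEQ_le[OF _ s2_lim])
    show "(\<lambda>k. \<Sum>j<J. (l (r k) j)\<^sup>2) \<longlonglongrightarrow> (\<Sum>j<J. (x j)\<^sup>2)" by (intro tendsto_intros l_lim)
    have "(\<Sum>j<J. (l k j)\<^sup>2) \<le> s2 k" for k
    proof -
      have "(\<Sum>j<J. (l k j)\<^sup>2) \<le> (\<Sum>j<max J (N k). (l k j)\<^sup>2)" by (intro sum_mono2) auto
      also have "\<dots> = s2 k" unfolding s2_def by (intro sum.mono_neutral_right) (use l0 in auto)
      finally show ?thesis .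
    qed
    then show "\<exists>M. \<forall>n\<ge>M. (\<Sum>j<J. (l (r n) j)\<^sup>2) \<le> s2 (r n)" by blast
  qed
  have x: "summable (\<lambda>j. (x j)\<^sup>2)" by (rule summableI_nonneg_bounded[OF _ part]) simp
  have xc: "(\<Sum>j. (x j)\<^sup>2) \<le> c" by (rule suminf_le_const[OF x part])
  define \<gamma>2 where "\<gamma>2 = c - (\<Sum>j. (x j)\<^sup>2)"
  have \<gamma>2: "\<gamma>2 \<ge> 0" using xc by (simp add: \<gamma>2_def)
  define P where "P = F_param 0 \<gamma>2 x"
  have P: "P a = exp (- of_real (a\<^sup>2 / 2 * c) + (\<Sum>j. logfac (a * x j)))" for a
    unfolding P_def F_param_eq_exp[OF x] \<gamma>2_def by simp
  then have P0: "P a \<noteq> 0" for a by simp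
  have contP: "continuous_on UNIV P" unfolding P_def by (rule continuous_F_param[OF x])
  define s1 where "s1 = (\<lambda>k. \<Sum>j<N k. l k j)"
  define Q where "Q = (\<lambda>k a. exp (- of_real (a\<^sup>2 / 2 * s2 k) + (\<Sum>j. logfac (a * l k j))))"
  have prod_eq: "(\<Prod>j<N k. 1 / (1 - \<i> * of_real (a * l k j))) = iexp (s1 k * a) * Q k a" for k a
  proof -
    have "1 / (1 - \<i> * complex_of_real t) = exp (logfac t - of_real (t\<^sup>2 / 2) + \<i> * t)" for t
      unfolding exp_add exp_logfac by (simp add: exp_minus)
    then have "(\<Prod>j<N k. 1 / (1 - \<i> * of_real (a * l k j)))
        = exp (\<Sum>j<N k. logfac (a * l k j) - of_real ((a * l k j)\<^sup>2 / 2) + \<i> * of_real (a * l k j))"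
      by (simp only: exp_sum finite_lessThan)
    also have "(\<Sum>j<N k. logfac (a * l k j) - of_real ((a * l k j)\<^sup>2 / 2) + \<i> * of_real (a * l k j))
        = (\<Sum>j<N k. logfac (a * l k j)) - of_real (a\<^sup>2 / 2 * s2 k) + \<i> * of_real (s1 k * a)"
      by (simp add: sum.distrib sum_subtractf s2_def s1_def sum_distrib_left sum_distrib_right power_mult_distrib mult_ac)
    also have "(\<Sum>j<N k. logfac (a * l k j)) = (\<Sum>j. logfac (a * l k j))"
      by (intro suminf_finite[symmetric]) (use l0 in auto)
    finally show ?thesis by (simp add: Q_def exp_add[symmetric] algebra_simps)
  qed
  have Q_lim: "(\<lambda>k. Q (r k) a) \<longlonglongrightarrow> P a" for a
  proof -
    have "(\<lambda>k. \<Sum>j. logfac (a * l (r k) j)) \<longlonglongrightarrow> (\<Sum>j. logfac (a * x j))"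
    proof (rule tannery_seq[where M = "\<lambda>j. (\<bar>a\<bar> * sqrt C) ^ 3 * real (Suc j) powr (- 3 / 2)"])
      show "(\<lambda>k. logfac (a * l (r k) j)) \<longlonglongrightarrow> logfac (a * x j)" for j
        by (rule isCont_tendsto_compose[OF continuous_logfac]) (intro tendsto_intros l_lim)
      have "norm (logfac (a * l k j)) \<le> (\<bar>a\<bar> * sqrt C) ^ 3 * real (Suc j) powr (- 3 / 2)" for k j
      proof -
        have "norm (logfac (a * l k j)) \<le> (\<bar>a\<bar> * \<bar>l k j\<bar>) ^ 3" using norm_logfac_le[of "a * l k j"] by (simp add: abs_mult)
        also have "\<dots> \<le> (\<bar>a\<bar> * sqrt (C / (j + 1))) ^ 3" by (intro power_mono mult_left_mono lb) auto
        also have "sqrt (C / (j + 1)) = sqrt C * real (Suc j) powr (- 1 / 2)"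
          by (simp add: real_sqrt_divide powr_minus_divide powr_half_sqrt add.commute)
        also have "(\<bar>a\<bar> * (sqrt C * real (Suc j) powr (- 1 / 2))) ^ 3 = (\<bar>a\<bar> * sqrt C) ^ 3 * (real (Suc j) powr (- 1 / 2)) ^ 3"
          by (simp add: power_mult_distrib)
        also have "(real (Suc j) powr (- 1 / 2)) ^ 3 = real (Suc j) powr (- 3 / 2)"
          by (simp add: powr_realpow[symmetric] powr_powr)
        finally show ?thesis .
      qed
      then show "\<forall>\<^sub>F k in sequentially. \<forall>j. norm (logfac (a * l (r k) j)) \<le> (\<bar>a\<bar> * sqrt C) ^ 3 * real (Suc j) powr (- 3 / 2)"
        by simp
      have "summable (\<lambda>j. real j powr (- 3 / 2))" by (simp add: summable_real_powr_iff)
      then have "summable (\<lambda>j. real (Suc j) powr (- 3 / 2))" by (subst summable_Suc_iff)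
      then show "summable (\<lambda>j. (\<bar>a\<bar> * sqrt C) ^ 3 * real (Suc j) powr (- 3 / 2))" by (rule summable_mult)
    qed simp
    then show ?thesis unfolding Q_def P by (intro tendsto_intros s2_lim)
  qed
  \<comment> \<open>What remains for the linear term. Its continuity comes from that of
    \<open>F\<close> and \<open>P\<close> and not from the convergence, which is available at
    rational points only.\<close>
  define e where "e = (\<lambda>a. F a / P a)"
  have conte: "continuous_on UNIV e" unfolding e_def by (intro continuous_intros F contP) (use P0 in auto)
  have e_lim: "(\<lambda>k. iexp (s1 (r k) * a)) \<longlonglongrightarrow> e a" if "a \<in> \<rat>" for a
  proof -
    have "(\<lambda>k. (iexp (s1 (r k) * a) * Q (r k) a) / Q (r k) a) \<longlonglongrightarrow> F a / P a"
      by (intro tendsto_divide Q_lim P0 LIMSEQ_subseq_LIMSEQ[OF conv'[OF that] r(1), unfolded o_def prod_eq])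
    moreover have "Q k a \<noteq> 0" for k by (simp add: Q_def)
    ultimately show ?thesis by (simp add: e_def)
  qed
  have dense: "f a = g a" if "continuous_on UNIV f" "continuous_on UNIV g" "\<And>q. q \<in> \<rat> \<Longrightarrow> f q = g q"
    for f g :: "real \<Rightarrow> complex" and a
  proof -
    have "closure \<rat> \<subseteq> {x. f x = g x}"
      by (rule closure_minimal) (use that closed_Collect_eq[of f g] in auto)
    then show ?thesis using Rats_closure_real by auto
  qed
  \<comment> \<open>The identity is extended from rational to real arguments one variable at a time
    by density.\<close>
  have mult_rat: "e (a + b) = e a * e b" if "a \<in> \<rat>" "b \<in> \<rat>" for a b
  proof (rule LIMSEQ_unique)
    show "(\<lambda>k. iexp (s1 (r k) * (a + b))) \<longlonglongrightarrow> e (a + b)" using that by (intro e_lim) auto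
    have "(\<lambda>k. iexp (s1 (r k) * a) * iexp (s1 (r k) * b)) \<longlonglongrightarrow> e a * e b"
      by (intro tendsto_mult e_lim that)
    then show "(\<lambda>k. iexp (s1 (r k) * (a + b))) \<longlonglongrightarrow> e a * e b"
      by (simp add: exp_add[symmetric] algebra_simps)
  qed
  have mult_half: "e (a + b) = e a * e b" if "a \<in> \<rat>" for a b
    by (rule dense[of "\<lambda>b. e (a + b)" "\<lambda>b. e a * e b"])
       (use mult_rat that in \<open>auto intro!: continuous_intros continuous_on_compose2[OF conte] conte\<close>)
  have mult: "e (a + b) = e a * e b" for a b
    by (rule dense[of "\<lambda>a. e (a + b)" "\<lambda>a. e a * e b"])
       (use mult_half in \<open>auto intro!: continuous_intros continuous_on_compose2[OF conte] conte\<close>)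
  have "complex_of_real (norm (e a)) = 1" for a
  proof (rule dense[of "\<lambda>a. complex_of_real (norm (e a))" "\<lambda>_. 1"])
    show "continuous_on UNIV (\<lambda>a. complex_of_real (norm (e a)))" by (intro continuous_intros conte)
    fix q :: real assume "q \<in> \<rat>"
    then have "(\<lambda>k. norm (iexp (s1 (r k) * q))) \<longlonglongrightarrow> norm (e q)" by (intro tendsto_norm e_lim)
    then have "norm (e q) = 1" by (simp add: LIMSEQ_const_iff)
    then show "complex_of_real (norm (e q)) = 1" by simp
  qed auto
  then have "norm (e a) = 1" for a by (metis of_real_eq_1_iff)
  then obtain \<gamma>1 where eg: "\<And>a. e a = iexp (\<gamma>1 * a)" using continuous_circle_character[OF conte mult] by blast
  then have "F a = iexp (\<gamma>1 * a) * P a" for a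
    using eg[of a] P0[of a] unfolding e_def by (metis nonzero_eq_divide_eq)
  then have "F a = F_param \<gamma>1 \<gamma>2 x a" for a
    unfolding P F_param_eq_exp[OF x] \<gamma>2_def by (simp add: exp_add[symmetric] algebra_simps)
  then show ?thesis using \<gamma>2 x by (intro exI[of _ \<gamma>1] exI[of _ \<gamma>2] exI[of _ x]) auto
qed

section \<open>Gaussian vectors\<close>

lemma integrable_abs_gauss:
  fixes \<kappa> :: complex
  assumes "Re \<kappa> > 0"
  shows "integrable lborel (\<lambda>x. \<bar>x\<bar> ^ k *\<^sub>R exp (- \<kappa> * of_real (x\<^sup>2)))"
proof -
  \<comment> \<open>With this scale the modulus of the Gaussian factor is a multiple of the standard
    normal density at \<open>s * x\<close>.\<close>
  define s where "s = sqrt (2 * Re \<kappa>)"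
  have s: "s > 0" "s\<^sup>2 = 2 * Re \<kappa>" using assms by (auto simp: s_def)
  have "integrable lborel (\<lambda>x. std_normal_density (0 + s * x) * \<bar>0 + s * x\<bar> ^ k)"
    by (rule lborel_integrable_real_affine[OF integrable_std_normal_moment_abs]) (use s in auto)
  then have "integrable lborel (\<lambda>x. (sqrt (2 * pi) / s ^ k) * (std_normal_density (0 + s * x) * \<bar>0 + s * x\<bar> ^ k))"
    by (rule integrable_mult_right)
  then show ?thesis
  proof (rule Bochner_Integration.integrable_bound)
    have "norm (\<bar>x\<bar> ^ k *\<^sub>R exp (- \<kappa> * of_real (x\<^sup>2))) = (sqrt (2 * pi) / s ^ k) * (std_normal_density (s * x) * \<bar>s * x\<bar> ^ k)" for x
      using s by (simp add: std_normal_density_def norm_mult power_mult_distrib abs_mult field_simps)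
    then show "AE x in lborel. norm (\<bar>x\<bar> ^ k *\<^sub>R exp (- \<kappa> * of_real (x\<^sup>2)))
        \<le> norm ((sqrt (2 * pi) / s ^ k) * (std_normal_density (0 + s * x) * \<bar>0 + s * x\<bar> ^ k))"
      using s(1) by (simp add: power_abs)
  qed measurable
qed

text \<open>The factor \<open>\<bar>x\<bar>\<close> is the Jacobian of the substitution used in
  \<open>gauss_integral_square\<close>. On each half line it makes the integrand an exact
  derivative, also for complex \<open>\<kappa>\<close>.\<close>

lemma integral_abs_gauss:
  fixes \<kappa> :: complex
  assumes \<kappa>: "Re \<kappa> > 0"
  shows "(LINT x|lborel. \<bar>x\<bar> *\<^sub>R exp (- \<kappa> * of_real (x\<^sup>2))) = 1 / \<kappa>"
proof -
  define h where "h = (\<lambda>x::real. \<bar>x\<bar> *\<^sub>R exp (- \<kappa> * complex_of_real (x\<^sup>2)))"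
  have h: "integrable lborel h" using integrable_abs_gauss[OF \<kappa>, of 1] by (simp add: h_def)
  have hp: "integrable lborel (\<lambda>x. indicator {0<..} x *\<^sub>R h x)" and hn: "integrable lborel (\<lambda>x. indicator {..<0} x *\<^sub>R h x)"
    using h by (auto intro!: integrable_mult_indicator)
  have k0: "\<kappa> \<noteq> 0" using \<kappa> by auto
  have E0: "einterval 0 \<infinity> = {0<..}" by (auto simp: einterval_def)
  have "(LBINT x=0..\<infinity>. h x) = 0 - (- 1 / (2 * \<kappa>))"
  proof (rule interval_integral_FTC_integrable[where F = "\<lambda>x. - exp (- \<kappa> * complex_of_real (x\<^sup>2)) / (2 * \<kappa>)"])
    fix x :: real assume "0 < ereal x"
    then have x: "x > 0" by simp
    have "((\<lambda>z. - exp (- \<kappa> * z\<^sup>2) / (2 * \<kappa>)) has_field_derivative (complex_of_real x * exp (- \<kappa> * (complex_of_real x)\<^sup>2))) (at (complex_of_real x))"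
      using k0 by (auto intro!: derivative_eq_intros simp: field_simps)
    from has_vector_derivative_real_field[OF this]
    show "((\<lambda>x. - exp (- \<kappa> * complex_of_real (x\<^sup>2)) / (2 * \<kappa>)) has_vector_derivative h x) (at x)"
      using x by (simp add: h_def scaleR_conv_of_real)
    show "isCont h x" unfolding h_def by (intro continuous_intros)
  next
    show "set_integrable lborel (einterval 0 \<infinity>) h"
      using hp by (simp add: set_integrable_def E0)
    have "(((\<lambda>x. - exp (- \<kappa> * complex_of_real (x\<^sup>2)) / (2 * \<kappa>))) \<longlongrightarrow> - 1 / (2 * \<kappa>)) (at_right 0)"
      by (rule tendsto_eq_intros refl | simp add: k0)+
    then show "(((\<lambda>x. - exp (- \<kappa> * complex_of_real (x\<^sup>2)) / (2 * \<kappa>)) \<circ> real_of_ereal) \<longlongrightarrow> - 1 / (2 * \<kappa>)) (at_right 0)"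
      by (simp add: zero_ereal_def ereal_tendsto_simps)
    have "((\<lambda>x. - exp (- \<kappa> * complex_of_real (x\<^sup>2)) / (2 * \<kappa>)) \<longlongrightarrow> 0) at_top"
    proof (rule tendsto_norm_zero_cancel)
      have "((\<lambda>x. exp (- Re \<kappa> * x\<^sup>2) / (2 * norm \<kappa>)) \<longlongrightarrow> 0 / (2 * norm \<kappa>)) at_top"
        using \<kappa> k0 by (intro tendsto_divide tendsto_const filterlim_compose[OF exp_at_bot]
            filterlim_tendsto_neg_mult_at_bot[OF tendsto_const] filterlim_pow_at_top filterlim_ident) auto
      then show "((\<lambda>x. norm (- exp (- \<kappa> * complex_of_real (x\<^sup>2)) / (2 * \<kappa>))) \<longlongrightarrow> 0) at_top"
        by (simp add: norm_divide norm_mult)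
    qed
    then show "(((\<lambda>x. - exp (- \<kappa> * complex_of_real (x\<^sup>2)) / (2 * \<kappa>)) \<circ> real_of_ereal) \<longlongrightarrow> 0) (at_left \<infinity>)"
      by (simp add: ereal_tendsto_simps)
  qed simp
  then have p: "(LINT x|lborel. indicator {0<..} x *\<^sub>R h x) = 1 / (2 * \<kappa>)"
    by (simp add: interval_lebesgue_integral_def set_lebesgue_integral_def E0)
  have "(LINT x|lborel. indicator {..<0} x *\<^sub>R h x) = (LINT x|lborel. indicator {..<0} (0 + - 1 * x) *\<^sub>R h (0 + - 1 * x))"
    using lborel_integral_real_affine[of "-1" "\<lambda>x. indicator {..<0} x *\<^sub>R h x" 0] by simp
  also have "\<dots> = (LINT x|lborel. indicator {0<..} x *\<^sub>R h x)"
    by (rule Bochner_Integration.integral_cong) (auto simp: h_def indicator_def)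
  finally have n: "(LINT x|lborel. indicator {..<0} x *\<^sub>R h x) = 1 / (2 * \<kappa>)" using p by simp
  have "(LINT x|lborel. h x) = (LINT x|lborel. indicator {0<..} x *\<^sub>R h x + indicator {..<0} x *\<^sub>R h x)"
    by (rule Bochner_Integration.integral_cong) (auto simp: h_def indicator_def)
  also have "\<dots> = 1 / (2 * \<kappa>) + 1 / (2 * \<kappa>)" by (simp add: Bochner_Integration.integral_add[OF hp hn] p n)
  finally show ?thesis using k0 by (simp add: h_def)
qed

text \<open>The substitution \<open>y = x s\<close> in the double integral of \<open>exp (- c (x\<^sup>2 + y\<^sup>2))\<close> replaces polar
  coordinates.\<close>

lemma gauss_integral_square:
  fixes c :: complex
  assumes c: "Re c > 0"
  shows "(LINT x|lborel. exp (- c * of_real (x\<^sup>2)))\<^sup>2 = pi / c"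
proof -
  define g where "g = (\<lambda>x::real. exp (- c * complex_of_real (x\<^sup>2)))"
  define f where "f = (\<lambda>(x::real) s. \<bar>x\<bar> *\<^sub>R exp (- (c * (1 + of_real (s\<^sup>2))) * complex_of_real (x\<^sup>2)))"
  have Re_s: "Re (c * (1 + complex_of_real (s\<^sup>2))) = Re c * (1 + s\<^sup>2)" for s by simp
  have Re_pos: "Re c * (1 + s\<^sup>2) > 0" for s using c by (intro mult_pos_pos) (auto simp: add_pos_nonneg)
  have [measurable]: "g \<in> borel_measurable borel" unfolding g_def by measurable
  have gi: "integrable lborel g" using integrable_abs_gauss[OF c, of 0] by (simp add: g_def)
  have fx: "f x s = g x * (\<bar>x\<bar> *\<^sub>R g (x * s))" for x s
    by (simp add: f_def g_def scaleR_conv_of_real algebra_simps power_mult_distrib flip: exp_add)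
  have aff: "(LINT s|lborel. \<bar>x\<bar> *\<^sub>R g (x * s)) = (LINT y|lborel. g y)" if "x \<noteq> 0" for x
    using lborel_integral_real_affine[OF that, of g 0] by simp
  have aff_i: "integrable lborel (\<lambda>s. g (x * s))" if "x \<noteq> 0" for x
    using lborel_integrable_real_affine[OF gi that, of 0] by simp
  have AE0: "AE x in lborel. x \<noteq> (0::real)" by (rule AE_lborel_singleton)
  have 1: "(LINT x|lborel. LINT s|lborel. f x s) = (LINT x|lborel. g x)\<^sup>2"
  proof -
    have "(LINT x|lborel. LINT s|lborel. f x s) = (LINT x|lborel. g x * (LINT y|lborel. g y))"
    proof (rule integral_cong_AE)
      show "AE x in lborel. (LINT s|lborel. f x s) = g x * (LINT y|lborel. g y)"
        using AE0
      proof eventually_elim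
        case (elim x)
        then show ?case by (simp only: fx integral_mult_right_zero aff[OF elim])
      qed
      show "(\<lambda>x. LINT s|lborel. f x s) \<in> borel_measurable lborel" unfolding f_def by measurable
    qed measurable
    then show ?thesis by (simp add: power2_eq_square)
  qed
  have ng: "norm (g y) = exp (- Re c * y\<^sup>2)" for y by (simp add: g_def)
  have ngi: "integrable lborel (\<lambda>y. norm (g y))" using gi by (rule integrable_norm)
  have "integrable (lborel \<Otimes>\<^sub>M lborel) (case_prod f)"
  proof (rule lborel_pair.Fubini_integrable)
    show "case_prod f \<in> borel_measurable (lborel \<Otimes>\<^sub>M lborel)" unfolding f_def by measurable
    have e: "AE x in lborel. (LINT s|lborel. norm (f x s)) = norm (g x) * (LINT y|lborel. norm (g y))"
      using AE0
    proof eventually_elim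
      case (elim x)
      have "(LINT s|lborel. norm (f x s)) = (LINT s|lborel. norm (g x) * (\<bar>x\<bar> *\<^sub>R norm (g (0 + x * s))))"
        by (simp add: fx norm_mult)
      also have "\<dots> = norm (g x) * (\<bar>x\<bar> *\<^sub>R (LINT s|lborel. norm (g (0 + x * s))))"
        by (simp only: integral_mult_right_zero integral_scaleR_right)
      also have "\<dots> = norm (g x) * (LINT y|lborel. norm (g y))"
        using lborel_integral_real_affine[OF elim, of "\<lambda>y. norm (g y)" 0] by simp
      finally show ?case .
    qed
    have "integrable lborel (\<lambda>x. norm (g x) * (LINT y|lborel. norm (g y)))" using ngi by simp
    then show "integrable lborel (\<lambda>x. LINT s|lborel. norm (case_prod f (x, s)))"
      by (rule integrable_cong_AE_imp) (use e in \<open>auto simp: f_def eq_commute\<close>)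
    show "AE x in lborel. integrable lborel (\<lambda>s. case_prod f (x, s))"
      using AE0 by eventually_elim (simp add: fx aff_i)
  qed
  then have "(LINT x|lborel. LINT s|lborel. f x s) = (LINT s|lborel. LINT x|lborel. f x s)"
    by (rule lborel_pair.Fubini_integral[symmetric])
  also have "(\<lambda>s. LINT x|lborel. f x s) = (\<lambda>s. (1 / c) * complex_of_real (inverse (1 + s\<^sup>2)))"
  proof
    fix s
    have "(LINT x|lborel. f x s) = 1 / (c * (1 + complex_of_real (s\<^sup>2)))"
      unfolding f_def by (rule integral_abs_gauss) (use Re_pos Re_s in simp)
    then show "(LINT x|lborel. f x s) = (1 / c) * complex_of_real (inverse (1 + s\<^sup>2))"
      by (simp add: divide_inverse)
  qed
  also have "(LINT s|lborel. (1 / c) * complex_of_real (inverse (1 + s\<^sup>2))) = (1 / c) * complex_of_real pi"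
  proof -
    have "(LINT s|lborel. inverse (1 + s\<^sup>2)) = pi"
      using LBINT_inverse_1_plus_square
      by (simp add: interval_lebesgue_integral_def set_lebesgue_integral_def)
    then show ?thesis by (simp only: integral_mult_right_zero integral_complex_of_real)
  qed
  finally show ?thesis using 1 by (simp add: g_def)
qed

text \<open>Stated for the square because a complex Gaussian coordinate has two independent real
  parts; no branch of the complex square root has to be chosen.\<close>

lemma std_normal_square_char:
  "(LINT x|std_normal_distribution. iexp (d * x\<^sup>2 / 2))\<^sup>2 = 1 / (1 - \<i> * of_real d)"
proof -
  define c where "c = (1 - \<i> * complex_of_real d) / 2"
  have c: "Re c > 0" by (simp add: c_def)
  have "(LINT x|std_normal_distribution. iexp (d * x\<^sup>2 / 2)) = (LINT x|lborel. std_normal_density x *\<^sub>R iexp (d * x\<^sup>2 / 2))"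
    by (rule integral_density) (auto simp: normal_density_nonneg)
  also have "\<dots> = (LINT x|lborel. (1 / sqrt (2 * pi)) *\<^sub>R exp (- c * complex_of_real (x\<^sup>2)))"
    by (rule Bochner_Integration.integral_cong)
      (simp_all add: std_normal_density_def c_def scaleR_conv_of_real exp_of_real[symmetric] exp_add[symmetric] algebra_simps diff_divide_distrib)
  also have "\<dots> = (1 / sqrt (2 * pi)) *\<^sub>R (LINT x|lborel. exp (- c * complex_of_real (x\<^sup>2)))"
    by (rule integral_scaleR_right)
  moreover have "(complex_of_real (sqrt (2 * pi)))\<^sup>2 = 2 * of_real pi"
    by (simp flip: of_real_power)
  ultimately have "(LINT x|std_normal_distribution. iexp (d * x\<^sup>2 / 2))\<^sup>2
      = (1 / sqrt (2 * pi))\<^sup>2 *\<^sub>R (LINT x|lborel. exp (- c * complex_of_real (x\<^sup>2)))\<^sup>2"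
    by (simp add: scaleR_conv_of_real power_mult_distrib power_divide)
  also have "\<dots> = (1 / (2 * pi)) *\<^sub>R (pi / c)"
    unfolding gauss_integral_square[OF c] by (simp add: power_divide)
  also have "\<dots> = 1 / (1 - \<i> * of_real d)"
    by (simp add: c_def scaleR_conv_of_real field_simps)
  finally show ?thesis .
qed

section \<open>Infinite products of Gaussian variables\<close>

text \<open>Restriction to \<open>J\<close> carries the infinite product measure to the finite one,
  where the integral of a product of functions of single coordinates factorises.\<close>

lemma (in product_prob_space) integral_prod_coordinates:
  fixes f :: "'i \<Rightarrow> 'a \<Rightarrow> 'b :: {real_normed_field, banach, second_countable_topology}"
  assumes J: "finite J" "J \<subseteq> I" and f: "\<And>i. i \<in> J \<Longrightarrow> integrable (M i) (f i)"
  shows "integrable (PiM I M) (\<lambda>\<omega>. \<Prod>i\<in>J. f i (\<omega> i))"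
    and "(LINT \<omega>|PiM I M. (\<Prod>i\<in>J. f i (\<omega> i))) = (\<Prod>i\<in>J. integral\<^sup>L (M i) (f i))"
proof -
  have [measurable]: "(\<lambda>\<omega>. restrict \<omega> J) \<in> measurable (PiM I M) (PiM J M)"
    by (rule measurable_restrict_subset[OF J(2)])
  have i: "integrable (PiM J M) (\<lambda>\<omega>. \<Prod>i\<in>J. f i (\<omega> i))" by (rule product_integrable_prod[OF J(1) f])
  have m: "(\<lambda>\<omega>. \<Prod>i\<in>J. f i (\<omega> i)) \<in> borel_measurable (PiM J M)" using i by (rule borel_measurable_integrable)
  have D: "distr (PiM I M) (PiM J M) (\<lambda>x. restrict x J) = PiM J M" by (rule distr_PiM_restrict_finite[OF J])
  have r: "(\<Prod>i\<in>J. f i (restrict \<omega> J i)) = (\<Prod>i\<in>J. f i (\<omega> i))" for \<omega> by simp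
  have "integrable (distr (PiM I M) (PiM J M) (\<lambda>x. restrict x J)) (\<lambda>\<omega>. \<Prod>i\<in>J. f i (\<omega> i))" using i by (simp only: D)
  then show "integrable (PiM I M) (\<lambda>\<omega>. \<Prod>i\<in>J. f i (\<omega> i))"
    by (subst (asm) integrable_distr_eq) (use m in \<open>simp_all only: r, auto\<close>)
  have "(LINT \<omega>|PiM J M. (\<Prod>i\<in>J. f i (\<omega> i))) = (LINT \<omega>|PiM I M. (\<Prod>i\<in>J. f i (\<omega> i)))"
    by (subst D[symmetric], subst integral_distr) (use m in \<open>simp_all only: r, auto\<close>)
  then show "(LINT \<omega>|PiM I M. (\<Prod>i\<in>J. f i (\<omega> i))) = (\<Prod>i\<in>J. integral\<^sup>L (M i) (f i))"
    using product_integral_prod[OF J(1) f] by simp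
qed

text \<open>Used in two roles: the coordinates \<open>(i, 0)\<close> and \<open>(i, 1)\<close> are
  the parts of a complex Gaussian vector, and the whole array gives the \<open>hcoord\<close>
  coordinates of a Gaussian Hermitian matrix.\<close>

definition gauss :: "(nat \<times> nat \<Rightarrow> real) measure" where
  "gauss = PiM UNIV (\<lambda>_. std_normal_distribution)"

lemma prob_space_std_normal: "prob_space std_normal_distribution"
  by (rule prob_space_normal_density) simp

lemma product_prob_space_std_normal: "product_prob_space (\<lambda>_. std_normal_distribution)"
  by (auto simp: product_prob_space_def product_sigma_finite_def product_prob_space_axioms_def
      prob_space_std_normal prob_space_imp_sigma_finite)

lemma prob_space_gauss: "prob_space gauss"
  unfolding gauss_def by (rule prob_space_PiM) (rule prob_space_std_normal)

lemma sets_gauss [measurable_cong]: "sets gauss = sets (PiM UNIV (\<lambda>_. borel))"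
  unfolding gauss_def by (rule sets_PiM_cong) auto

lemma space_gauss [simp]: "space gauss = UNIV"
  by (auto simp: gauss_def space_PiM)

lemma gauss_coord_measurable [measurable]: "(\<lambda>\<omega>. \<omega> p) \<in> borel_measurable gauss"
  by measurable

lemma gauss_integral_prod:
  fixes f :: "nat \<times> nat \<Rightarrow> real \<Rightarrow> 'b :: {real_normed_field, banach, second_countable_topology}"
  assumes "finite J" "\<And>p. p \<in> J \<Longrightarrow> integrable std_normal_distribution (f p)"
  shows "integrable gauss (\<lambda>\<omega>. \<Prod>p\<in>J. f p (\<omega> p))"
    "(LINT \<omega>|gauss. (\<Prod>p\<in>J. f p (\<omega> p))) = (\<Prod>p\<in>J. integral\<^sup>L std_normal_distribution (f p))"
  using product_prob_space.integral_prod_coordinates[OF product_prob_space_std_normal, of J UNIV f] assms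
  unfolding gauss_def by auto

lemma gauss_char:
  assumes "finite J"
  shows "(LINT \<omega>|gauss. iexp (\<Sum>p\<in>J. t p * \<omega> p)) = exp (- of_real ((\<Sum>p\<in>J. (t p)\<^sup>2) / 2))"
proof -
  interpret N: prob_space std_normal_distribution by (rule prob_space_std_normal)
  have "(LINT \<omega>|gauss. iexp (\<Sum>p\<in>J. t p * \<omega> p)) = (LINT \<omega>|gauss. (\<Prod>p\<in>J. iexp (t p * \<omega> p)))"
    by (simp add: exp_sum[OF assms] sum_distrib_left)
  also have "\<dots> = (\<Prod>p\<in>J. (LINT x|std_normal_distribution. iexp (t p * x)))"
    by (rule gauss_integral_prod(2)[OF assms]) (auto intro!: N.integrable_iexp)
  also have "\<dots> = (\<Prod>p\<in>J. complex_of_real (exp (- ((t p)\<^sup>2) / 2)))"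
    using char_std_normal_distribution unfolding char_def by (simp add: fun_eq_iff)
  also have "\<dots> = complex_of_real (exp (\<Sum>p\<in>J. - ((t p)\<^sup>2) / 2))"
    by (simp only: exp_sum[OF assms] of_real_prod)
  also have "(\<Sum>p\<in>J. - ((t p)\<^sup>2) / 2) = - ((\<Sum>p\<in>J. (t p)\<^sup>2) / 2)"
    by (simp add: sum_negf sum_divide_distrib)
  finally show ?thesis by (simp only: exp_of_real[symmetric] of_real_minus)
qed

section \<open>Complex Gaussian vectors and their unitary invariance\<close>

text \<open>The division by \<open>sqrt 2\<close> gives the squared modulus mean 1.\<close>

definition xi :: "nat \<Rightarrow> (nat \<times> nat \<Rightarrow> real) \<Rightarrow> complex" where
  "xi i \<omega> = Complex (\<omega> (i, 0)) (\<omega> (i, 1)) / sqrt 2"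

definition outer :: "(nat \<Rightarrow> complex) \<Rightarrow> cmat" where
  "outer v = (\<lambda>i j. v i * cnj (v j))"

lemma outer_Herm [simp]: "outer v \<in> Herm"
  by (rule HermI) (simp add: outer_def)

text \<open>Multiplication of the first \<open>n\<close> entries of the vector \<open>xi\<close> by
  \<open>u\<close>, lifted to the real coordinates; \<open>sqrt 2\<close> undoes the normalisation
  in \<open>xi\<close>. As a map of the whole sample space it lets unitary invariance be an equality
  of laws.\<close>

definition rotate_coords :: "nat \<Rightarrow> cmat \<Rightarrow> (nat \<times> nat \<Rightarrow> real) \<Rightarrow> nat \<times> nat \<Rightarrow> real" where
  "rotate_coords n u \<omega> = (\<lambda>(i, b). if i < n \<and> b = 0 then sqrt 2 * Re (\<Sum>k<n. u i k * xi k \<omega>)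
     else if i < n \<and> b = 1 then sqrt 2 * Im (\<Sum>k<n. u i k * xi k \<omega>) else \<omega> (i, b))"

lemma xi_measurable [measurable]: "xi i \<in> borel_measurable (PiM UNIV (\<lambda>_. borel))"
  unfolding xi_def[abs_def] Complex_eq by measurable

lemma xi_measurable_gauss [measurable]: "xi i \<in> borel_measurable gauss"
  by (simp add: measurable_cong_sets[OF sets_gauss refl])

lemma xi_rotate: "i < n \<Longrightarrow> xi i (rotate_coords n u \<omega>) = (\<Sum>k<n. u i k * xi k \<omega>)"
proof -
  assume i: "i < n"
  have "Complex (sqrt 2 * Re z) (sqrt 2 * Im z) / sqrt 2 = z" for z
    by (simp add: complex_eq_iff)
  moreover have "xi i (rotate_coords n u \<omega>) = Complex (sqrt 2 * Re (\<Sum>k<n. u i k * xi k \<omega>)) (sqrt 2 * Im (\<Sum>k<n. u i k * xi k \<omega>)) / sqrt 2"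
    using i unfolding xi_def[of i] rotate_coords_def by simp
  ultimately show ?thesis by (simp only:)
qed

lemma rotate_coords_measurable [measurable]: "rotate_coords n u \<in> measurable gauss (PiM UNIV (\<lambda>_. borel))"
proof (rule measurable_PiM_single')
  fix p :: "nat \<times> nat"
  obtain i b where p: "p = (i, b)" by (cases p)
  show "(\<lambda>\<omega>. rotate_coords n u \<omega> p) \<in> borel_measurable gauss"
    unfolding rotate_coords_def p by measurable
qed auto

lemma unitary_isometry:
  assumes u: "u \<in> U_n n"
  shows "(\<Sum>k<n. (cmod (\<Sum>i<n. cnj (\<tau> i) * u i k))\<^sup>2) = (\<Sum>i<n. (cmod (\<tau> i))\<^sup>2)"
proof -
  have "complex_of_real (\<Sum>k<n. (cmod (\<Sum>i<n. cnj (\<tau> i) * u i k))\<^sup>2)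
     = (\<Sum>k<n. \<Sum>i<n. \<Sum>j<n. cnj (\<tau> i) * \<tau> j * (u i k * madj u k j))"
    unfolding of_real_sum complex_norm_square cnj_sum sum_product
    by (rule sum.cong[OF refl], rule sum.cong[OF refl], rule sum.cong[OF refl]) (simp add: madj_def)
  also have "\<dots> = (\<Sum>i<n. \<Sum>k<n. \<Sum>j<n. cnj (\<tau> i) * \<tau> j * (u i k * madj u k j))"
    by (rule sum.swap)
  also have "\<dots> = (\<Sum>i<n. \<Sum>j<n. cnj (\<tau> i) * \<tau> j * (\<Sum>k<n. u i k * madj u k j))"
    by (rule sum.cong[OF refl], subst sum.swap) (simp add: sum_distrib_left)
  also have "\<dots> = (\<Sum>i<n. \<Sum>j<n. if j = i then cnj (\<tau> i) * \<tau> j else 0)"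
  proof (rule sum.cong[OF refl], rule sum.cong[OF refl])
    fix i j assume ij: "i \<in> {..<n}" "j \<in> {..<n}"
    have "(\<Sum>k<n. u i k * madj u k j) = mmul u (madj u) i j"
      using mmul_blkL[OF U_n_blk[OF u] order.refl, of i "madj u" j] ij by simp
    then show "cnj (\<tau> i) * \<tau> j * (\<Sum>k<n. u i k * madj u k j) = (if j = i then cnj (\<tau> i) * \<tau> j else 0)"
      using u by (simp add: U_n_def mone_def)
  qed
  also have "\<dots> = (\<Sum>i<n. cnj (\<tau> i) * \<tau> i)" by simp
  also have "\<dots> = complex_of_real (\<Sum>i<n. (cmod (\<tau> i))\<^sup>2)"
    by (simp add: complex_norm_square mult.commute del: of_real_power)
  finally show ?thesis by (simp only: of_real_eq_iff)
qed

text \<open>The Gaussian characteristic function depends only on the Euclidean length of the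
  coefficient vector, and passing the unitary from the sample to the coefficients preserves that
  length.\<close>

theorem gauss_rotate:
  assumes u: "u \<in> U_n n"
  shows "distr gauss (PiM UNIV (\<lambda>_. borel)) (rotate_coords n u) = distr gauss (PiM UNIV (\<lambda>_. borel)) (\<lambda>\<omega>. \<omega>)"
proof -
  have comp[measurable]: "(\<lambda>\<omega>. rotate_coords n u \<omega> p) \<in> borel_measurable gauss" for p
    by (rule measurable_compose[OF rotate_coords_measurable]) measurable
  have "same_joint_char gauss gauss (\<lambda>p \<omega>. rotate_coords n u \<omega> p) (\<lambda>p \<omega>. \<omega> p)"
  proof (intro same_joint_char.intro same_joint_char_axioms.intro prob_space_gauss)
    fix J :: "(nat \<times> nat) set" and t :: "nat \<times> nat \<Rightarrow> real" assume J: "finite J"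
    define B where "B = {..<n} \<times> {0, 1::nat}"
    \<comment> \<open>\<open>J\<close> may contain just one of \<open>(i, 0)\<close> and
      \<open>(i, 1)\<close>. Extension by zero pairs the coefficients into complex numbers
      \<open>\<tau> i\<close>, and \<open>\<sigma>\<close> is the adjoint of \<open>u\<close>
      applied to \<open>\<tau>\<close>.\<close>
    define s where "s = (\<lambda>p. if p \<in> J then t p else 0)"
    define \<tau> where "\<tau> = (\<lambda>i. Complex (s (i, 0)) (s (i, 1)))"
    define \<sigma> where "\<sigma> = (\<lambda>k. cnj (\<Sum>i<n. cnj (\<tau> i) * u i k))"
    define r where "r = (\<lambda>(k, b). if (k, b) \<in> B then if b = 0 then Re (\<sigma> k) else Im (\<sigma> k) else s (k, b))"
    have fB: "finite B" by (simp add: B_def)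
    have sumB: "(\<Sum>p\<in>B. f p) = (\<Sum>i<n. f (i, 0) + f (i, 1))" for f :: "nat \<times> nat \<Rightarrow> real"
      unfolding B_def sum.cartesian_product' by simp
    have split: "(\<Sum>p\<in>J \<union> B. f p) = (\<Sum>p\<in>B. f p) + (\<Sum>p\<in>J - B. f p)" for f :: "nat \<times> nat \<Rightarrow> real"
      using J fB by (metis Un_commute sum.union_diff2 Un_Diff_cancel finite_Diff sum.union_disjoint Diff_disjoint)
    have 1: "(\<Sum>p\<in>J. t p * f p) = (\<Sum>p\<in>J \<union> B. s p * f p)" for f
      by (rule sum.mono_neutral_cong_left) (use J fB in \<open>auto simp: s_def\<close>)
    have 2: "(\<Sum>p\<in>B. s p * rotate_coords n u \<omega> p) = (\<Sum>p\<in>B. r p * \<omega> p)" for \<omega>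
    proof -
      have "(\<Sum>p\<in>B. s p * rotate_coords n u \<omega> p) = (\<Sum>i<n. sqrt 2 * Re (cnj (\<tau> i) * (\<Sum>k<n. u i k * xi k \<omega>)))"
        unfolding sumB by (rule sum.cong[OF refl]) (simp add: rotate_coords_def \<tau>_def algebra_simps)
      also have "\<dots> = sqrt 2 * Re (\<Sum>i<n. \<Sum>k<n. cnj (\<tau> i) * (u i k * xi k \<omega>))"
        by (simp only: Re_sum sum_distrib_left)
      also have "(\<Sum>i<n. \<Sum>k<n. cnj (\<tau> i) * (u i k * xi k \<omega>)) = (\<Sum>k<n. cnj (\<sigma> k) * xi k \<omega>)"
        by (subst sum.swap) (simp add: \<sigma>_def sum_distrib_right mult.assoc)
      also have "sqrt 2 * Re (\<Sum>k<n. cnj (\<sigma> k) * xi k \<omega>) = (\<Sum>k<n. sqrt 2 * Re (cnj (\<sigma> k) * xi k \<omega>))"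
        by (simp only: Re_sum sum_distrib_left)
      also have "\<dots> = (\<Sum>p\<in>B. r p * \<omega> p)"
        unfolding sumB by (rule sum.cong[OF refl]) (simp add: r_def B_def xi_def field_simps)
      finally show ?thesis .
    qed
    have 3: "(\<Sum>p\<in>J - B. s p * rotate_coords n u \<omega> p) = (\<Sum>p\<in>J - B. r p * \<omega> p)" for \<omega>
    proof (rule sum.cong[OF refl])
      fix p assume "p \<in> J - B"
      then have "rotate_coords n u \<omega> p = \<omega> p" "r p = s p"
        by (cases p; auto simp: rotate_coords_def r_def B_def)+
      then show "s p * rotate_coords n u \<omega> p = r p * \<omega> p" by simp
    qed
    have 4: "(\<Sum>p\<in>B. (r p)\<^sup>2) = (\<Sum>p\<in>B. (s p)\<^sup>2)"
    proof -
      have "(\<Sum>p\<in>B. (r p)\<^sup>2) = (\<Sum>k<n. (cmod (\<Sum>i<n. cnj (\<tau> i) * u i k))\<^sup>2)"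
        unfolding sumB
      proof (rule sum.cong[OF refl])
        fix k assume "k \<in> {..<n}"
        then have "(r (k, 0))\<^sup>2 + (r (k, 1))\<^sup>2 = (cmod (\<sigma> k))\<^sup>2" by (simp add: r_def B_def cmod_power2)
        then show "(r (k, 0))\<^sup>2 + (r (k, 1))\<^sup>2 = (cmod (\<Sum>i<n. cnj (\<tau> i) * u i k))\<^sup>2"
          unfolding \<sigma>_def by (simp only: complex_mod_cnj)
      qed
      also have "\<dots> = (\<Sum>p\<in>B. (s p)\<^sup>2)" unfolding sumB unitary_isometry[OF u]
        by (rule sum.cong[OF refl]) (simp add: \<tau>_def cmod_power2)
      finally show ?thesis .
    qed
    have 5: "(\<Sum>p\<in>J - B. (r p)\<^sup>2) = (\<Sum>p\<in>J - B. (s p)\<^sup>2)"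
      by (rule sum.cong[OF refl]) (auto simp: r_def)
    have fJB: "finite (J \<union> B)" using J fB by simp
    have "(LINT \<omega>|gauss. iexp (\<Sum>p\<in>J. t p * rotate_coords n u \<omega> p)) = (LINT \<omega>|gauss. iexp (\<Sum>p\<in>J \<union> B. r p * \<omega> p))"
      by (simp only: 1 split 2 3)
    also have "\<dots> = (LINT \<omega>|gauss. iexp (\<Sum>p\<in>J \<union> B. s p * \<omega> p))"
      unfolding gauss_char[OF fJB] by (simp only: split 4 5)
    also have "\<dots> = (LINT \<omega>|gauss. iexp (\<Sum>p\<in>J. t p * \<omega> p))"
      by (simp only: 1)
    finally show "(LINT \<omega>|gauss. iexp (\<Sum>p\<in>J. t p * rotate_coords n u \<omega> p)) = (LINT \<omega>|gauss. iexp (\<Sum>p\<in>J. t p * \<omega> p))" .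
  qed measurable
  from same_joint_char.distr_eq[OF this] show ?thesis by simp
qed

lemma gauss_integral_rotate:
  fixes h :: "(nat \<times> nat \<Rightarrow> real) \<Rightarrow> 'b :: {banach, second_countable_topology}"
  assumes u: "u \<in> U_n n" and h: "h \<in> borel_measurable (PiM UNIV (\<lambda>_. borel))"
  shows "(LINT \<omega>|gauss. h (rotate_coords n u \<omega>)) = (LINT \<omega>|gauss. h \<omega>)"
proof -
  have "(LINT \<omega>|gauss. h (rotate_coords n u \<omega>)) = (LINT \<omega>|distr gauss (PiM UNIV (\<lambda>_. borel)) (rotate_coords n u). h \<omega>)"
    by (rule integral_distr[symmetric]) (use h in measurable)
  also have "\<dots> = (LINT \<omega>|gauss. h \<omega>)"
    unfolding gauss_rotate[OF u] by (rule integral_distr) (use h in measurable)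
  finally show ?thesis .
qed

text \<open>Unitary invariance removes \<open>u\<close>, leaving a weighted sum of independent
  squares; the two real parts of coordinate \<open>k\<close> contribute the square computed in
  \<open>std_normal_square_char\<close>.\<close>

theorem gauss_quadratic_char:
  assumes u: "u \<in> U_n n" and d: "\<And>k. n \<le> k \<Longrightarrow> d k = (0::real)"
    and A: "A = conjugate_by u (diagm (\<lambda>k. of_real (d k)))"
  shows "(LINT \<omega>|gauss. exp (\<i> * mtrace (mmul A (outer (\<lambda>i. xi i \<omega>))))) = (\<Prod>k<n. 1 / (1 - \<i> * of_real (d k)))"
proof -
  interpret N: prob_space std_normal_distribution by (rule prob_space_std_normal)
  have D: "diagm (\<lambda>k. of_real (d k)) \<in> Herm_n n"
    using d by (auto simp: Herm_n_def diagm_def intro!: HermI)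
  have tr: "mtrace (mmul A (outer (\<lambda>i. xi i \<omega>))) = of_real (\<Sum>i<n. d i * (cmod (xi i (rotate_coords n (madj u) \<omega>)))\<^sup>2)" for \<omega>
  proof -
    have "mtrace (mmul A (outer (\<lambda>i. xi i \<omega>)))
        = (\<Sum>i<n. \<Sum>k<n. diagm (\<lambda>k. of_real (d k)) i k * conjugate_by (madj u) (outer (\<lambda>i. xi i \<omega>)) k i)"
      unfolding A trace_conjugate_by[OF u D] by (rule trace_eq_sum[OF D])
    also have "\<dots> = (\<Sum>i<n. of_real (d i) * conjugate_by (madj u) (outer (\<lambda>i. xi i \<omega>)) i i)"
      by (rule sum.cong[OF refl]) (simp add: diagm_def if_distrib[of "\<lambda>x. x * _"] cong: if_cong)
    also have "\<dots> = (\<Sum>i<n. of_real (d i * (cmod (xi i (rotate_coords n (madj u) \<omega>)))\<^sup>2))"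
    proof (rule sum.cong[OF refl])
      fix i assume i: "i \<in> {..<n}"
      have "conjugate_by (madj u) (outer (\<lambda>i. xi i \<omega>)) i i
          = (\<Sum>k<n. \<Sum>l<n. madj u i k * (xi k \<omega> * cnj (xi l \<omega>)) * cnj (madj u i l))"
        using conjugate_by_eq_sum[OF U_n_madj[OF u] order.refl, of i i] i by (simp add: outer_def)
      also have "\<dots> = (\<Sum>k<n. madj u i k * xi k \<omega>) * cnj (\<Sum>k<n. madj u i k * xi k \<omega>)"
        by (simp add: sum_product mult_ac)
      also have "\<dots> = of_real ((cmod (xi i (rotate_coords n (madj u) \<omega>)))\<^sup>2)"
        using i by (simp add: xi_rotate complex_norm_square del: of_real_power)
      finally show "of_real (d i) * conjugate_by (madj u) (outer (\<lambda>i. xi i \<omega>)) i i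
          = of_real (d i * (cmod (xi i (rotate_coords n (madj u) \<omega>)))\<^sup>2)" by simp
    qed
    finally show ?thesis by simp
  qed
  define B where "B = {..<n} \<times> {0, 1::nat}"
  have fB: "finite B" by (simp add: B_def)
  have "(LINT \<omega>|gauss. exp (\<i> * mtrace (mmul A (outer (\<lambda>i. xi i \<omega>)))))
      = (LINT \<omega>|gauss. iexp (\<Sum>i<n. d i * (cmod (xi i \<omega>))\<^sup>2))"
    unfolding tr by (rule gauss_integral_rotate[OF U_n_madj[OF u], of "\<lambda>\<omega>. iexp (\<Sum>i<n. d i * (cmod (xi i \<omega>))\<^sup>2)"]) measurable
  also have "\<dots> = (LINT \<omega>|gauss. (\<Prod>p\<in>B. iexp (d (fst p) * (\<omega> p)\<^sup>2 / 2)))"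
  proof (rule Bochner_Integration.integral_cong[OF refl])
    fix \<omega> :: "nat \<times> nat \<Rightarrow> real"
    have "(cmod (xi i \<omega>))\<^sup>2 = (\<omega> (i, 0))\<^sup>2 / 2 + (\<omega> (i, 1))\<^sup>2 / 2" for i
      by (simp add: xi_def norm_divide power_divide cmod_power2 add_divide_distrib)
    then have "(\<Sum>i<n. d i * (cmod (xi i \<omega>))\<^sup>2) = (\<Sum>i<n. d i * (\<omega> (i, 0))\<^sup>2 / 2 + d i * (\<omega> (i, 1))\<^sup>2 / 2)"
      by (simp add: distrib_left)
    also have "\<dots> = (\<Sum>p\<in>B. d (fst p) * (\<omega> p)\<^sup>2 / 2)"
      unfolding B_def by (simp add: sum.cartesian_product' )
    finally show "iexp (\<Sum>i<n. d i * (cmod (xi i \<omega>))\<^sup>2) = (\<Prod>p\<in>B. iexp (d (fst p) * (\<omega> p)\<^sup>2 / 2))"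
      by (simp only: of_real_sum sum_distrib_left exp_sum[OF fB])
  qed
  also have "\<dots> = (\<Prod>p\<in>B. (LINT x|std_normal_distribution. iexp (d (fst p) * x\<^sup>2 / 2)))"
    by (rule gauss_integral_prod(2)[OF fB], rule N.integrable_iexp) auto
  also have "\<dots> = (\<Prod>k<n. (LINT x|std_normal_distribution. iexp (d k * x\<^sup>2 / 2))\<^sup>2)"
    unfolding B_def by (simp add: prod.cartesian_product' power2_eq_square)
  also have "\<dots> = (\<Prod>k<n. 1 / (1 - \<i> * of_real (d k)))" by (simp only: std_normal_square_char)
  finally show ?thesis .
qed

section \<open>Almost sure convergence from geometric mean square bounds\<close>

text \<open>By the inequality of arithmetic and geometric means with weight \<open>2 ^ m\<close>,
  the mean of the norm of \<open>D m\<close> is at most a multiple of \<open>(1 / 2) ^ m\<close>.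
  The series of norms then has finite expectation, so it is finite almost everywhere.\<close>

lemma (in prob_space) AE_summable_of_L2_geometric:
  fixes D :: "nat \<Rightarrow> 'a \<Rightarrow> 'b :: {banach, second_countable_topology}"
  assumes D[measurable]: "\<And>m. D m \<in> borel_measurable M"
    and int: "\<And>m. integrable M (\<lambda>w. (norm (D m w))\<^sup>2)"
    and bound: "\<And>m. expectation (\<lambda>w. (norm (D m w))\<^sup>2) \<le> C * (1 / 4) ^ m"
  shows "AE w in M. summable (\<lambda>m. norm (D m w))"
proof -
  have le: "norm x \<le> ((1 / 2) ^ m + 2 ^ m * (norm x)\<^sup>2) / 2" for x :: 'b and m
  proof -
    have "0 \<le> (1 - 2 ^ m * norm x)\<^sup>2" by simp
    then have "2 * (2 ^ m * norm x) \<le> 1 + (2 ^ m * norm x)\<^sup>2" by (simp add: power2_diff)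
    then show ?thesis by (simp add: field_simps power2_eq_square)
  qed
  have i2: "integrable M (\<lambda>w. ((1 / 2) ^ m + 2 ^ m * (norm (D m w))\<^sup>2) / 2)" for m
    using int by simp
  have "(\<integral>\<^sup>+ w. ennreal (norm (D m w)) \<partial>M) \<le> ennreal ((1 + C) / 2 * (1 / 2) ^ m)" for m
  proof -
    have "(\<integral>\<^sup>+ w. ennreal (norm (D m w)) \<partial>M) \<le> (\<integral>\<^sup>+ w. ennreal (((1 / 2) ^ m + 2 ^ m * (norm (D m w))\<^sup>2) / 2) \<partial>M)"
      by (intro nn_integral_mono ennreal_leI le)
    also have "\<dots> = ennreal (expectation (\<lambda>w. ((1 / 2) ^ m + 2 ^ m * (norm (D m w))\<^sup>2) / 2))"
      by (rule nn_integral_eq_integral[OF i2]) simp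
    also have "expectation (\<lambda>w. ((1 / 2) ^ m + 2 ^ m * (norm (D m w))\<^sup>2) / 2)
        = ((1 / 2) ^ m + 2 ^ m * expectation (\<lambda>w. (norm (D m w))\<^sup>2)) / 2"
      using int by (simp add: prob_space)
    also have "\<dots> \<le> ((1 / 2) ^ m + 2 ^ m * (C * (1 / 4) ^ m)) / 2"
      using bound[of m] by (intro divide_right_mono add_left_mono mult_left_mono) auto
    also have "2 ^ m * (C * (1 / 4 :: real) ^ m) = C * (1 / 2) ^ m"
      by (simp add: power_mult_distrib[symmetric] mult.left_commute)
    finally show ?thesis by (simp add: ennreal_leI algebra_simps add_divide_distrib)
  qed note b = this
  have "(\<integral>\<^sup>+ w. (\<Sum>m. ennreal (norm (D m w))) \<partial>M) = (\<Sum>m. \<integral>\<^sup>+ w. ennreal (norm (D m w)) \<partial>M)"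
    by (rule nn_integral_suminf) measurable
  also have "\<dots> \<le> (\<Sum>m. ennreal (\<bar>(1 + C) / 2\<bar> * (1 / 2) ^ m))"
  proof (intro suminf_le summableI)
    fix m
    have "(1 + C) / 2 * (1 / 2) ^ m \<le> \<bar>(1 + C) / 2\<bar> * (1 / 2) ^ m"
      by (rule mult_right_mono[OF abs_ge_self]) simp
    then show "(\<integral>\<^sup>+ w. ennreal (norm (D m w)) \<partial>M) \<le> ennreal (\<bar>(1 + C) / 2\<bar> * (1 / 2) ^ m)"
      using b[of m] by (meson ennreal_leI order_trans)
  qed
  also have "\<dots> = ennreal (\<Sum>m. \<bar>(1 + C) / 2\<bar> * (1 / 2) ^ m)"
    by (rule suminf_ennreal2) (auto intro!: summable_mult summable_geometric)
  also have "\<dots> < \<infinity>" by simp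
  finally have "(\<integral>\<^sup>+ w. (\<Sum>m. ennreal (norm (D m w))) \<partial>M) \<noteq> \<infinity>" by simp
  then have "AE w in M. (\<Sum>m. ennreal (norm (D m w))) \<noteq> \<infinity>"
    by (intro nn_integral_noteq_infinite) auto
  then show ?thesis
    by eventually_elim (auto intro!: summable_suminf_not_top)
qed

lemma orthogonal_sum_square:
  fixes W :: "'i \<Rightarrow> 'a \<Rightarrow> real"
  assumes int: "\<And>p q. p \<in> J \<Longrightarrow> q \<in> J \<Longrightarrow> integrable M (\<lambda>w. W p w * W q w)"
    and orth: "\<And>p q. p \<in> J \<Longrightarrow> q \<in> J \<Longrightarrow> (LINT w|M. W p w * W q w) = (if p = q then K else 0)"
    and J: "finite J"
  shows "integrable M (\<lambda>w. (\<Sum>p\<in>J. c p * W p w)\<^sup>2)"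
    "(LINT w|M. (\<Sum>p\<in>J. c p * W p w)\<^sup>2) = K * (\<Sum>p\<in>J. (c p)\<^sup>2)"
proof -
  have e: "(\<Sum>p\<in>J. c p * W p w)\<^sup>2 = (\<Sum>p\<in>J. \<Sum>q\<in>J. c p * c q * (W p w * W q w))" for w
    by (simp add: power2_eq_square sum_product mult_ac)
  show "integrable M (\<lambda>w. (\<Sum>p\<in>J. c p * W p w)\<^sup>2)"
    unfolding e by (intro Bochner_Integration.integrable_sum integrable_mult_right int)
  have "(LINT w|M. (\<Sum>p\<in>J. c p * W p w)\<^sup>2) = (\<Sum>p\<in>J. \<Sum>q\<in>J. c p * c q * (LINT w|M. W p w * W q w))"
    unfolding e using int by (simp add: Bochner_Integration.integral_sum)
  also have "\<dots> = (\<Sum>p\<in>J. \<Sum>q\<in>J. if q = p then K * (c p)\<^sup>2 else 0)"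
    by (rule sum.cong[OF refl], rule sum.cong[OF refl]) (auto simp: orth power2_eq_square)
  also have "\<dots> = K * (\<Sum>p\<in>J. (c p)\<^sup>2)" using J by (simp add: sum_distrib_left)
  finally show "(LINT w|M. (\<Sum>p\<in>J. c p * W p w)\<^sup>2) = K * (\<Sum>p\<in>J. (c p)\<^sup>2)" .
qed

lemma gauss_integral_one:
  fixes f :: "real \<Rightarrow> real"
  assumes "integrable std_normal_distribution f"
  shows "integrable gauss (\<lambda>\<omega>. f (\<omega> p))" "(LINT \<omega>|gauss. f (\<omega> p)) = integral\<^sup>L std_normal_distribution f"
  using gauss_integral_prod[of "{p}" "\<lambda>_. f"] assms by auto

lemma gauss_integral_two:
  fixes f g :: "real \<Rightarrow> real"
  assumes "integrable std_normal_distribution f" "integrable std_normal_distribution g" "p \<noteq> q"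
  shows "integrable gauss (\<lambda>\<omega>. f (\<omega> p) * g (\<omega> q))"
    "(LINT \<omega>|gauss. f (\<omega> p) * g (\<omega> q)) = integral\<^sup>L std_normal_distribution f * integral\<^sup>L std_normal_distribution g"
  using gauss_integral_prod[of "{p, q}" "\<lambda>r. if r = p then f else g"] assms by auto

lemma std_normal_moments:
  "integrable std_normal_distribution (\<lambda>x. x ^ k)" "integrable std_normal_distribution (\<lambda>x. x)"
  "(LINT x|std_normal_distribution. x) = 0" "(LINT x|std_normal_distribution. x\<^sup>2) = 1"
  using integrable_std_normal_distribution_moment[of k] integrable_std_normal_distribution_moment[of 1]
    integral_std_normal_distribution_moment_odd[of 1] std_normal_distribution_even_moments[of 1]
  by (simp_all add: fact_numeral)

lemma gauss_coord_product:
  "integrable gauss (\<lambda>\<omega>. \<omega> p * \<omega> q)" "(LINT \<omega>|gauss. \<omega> p * \<omega> q) = (if p = q then 1 else 0)"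
  "integrable gauss (\<lambda>\<omega>. (\<omega> p * \<omega> q)\<^sup>2)"
proof -
  have 4: "(x * x)\<^sup>2 = x ^ 4" for x :: real by (simp add: power2_eq_square power4_eq_xxxx mult.assoc)
  show "integrable gauss (\<lambda>\<omega>. \<omega> p * \<omega> q)" "(LINT \<omega>|gauss. \<omega> p * \<omega> q) = (if p = q then 1 else 0)"
    using gauss_integral_one[OF std_normal_moments(1)[of 2], of p]
      gauss_integral_two[OF std_normal_moments(2,2), of p q] std_normal_moments(3,4)
    by (cases "p = q"; auto simp: power2_eq_square)+
  show "integrable gauss (\<lambda>\<omega>. (\<omega> p * \<omega> q)\<^sup>2)"
    using gauss_integral_one(1)[OF std_normal_moments(1)[of 4], of p]
      gauss_integral_two(1)[OF std_normal_moments(1,1)[of 2], of p q]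
    by (cases "p = q") (auto simp: 4 power_mult_distrib)
qed

lemma gauss_centred_square:
  defines "W \<equiv> \<lambda>(p :: nat \<times> nat) \<omega>. (\<omega> p)\<^sup>2 - 1 :: real"
  obtains K where "\<And>p q. integrable gauss (\<lambda>\<omega>. W p \<omega> * W q \<omega>)"
    "\<And>p q. (LINT \<omega>|gauss. W p \<omega> * W q \<omega>) = (if p = q then K else 0)"
proof -
  interpret N: prob_space std_normal_distribution by (rule prob_space_std_normal)
  have i: "integrable std_normal_distribution (\<lambda>x. x\<^sup>2 - 1)"
    using std_normal_moments(1)[of 2] by simp
  have z: "(LINT x|std_normal_distribution. x\<^sup>2 - 1) = 0"
    using std_normal_moments(1)[of 2] std_normal_moments(4) N.prob_space by simp
  have "(x\<^sup>2 - 1) * (x\<^sup>2 - 1) = x ^ 4 - 2 * x\<^sup>2 + 1" for x :: real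
    by (simp add: power2_eq_square power4_eq_xxxx algebra_simps)
  then have i2: "integrable std_normal_distribution (\<lambda>x. (x\<^sup>2 - 1) * (x\<^sup>2 - 1))"
    using std_normal_moments(1)[of 2] std_normal_moments(1)[of 4] by simp
  define K where "K = (LINT x|std_normal_distribution. (x\<^sup>2 - 1) * (x\<^sup>2 - 1))"
  have "integrable gauss (\<lambda>\<omega>. W p \<omega> * W q \<omega>)" for p q
    using gauss_integral_one(1)[OF i2, of p] gauss_integral_two(1)[OF i i, of p q]
    by (cases "p = q") (auto simp: W_def)
  moreover have "(LINT \<omega>|gauss. W p \<omega> * W q \<omega>) = (if p = q then K else 0)" for p q
    using gauss_integral_one(2)[OF i2, of p] gauss_integral_two(2)[OF i i, of p q] z
    by (cases "p = q") (auto simp: W_def K_def)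
  ultimately show ?thesis using that by blast
qed

text \<open>A law of large numbers along the lengths \<open>4 ^ m\<close> only: there the mean
  square deviation is geometric and the summability criterion applies directly.\<close>

theorem gauss_norm_LLN:
  "AE \<omega> in gauss. (\<lambda>m. (\<Sum>i<4 ^ m. (cmod (xi i \<omega>))\<^sup>2) / 4 ^ m) \<longlonglongrightarrow> 1"
proof -
  interpret G: prob_space gauss by (rule prob_space_gauss)
  define W where "W = (\<lambda>(p :: nat \<times> nat) \<omega>. (\<omega> p)\<^sup>2 - 1 :: real)"
  obtain K where K: "\<And>p q. integrable gauss (\<lambda>\<omega>. W p \<omega> * W q \<omega>)"
    "\<And>p q. (LINT \<omega>|gauss. W p \<omega> * W q \<omega>) = (if p = q then K else 0)"
    using gauss_centred_square unfolding W_def by blast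
  define B where "B = (\<lambda>m. {..<4 ^ m :: nat} \<times> {0, 1 :: nat})"
  have fB: "finite (B m)" for m by (simp add: B_def)
  \<comment> \<open>The squared modulus of \<open>xi i\<close> minus 1 is half the sum of two
    centred squares, so this is the deviation from 1 of the average over \<open>4 ^ m\<close>
    indices.\<close>
  define D where "D = (\<lambda>m \<omega>. \<Sum>p\<in>B m. (1 / (2 * 4 ^ m)) * W p \<omega>)"
  have "card (B m) = 2 * 4 ^ m" for m by (simp add: B_def card_cartesian_product)
  then have sq: "integrable gauss (\<lambda>\<omega>. (D m \<omega>)\<^sup>2)" "(LINT \<omega>|gauss. (D m \<omega>)\<^sup>2) = (K / 2) * (1 / 4) ^ m" for m
    unfolding D_def
    using orthogonal_sum_square[of "B m" gauss W K "\<lambda>_. 1 / (2 * 4 ^ m)"] K fB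
    by (auto simp: power2_eq_square field_simps)
  have "AE \<omega> in gauss. summable (\<lambda>m. norm (D m \<omega>))"
  proof (rule G.AE_summable_of_L2_geometric)
    show "D m \<in> borel_measurable gauss" for m unfolding D_def W_def by measurable
    show "integrable gauss (\<lambda>\<omega>. (norm (D m \<omega>))\<^sup>2)" for m using sq(1) by simp
    show "(LINT \<omega>|gauss. (norm (D m \<omega>))\<^sup>2) \<le> (K / 2) * (1 / 4) ^ m" for m using sq(2) by simp
  qed
  then show ?thesis
  proof eventually_elim
    case (elim \<omega>)
    have "(\<lambda>m. D m \<omega>) \<longlonglongrightarrow> 0" by (rule tendsto_norm_zero_cancel[OF summable_LIMSEQ_zero[OF elim]])
    then have "(\<lambda>m. 1 + D m \<omega>) \<longlonglongrightarrow> 1 + 0" by (intro tendsto_intros)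
    moreover have "1 + D m \<omega> = (\<Sum>i<4 ^ m. (cmod (xi i \<omega>))\<^sup>2) / 4 ^ m" for m
    proof -
      have "(cmod (xi i \<omega>))\<^sup>2 = (W (i, 0) \<omega> + W (i, 1) \<omega>) / 2 + 1" for i
        by (simp add: xi_def W_def norm_divide power_divide cmod_power2 field_simps)
      then have "(\<Sum>i<4 ^ m. (cmod (xi i \<omega>))\<^sup>2) = (\<Sum>i<4 ^ m. (W (i, 0) \<omega> + W (i, 1) \<omega>) / 2) + 4 ^ m"
        by (simp add: sum.distrib)
      also have "(\<Sum>i<4 ^ m. (W (i, 0) \<omega> + W (i, 1) \<omega>) / 2) = (\<Sum>p\<in>B m. W p \<omega>) / 2"
        unfolding B_def sum.cartesian_product' by (simp flip: sum_divide_distrib)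
      moreover have "D m \<omega> = (\<Sum>p\<in>B m. W p \<omega>) / 2 / 4 ^ m" by (simp add: D_def sum_divide_distrib)
      ultimately show ?thesis by (simp only: add_divide_distrib) simp
    qed
    ultimately show ?case by simp
  qed
qed

section \<open>Coordinates of the centred rank one matrix\<close>

text \<open>Subtracting the identity makes the mean zero. In the characteristic function this is the
  factor \<open>exp (- (\<i> * x * a))\<close>, and it is why square summable weights suffice for
  the random series.\<close>

definition outer_coord :: "nat \<times> nat \<Rightarrow> (nat \<times> nat \<Rightarrow> real) \<Rightarrow> real" where
  "outer_coord p \<omega> = hcoord (outer (\<lambda>i. xi i \<omega>)) p - hcoord mone p"

lemma outer_coord_eq:
  "outer_coord (i, j) \<omega> = (\<omega> (i, 0) * \<omega> (j, 0) + \<omega> (i, 1) * \<omega> (j, 1) + \<omega> (i, 1) * \<omega> (j, 0) - \<omega> (i, 0) * \<omega> (j, 1)) / 2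
     - (if i = j then 1 else 0)"
  by (simp add: outer_coord_def hcoord_def outer_def xi_def mone_def field_simps)

lemma outer_coord_moments:
  "integrable gauss (outer_coord p)" "(LINT \<omega>|gauss. outer_coord p \<omega>) = 0"
  "integrable gauss (\<lambda>\<omega>. (outer_coord p \<omega>)\<^sup>2)"
proof -
  interpret G: prob_space gauss by (rule prob_space_gauss)
  obtain i j where p: "p = (i, j)" by (cases p)
  show "integrable gauss (outer_coord p)" "(LINT \<omega>|gauss. outer_coord p \<omega>) = 0"
    unfolding p outer_coord_eq[abs_def] using gauss_coord_product(1)
    by (auto simp: gauss_coord_product(2) G.prob_space[unfolded space_gauss])
  define d where "d = (if i = j then 1 else 0 :: real)"
  show "integrable gauss (\<lambda>\<omega>. (outer_coord p \<omega>)\<^sup>2)"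
  proof (rule Bochner_Integration.integrable_bound)
    let ?g = "\<lambda>\<omega>. 5 * ((\<omega> (i, 0) * \<omega> (j, 0))\<^sup>2 + (\<omega> (i, 1) * \<omega> (j, 1))\<^sup>2 + (\<omega> (i, 1) * \<omega> (j, 0))\<^sup>2 + (\<omega> (i, 0) * \<omega> (j, 1))\<^sup>2 + 1 :: real)"
    show "integrable gauss ?g" using gauss_coord_product(3) by simp
    show "(\<lambda>\<omega>. (outer_coord p \<omega>)\<^sup>2) \<in> borel_measurable gauss"
      unfolding p outer_coord_eq by measurable
    have ineq: "((a + b + c - e) / 2 - d)\<^sup>2 \<le> 5 * (a\<^sup>2 + b\<^sup>2 + c\<^sup>2 + e\<^sup>2 + 1)" if "0 \<le> d" "d \<le> 1" for a b c e d :: real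
    proof -
      have "(x + y)\<^sup>2 \<le> 2 * x\<^sup>2 + 2 * y\<^sup>2" for x y :: real
        using zero_le_power2[of "x - y"] by (simp add: power2_eq_square algebra_simps)
      note s = this
      have "(a + b + c - e)\<^sup>2 \<le> 2 * (a + b)\<^sup>2 + 2 * (c + - e)\<^sup>2" using s[of "a + b" "c + - e"] by (simp add: algebra_simps)
      also have "\<dots> \<le> 4 * (a\<^sup>2 + b\<^sup>2 + c\<^sup>2 + e\<^sup>2)" using s[of a b] s[of c "- e"] by simp
      finally have 1: "((a + b + c - e) / 2)\<^sup>2 \<le> a\<^sup>2 + b\<^sup>2 + c\<^sup>2 + e\<^sup>2" by (simp add: power_divide)
      have "d\<^sup>2 \<le> 1" using that by (simp add: power_le_one)
      then show ?thesis using s[of "(a + b + c - e) / 2" "- d"] 1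
        zero_le_power2[of a] zero_le_power2[of b] zero_le_power2[of c] zero_le_power2[of e]
        unfolding diff_conv_add_uminus[symmetric] power2_minus by argo
    qed
    show "AE \<omega> in gauss. norm ((outer_coord p \<omega>)\<^sup>2) \<le> norm (?g \<omega>)"
      unfolding p outer_coord_eq using ineq[of "if i = j then 1 else 0"]
      by (intro AE_I2) (auto intro: order_trans[OF _ abs_ge_self])
  qed
qed

section \<open>Ergodicity and multiplicativity\<close>

definition madd :: "cmat \<Rightarrow> cmat \<Rightarrow> cmat" where
  "madd A B = (\<lambda>i j. A i j + B i j)"

definition phase :: "cmat \<Rightarrow> cmat \<Rightarrow> complex" where
  "phase A B = exp (\<i> * mtrace (mmul A B))"

lemma madd_Herm_n: "A \<in> Herm_n n \<Longrightarrow> B \<in> Herm_n n \<Longrightarrow> madd A B \<in> Herm_n n"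
  using Herm_cnj[of A] Herm_cnj[of B] by (auto simp: Herm_n_def madd_def intro!: HermI)

lemma mscale_Herm_n: "A \<in> Herm_n n \<Longrightarrow> mscale (of_real c) A \<in> Herm_n n"
  using Herm_cnj[of A] by (auto simp: Herm_n_def mscale_def intro!: HermI)

lemma Herm_finI: "A \<in> Herm_n n \<Longrightarrow> A \<in> Herm_fin"
  by (auto simp: Herm_fin_def)

lemma phase_madd:
  assumes "A \<in> Herm_fin" "A' \<in> Herm_fin"
  shows "phase (madd A A') B = phase A B * phase A' B"
proof -
  obtain n n' where "A \<in> Herm_n n" "A' \<in> Herm_n n'" using assms by (auto simp: Herm_fin_def)
  then have A: "A \<in> Herm_n (max n n')" "A' \<in> Herm_n (max n n')" by (auto intro: Herm_n_mono)
  have "mtrace (mmul (madd A A') B) = mtrace (mmul A B) + mtrace (mmul A' B)"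
    unfolding trace_eq_sum[OF madd_Herm_n[OF A]] trace_eq_sum[OF A(1)] trace_eq_sum[OF A(2)]
    by (simp add: madd_def algebra_simps sum.distrib)
  then show ?thesis by (simp add: phase_def distrib_left exp_add)
qed

lemma trace_Reals:
  assumes "A \<in> Herm_fin" "B \<in> Herm" shows "mtrace (mmul A B) = of_real (Re (mtrace (mmul A B)))"
proof -
  obtain n where "A \<in> Herm_n n" using assms by (auto simp: Herm_fin_def)
  then show ?thesis by (simp add: trace_eq_hcoord[OF _ assms(2)])
qed

lemma norm_phase: "A \<in> Herm_fin \<Longrightarrow> B \<in> Herm \<Longrightarrow> norm (phase A B) = 1"
  unfolding phase_def by (subst trace_Reals) auto

lemma phase_neg:
  assumes "A \<in> Herm_fin" "B \<in> Herm" shows "phase (mscale (-1) A) B = cnj (phase A B)"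
proof -
  obtain n where A: "A \<in> Herm_n n" using assms by (auto simp: Herm_fin_def)
  have "mtrace (mmul (mscale (-1) A) B) = - mtrace (mmul A B)"
    using trace_eq_sum[OF mscale_Herm_n[OF A, of "-1"], of B] trace_eq_sum[OF A, of B]
    by (simp add: mscale_def sum_negf)
  moreover obtain r where "mtrace (mmul A B) = complex_of_real r" using trace_Reals[OF assms] by blast
  ultimately show ?thesis unfolding phase_def by (simp add: exp_cnj)
qed

lemma phase_conjugate:
  assumes u: "u \<in> U_fin" and A: "A \<in> Herm_fin"
  shows "phase (conjugate_by u A) B = phase A (conjugate_by (madj u) B)"
    "phase A (conjugate_by u B) = phase (conjugate_by (madj u) A) B"
    "conjugate_by u A \<in> Herm_fin" "madj u \<in> U_fin"
proof -
  obtain n m where "A \<in> Herm_n n" "u \<in> U_n m" using assms by (auto simp: Herm_fin_def U_fin_def)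
  then have n: "A \<in> Herm_n (max n m)" "u \<in> U_n (max n m)" by (auto intro: Herm_n_mono U_n_mono)
  show "phase (conjugate_by u A) B = phase A (conjugate_by (madj u) B)"
    unfolding phase_def trace_conjugate_by[OF n(2,1)] ..
  show "phase A (conjugate_by u B) = phase (conjugate_by (madj u) A) B"
    unfolding phase_def trace_conjugate_by[OF U_n_madj[OF n(2)] n(1)] by simp
  show "conjugate_by u A \<in> Herm_fin" using conjugate_by_Herm_n[OF n(2,1)] by (rule Herm_finI)
  show "madj u \<in> U_fin" using U_n_madj[OF n(2)] by (auto simp: U_fin_def)
qed

lemma shiftm_mscale: "shiftm L (mscale c A) = mscale c (shiftm L A)"
  by (intro ext) (simp add: shiftm_def mscale_def)

lemma conjugate_by_madd: "u \<in> U_n n \<Longrightarrow> conjugate_by u (madd A B) = madd (conjugate_by u A) (conjugate_by u B)"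
  unfolding madd_def by (rule conjugate_by_add)

lemma exists_permutation_01:
  assumes "b \<noteq> (b' :: nat)"
  shows "\<exists>\<sigma> m. \<sigma> permutes {..<m} \<and> \<sigma> 0 = b \<and> \<sigma> 1 = b'"
proof -
  \<comment> \<open>\<open>c\<close> is the point that the exchange of 0 and \<open>b\<close> sends
    to \<open>b'\<close>; moving 1 to \<open>c\<close> first therefore makes 1 end at
    \<open>b'\<close>. Since \<open>c \<noteq> 0\<close>, the first exchange leaves 0 alone.\<close>
  define c where "c = Transposition.transpose 0 b b'"
  define \<sigma> where "\<sigma> = Transposition.transpose 0 b \<circ> Transposition.transpose 1 c"
  define m where "m = Suc (Suc (b + b'))"
  have "c < m" by (auto simp: c_def m_def Transposition.transpose_def)
  have "\<sigma> permutes {..<m}"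
    unfolding \<sigma>_def by (intro permutes_compose permutes_swap_id) (use \<open>c < m\<close> in \<open>auto simp: m_def\<close>)
  moreover have "c \<noteq> 0" using assms by (auto simp: c_def Transposition.transpose_def split: if_splits)
  then have "\<sigma> 0 = b" by (simp add: \<sigma>_def Transposition.transpose_def)
  moreover have "\<sigma> 1 = b'" by (simp add: \<sigma>_def c_def)
  ultimately show ?thesis by blast
qed

text \<open>A covariance with one value on the diagonal and one off it separates into two terms. The
  first disappears when the weights sum to zero (differences of averages) or when
  \<open>c = 0\<close> (centred uncorrelated phases).\<close>

lemma complex_L2_sum:
  fixes V :: "'i \<Rightarrow> 'a \<Rightarrow> complex" and \<alpha> :: "'i \<Rightarrow> real"
  assumes J: "finite J"
    and int: "\<And>p q. p \<in> J \<Longrightarrow> q \<in> J \<Longrightarrow> integrable M (\<lambda>w. V p w * cnj (V q w))"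
    and cov: "\<And>p q. p \<in> J \<Longrightarrow> q \<in> J \<Longrightarrow> (LINT w|M. V p w * cnj (V q w)) = (if p = q then \<kappa> else c)"
  shows "integrable M (\<lambda>w. (norm (\<Sum>p\<in>J. \<alpha> p *\<^sub>R V p w))\<^sup>2)"
    "complex_of_real (LINT w|M. (norm (\<Sum>p\<in>J. \<alpha> p *\<^sub>R V p w))\<^sup>2)
      = c * of_real ((\<Sum>p\<in>J. \<alpha> p)\<^sup>2) + (\<kappa> - c) * of_real (\<Sum>p\<in>J. (\<alpha> p)\<^sup>2)"
proof -
  have e: "complex_of_real ((norm (\<Sum>p\<in>J. \<alpha> p *\<^sub>R V p w))\<^sup>2)
      = (\<Sum>p\<in>J. \<Sum>q\<in>J. of_real (\<alpha> p * \<alpha> q) * (V p w * cnj (V q w)))" for w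
    unfolding complex_norm_square cnj_sum sum_product
    by (rule sum.cong[OF refl], rule sum.cong[OF refl]) (simp add: scaleR_conv_of_real mult_ac)
  have i: "integrable M (\<lambda>w. complex_of_real ((norm (\<Sum>p\<in>J. \<alpha> p *\<^sub>R V p w))\<^sup>2))"
    unfolding e by (intro Bochner_Integration.integrable_sum integrable_mult_right int)
  then show "integrable M (\<lambda>w. (norm (\<Sum>p\<in>J. \<alpha> p *\<^sub>R V p w))\<^sup>2)"
    by (simp only: complex_of_real_integrable_eq)
  have "complex_of_real (LINT w|M. (norm (\<Sum>p\<in>J. \<alpha> p *\<^sub>R V p w))\<^sup>2)
      = (LINT w|M. complex_of_real ((norm (\<Sum>p\<in>J. \<alpha> p *\<^sub>R V p w))\<^sup>2))"
    by (rule integral_complex_of_real[symmetric])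
  also have "\<dots> = (\<Sum>p\<in>J. \<Sum>q\<in>J. of_real (\<alpha> p * \<alpha> q) * (LINT w|M. V p w * cnj (V q w)))"
    unfolding e using int by (simp add: Bochner_Integration.integral_sum)
  also have "\<dots> = (\<Sum>p\<in>J. \<Sum>q\<in>J. c * of_real (\<alpha> p * \<alpha> q) + (if q = p then (\<kappa> - c) * of_real ((\<alpha> p)\<^sup>2) else 0))"
    by (rule sum.cong[OF refl], rule sum.cong[OF refl]) (auto simp: cov power2_eq_square algebra_simps)
  also have "\<dots> = c * (\<Sum>p\<in>J. \<Sum>q\<in>J. of_real (\<alpha> p * \<alpha> q)) + (\<kappa> - c) * (\<Sum>p\<in>J. of_real ((\<alpha> p)\<^sup>2))"
    using J by (simp add: sum.distrib sum_distrib_left)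
  also have "(\<Sum>p\<in>J. \<Sum>q\<in>J. complex_of_real (\<alpha> p * \<alpha> q)) = of_real ((\<Sum>p\<in>J. \<alpha> p)\<^sup>2)"
    by (simp add: power2_eq_square sum_product)
  finally show "complex_of_real (LINT w|M. (norm (\<Sum>p\<in>J. \<alpha> p *\<^sub>R V p w))\<^sup>2)
      = c * of_real ((\<Sum>p\<in>J. \<alpha> p)\<^sup>2) + (\<kappa> - c) * of_real (\<Sum>p\<in>J. (\<alpha> p)\<^sup>2)" by simp
qed

section \<open>Invariant measures and exchangeable blocks\<close>

locale hermitian_measure = prob_space M for M :: "cmat measure" +
  assumes borel_prob: "borel_prob_on_Herm M"
begin

lemmas space_M = borel_prob_on_HermD(2)[OF borel_prob]
lemmas sets_M = borel_prob_on_HermD(3)[OF borel_prob]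
lemmas measurable_M = borel_prob_on_HermD(4)[OF borel_prob]

lemma hcoord_M [measurable]: "(\<lambda>B. hcoord B p) \<in> borel_measurable M"
  by (rule measurable_M) measurable

lemma entry_M [measurable]: "(\<lambda>B. B i j) \<in> borel_measurable M"
  by (rule measurable_M) (rule measurable_product_then_coordinatewise, rule measurable_product_then_coordinatewise, simp)

lemma phase_M [measurable]:
  assumes "A \<in> Herm_fin" shows "phase A \<in> borel_measurable M"
proof -
  obtain n where A: "A \<in> Herm_n n" using assms by (auto simp: Herm_fin_def)
  show ?thesis unfolding phase_def[abs_def] trace_eq_sum[OF A] by measurable
qed

lemma phase_integrable:
  assumes "A \<in> Herm_fin" shows "integrable M (phase A)"
  by (rule integrable_const_bound[of _ 1]) (use assms norm_phase space_M in auto)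

lemma char_fun_eq: "char_fun M A = (LINT B|M. phase A B)"
  by (simp add: char_fun_def phase_def)

lemma conjugate_measurable:
  assumes "u \<in> U_fin" shows "conjugate_by u \<in> measurable M M"
proof -
  obtain n where u: "u \<in> U_n n" using assms by (auto simp: U_fin_def)
  have "(\<lambda>B. conjugate_by u B i j) \<in> borel_measurable M" for i j
  proof -
    define N where "N = max n (max (Suc i) (Suc j))"
    have N: "n \<le> N" "i < N" "j < N" by (auto simp: N_def)
    show ?thesis unfolding conjugate_by_eq_sum[OF u N] by measurable
  qed
  then have "conjugate_by u \<in> measurable M borel"
    by (intro measurable_coordinatewise_then_product)
  then have "conjugate_by u \<in> measurable M (restrict_space borel Herm)"
    by (intro measurable_restrict_space2) (use conjugate_by_Herm[OF u] space_M in auto)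
  then show ?thesis using measurable_cong_sets[OF refl sets_M] by auto
qed

end

locale invariant_measure = hermitian_measure M for M :: "cmat measure" +
  assumes U_inv: "U_invariant M"
begin

lemma integral_conjugate:
  fixes h :: "cmat \<Rightarrow> 'b :: {banach, second_countable_topology}"
  assumes u: "u \<in> U_fin" and h[measurable]: "h \<in> borel_measurable M"
  shows "(LINT B|M. h (conjugate_by u B)) = (LINT B|M. h B)"
proof -
  have "distr M M (conjugate_by u) = M" using U_inv u by (auto simp: U_invariant_def)
  then have "(LINT B|M. h B) = (LINT B|distr M M (conjugate_by u). h B)" by simp
  also have "\<dots> = (LINT B|M. h (conjugate_by u B))"
    by (rule integral_distr[OF conjugate_measurable[OF u] h])
  finally show ?thesis by simp
qed

lemma char_fun_conjugate:
  assumes u: "u \<in> U_fin" and A: "A \<in> Herm_fin"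
  shows "char_fun M (conjugate_by u A) = char_fun M A"
  unfolding char_fun_eq phase_conjugate(1)[OF u A]
  by (rule integral_conjugate) (use phase_conjugate[OF u A] phase_M A in auto)

text \<open>Exchangeability of the translates: one block permutation moves blocks 0 and 1 to
  \<open>b\<close> and \<open>b'\<close> at the same time, so the joint law does not depend on the
  positions.\<close>

lemma char_fun_blocks:
  assumes n: "n > 0" and A: "A \<in> Herm_n n" "A' \<in> Herm_n n" and b: "b \<noteq> b'"
  shows "char_fun M (madd (shiftm (b * n) A) (shiftm (b' * n) A')) = char_fun M (madd A (shiftm n A'))"
proof -
  obtain \<sigma> m where s: "\<sigma> permutes {..<m}" "\<sigma> 0 = b" "\<sigma> 1 = b'" using exists_permutation_01[OF b] by blast
  obtain u where u: "u \<in> U_n (m * n)" "\<And>A b. A \<in> Herm_n n \<Longrightarrow> conjugate_by u (shiftm (b * n) A) = shiftm (\<sigma> b * n) A"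
    using block_permutation[OF n s(1)] by blast
  have "madd A (shiftm n A') \<in> Herm_n (n + n)"
    using A by (intro madd_Herm_n shiftm_Herm_n) (auto intro: Herm_n_mono)
  moreover have "conjugate_by u (madd A (shiftm n A')) = madd (shiftm (b * n) A) (shiftm (b' * n) A')"
    using u(2)[OF A(1), of 0] u(2)[OF A(2), of 1] s by (simp add: conjugate_by_madd[OF u(1)])
  ultimately show ?thesis
    using char_fun_conjugate[of u "madd A (shiftm n A')"] u(1) by (auto simp: U_fin_def Herm_fin_def)
qed

lemma char_fun_block:
  assumes n: "n > 0" and A: "A \<in> Herm_n n"
  shows "char_fun M (shiftm (b * n) A) = char_fun M A"
proof -
  obtain \<sigma> m where s: "\<sigma> permutes {..<m}" "\<sigma> 0 = b" using exists_permutation_01[of b "Suc b"] by auto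
  obtain u where u: "u \<in> U_n (m * n)" "\<And>A b. A \<in> Herm_n n \<Longrightarrow> conjugate_by u (shiftm (b * n) A) = shiftm (\<sigma> b * n) A"
    using block_permutation[OF n s(1)] by blast
  show ?thesis using char_fun_conjugate[of u A] u(2)[OF A, of 0] s(2) u(1) A by (auto simp: U_fin_def Herm_fin_def)
qed

section \<open>Averages over disjoint blocks\<close>

text \<open>The count starts at block 1: block 0 is kept free for a second matrix whose phase
  multiplies the average in the proof of multiplicativity.\<close>

definition block_average :: "nat \<Rightarrow> cmat \<Rightarrow> nat \<Rightarrow> cmat \<Rightarrow> complex" where
  "block_average n A m B = (\<Sum>b<4 ^ m. (1 / 4 ^ m) *\<^sub>R phase (shiftm (Suc b * n) A) B)"

lemma shift_Herm_fin: "A \<in> Herm_n n \<Longrightarrow> shiftm L A \<in> Herm_fin"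
  using shiftm_Herm_n Herm_finI by blast

lemma block_average_M [measurable]:
  "A \<in> Herm_n n \<Longrightarrow> block_average n A m \<in> borel_measurable M"
  unfolding block_average_def[abs_def]
  by (intro borel_measurable_sum borel_measurable_scaleR borel_measurable_const phase_M shift_Herm_fin)

lemma norm_block_average: "A \<in> Herm_n n \<Longrightarrow> B \<in> Herm \<Longrightarrow> norm (block_average n A m B) \<le> 1"
  unfolding block_average_def
  by (rule order_trans[OF norm_sum]) (simp add: norm_phase[OF shift_Herm_fin])

lemma phase_cov:
  assumes n: "n > 0" and A: "A \<in> Herm_n n"
  shows "integrable M (\<lambda>B. phase (shiftm (b * n) A) B * cnj (phase (shiftm (b' * n) A) B))"
    "(LINT B|M. phase (shiftm (b * n) A) B * cnj (phase (shiftm (b' * n) A) B))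
      = (if b = b' then 1 else char_fun M (madd A (shiftm n (mscale (-1) A))))"
proof -
  note sh = shift_Herm_fin[OF A]
  have mA: "mscale (-1) A \<in> Herm_n n" using mscale_Herm_n[OF A, of "-1"] by simp
  have p: "phase (shiftm (b * n) A) B * cnj (phase (shiftm (b' * n) A) B)
      = phase (madd (shiftm (b * n) A) (shiftm (b' * n) (mscale (-1) A))) B" if "B \<in> Herm" for b b' B
    by (simp only: shiftm_mscale phase_madd[OF sh shift_Herm_fin[OF mA, unfolded shiftm_mscale]] phase_neg[OF sh that])
  have m: "madd (shiftm (b * n) A) (shiftm (b' * n) (mscale (-1) A)) \<in> Herm_fin" for b b'
    using shiftm_Herm_n[OF A, of "b * n"] shiftm_Herm_n[OF mA, of "b' * n"]
    by (intro Herm_finI[of _ "max (b * n + n) (b' * n + n)"] madd_Herm_n) (auto elim: Herm_n_mono)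
  show "integrable M (\<lambda>B. phase (shiftm (b * n) A) B * cnj (phase (shiftm (b' * n) A) B))"
    using phase_integrable[OF m[of b b']] by (subst Bochner_Integration.integrable_cong[OF refl p]) (auto simp: space_M)
  have "(LINT B|M. phase (shiftm (b * n) A) B * cnj (phase (shiftm (b' * n) A) B))
      = char_fun M (madd (shiftm (b * n) A) (shiftm (b' * n) (mscale (-1) A)))"
    unfolding char_fun_eq by (rule Bochner_Integration.integral_cong[OF refl p]) (simp add: space_M)
  also have "\<dots> = (if b = b' then 1 else char_fun M (madd A (shiftm n (mscale (-1) A))))"
  proof (cases "b = b'")
    case True
    have "madd (shiftm (b * n) A) (shiftm (b' * n) (mscale (-1) A)) = (\<lambda>i j. 0)"
      using True by (intro ext) (simp add: madd_def shiftm_def mscale_def)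
    moreover have "(\<lambda>i j. 0) \<in> Herm_n 0" by (auto simp: Herm_n_def intro!: HermI)
    ultimately show ?thesis using True
      by (simp add: char_fun_eq phase_def trace_eq_sum prob_space)
  qed (simp add: char_fun_blocks[OF n A mA])
  finally show "(LINT B|M. phase (shiftm (b * n) A) B * cnj (phase (shiftm (b' * n) A) B))
      = (if b = b' then 1 else char_fun M (madd A (shiftm n (mscale (-1) A))))" .
qed

lemma norm_char_fun_le: "A \<in> Herm_fin \<Longrightarrow> norm (char_fun M A) \<le> 1"
proof -
  assume A: "A \<in> Herm_fin"
  have "norm (char_fun M A) \<le> (LINT B|M. norm (phase A B))" unfolding char_fun_eq by (rule integral_norm_bound)
  also have "\<dots> = (LINT B|M. 1)" by (rule Bochner_Integration.integral_cong) (auto simp: space_M norm_phase[OF A])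
  finally show ?thesis by (simp add: prob_space)
qed

text \<open>Consecutive averages differ by a combination with weights of sum zero, so the common
  covariance of distinct blocks cancels and a geometric mean square bound remains. Invariance alone
  gives convergence; ergodicity is needed only to identify the limit.\<close>

lemma block_average_converges:
  assumes n: "n > 0" and A: "A \<in> Herm_n n"
  shows "AE B in M. convergent (\<lambda>m. block_average n A m B)"
proof -
  define D where "D = (\<lambda>m B. block_average n A (Suc m) B - block_average n A m B)"
  \<comment> \<open>The shorter average is rewritten over the \<open>4 ^ Suc m\<close> blocks of the
    longer one with weight zero on the new blocks; \<open>\<alpha>\<close> is the difference of the
    two weightings.\<close>
  define \<alpha> where "\<alpha> = (\<lambda>(m :: nat) (b :: nat). 1 / 4 ^ Suc m - (if b < 4 ^ m then 1 / 4 ^ m else 0) :: real)"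
  define c where "c = char_fun M (madd A (shiftm n (mscale (-1) A)))"
  have sub: "{..<4 ^ m} \<subseteq> {..<4 ^ Suc m :: nat}" for m by auto
  have D: "D m B = (\<Sum>b<4 ^ Suc m. \<alpha> m b *\<^sub>R phase (shiftm (Suc b * n) A) B)" for m B
  proof -
    have "block_average n A m B = (\<Sum>b<4 ^ Suc m. (if b < 4 ^ m then 1 / 4 ^ m else 0) *\<^sub>R phase (shiftm (Suc b * n) A) B)"
      unfolding block_average_def by (rule sum.mono_neutral_cong_left) (use sub in auto)
    then show ?thesis
      unfolding D_def by (simp only: block_average_def[of n A "Suc m"] sum_subtractf[symmetric] scaleR_diff_left[symmetric] \<alpha>_def)
  qed
  have \<alpha>0: "(\<Sum>b<4 ^ Suc m. \<alpha> m b) = 0" for m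
  proof -
    have "(\<Sum>b<4 ^ Suc m :: nat. (if b < 4 ^ m then 1 / 4 ^ m else 0 :: real)) = (\<Sum>b<4 ^ m :: nat. 1 / 4 ^ m)"
      by (rule sum.mono_neutral_cong_right) (use sub in auto)
    then show ?thesis unfolding \<alpha>_def sum_subtractf by simp
  qed
  have \<alpha>2: "(\<Sum>b<4 ^ Suc m. (\<alpha> m b)\<^sup>2) \<le> 4 * (1 / 4) ^ m" for m
  proof -
    have "\<bar>\<alpha> m b\<bar> \<le> 1 / 4 ^ m" for b by (auto simp: \<alpha>_def field_simps)
    then have "(\<alpha> m b)\<^sup>2 \<le> (1 / 4 ^ m)\<^sup>2" for b by (metis abs_ge_zero power2_abs power_mono)
    then have "(\<Sum>b<4 ^ Suc m. (\<alpha> m b)\<^sup>2) \<le> (\<Sum>b<4 ^ Suc m :: nat. (1 / 4 ^ m)\<^sup>2)" by (intro sum_mono)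
    also have "\<dots> = 4 * (1 / 4) ^ m" by (simp add: power2_eq_square power_divide)
    finally show ?thesis .
  qed
  have "norm c \<le> 1"
  proof -
    have mA: "mscale (-1) A \<in> Herm_n n" using mscale_Herm_n[OF A, of "-1"] by simp
    have "madd A (shiftm n (mscale (-1) A)) \<in> Herm_n (n + n)"
      using A mA by (intro madd_Herm_n shiftm_Herm_n) (auto intro: Herm_n_mono)
    then show ?thesis unfolding c_def by (intro norm_char_fun_le Herm_finI)
  qed
  then have c: "norm (1 - c) \<le> 2" using norm_triangle_ineq4[of 1 c] by simp
  have int: "integrable M (\<lambda>w. phase (shiftm (Suc p * n) A) w * cnj (phase (shiftm (Suc q * n) A) w))" for p q
    by (rule phase_cov(1)[OF n A])
  have cov: "(LINT w|M. phase (shiftm (Suc p * n) A) w * cnj (phase (shiftm (Suc q * n) A) w)) = (if p = q then 1 else c)" for p q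
    unfolding phase_cov(2)[OF n A] c_def by (simp only: nat.inject)
  note L = complex_L2_sum[OF finite_lessThan int cov]
  have L2: "integrable M (\<lambda>B. (norm (D m B))\<^sup>2)"
    "complex_of_real (LINT B|M. (norm (D m B))\<^sup>2) = (1 - c) * of_real (\<Sum>b<4 ^ Suc m. (\<alpha> m b)\<^sup>2)" for m
    unfolding D by (rule L(1), unfold L(2) \<alpha>0) simp
  have "AE B in M. summable (\<lambda>m. norm (D m B))"
  proof (rule AE_summable_of_L2_geometric)
    show "D m \<in> borel_measurable M" for m unfolding D_def using block_average_M[OF A] by measurable
    show "integrable M (\<lambda>B. (norm (D m B))\<^sup>2)" for m by (rule L2)
    fix m
    have "\<bar>LINT B|M. (norm (D m B))\<^sup>2\<bar> = norm (1 - c) * norm (complex_of_real (\<Sum>b<4 ^ Suc m. (\<alpha> m b)\<^sup>2))"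
      using arg_cong[OF L2(2)[of m], of norm] by (simp only: norm_of_real norm_mult)
    also have "norm (complex_of_real (\<Sum>b<4 ^ Suc m. (\<alpha> m b)\<^sup>2)) = (\<Sum>b<4 ^ Suc m. (\<alpha> m b)\<^sup>2)"
      unfolding norm_of_real by (rule abs_of_nonneg) (intro sum_nonneg, simp)
    also have "norm (1 - c) * (\<Sum>b<4 ^ Suc m. (\<alpha> m b)\<^sup>2) \<le> 2 * (4 * (1 / 4) ^ m)"
      by (intro mult_mono c \<alpha>2 sum_nonneg) auto
    finally show "(LINT B|M. (norm (D m B))\<^sup>2) \<le> 8 * (1 / 4) ^ m" by simp
  qed
  then show ?thesis
  proof eventually_elim
    case (elim B)
    then have "summable (\<lambda>m. D m B)" by (rule summable_norm_cancel)
    then have "convergent (\<lambda>m. \<Sum>k<m. D k B)" by (simp add: summable_iff_convergent)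
    then have "convergent (\<lambda>m. block_average n A m B - block_average n A 0 B)"
      unfolding D_def using sum_lessThan_telescope[of "\<lambda>m. block_average n A m B"] by simp
    then show ?case by (simp add: convergent_diff_const_right_iff)
  qed
qed

end

context invariant_measure
begin

lemma AE_Herm: "AE B in M. B \<in> Herm"
  using AE_space[of M] unfolding space_M .

lemma conjugate_image_invariant:
  assumes u: "u \<in> U_fin" and P: "\<And>B u. B \<in> Herm \<Longrightarrow> u \<in> U_fin \<Longrightarrow> P (conjugate_by u B) \<longleftrightarrow> P B"
  shows "conjugate_by u ` {B \<in> Herm. P B} = {B \<in> Herm. P B}"
proof -
  obtain n where n: "u \<in> U_n n" using u by (auto simp: U_fin_def)
  have u': "madj u \<in> U_fin" using U_n_madj[OF n] by (auto simp: U_fin_def)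
  show ?thesis
  proof (intro equalityI subsetI)
    fix B assume "B \<in> {B \<in> Herm. P B}"
    then have "conjugate_by (madj u) B \<in> {B \<in> Herm. P B}" using P u' conjugate_by_Herm[OF U_n_madj[OF n]] by auto
    then have "conjugate_by u (conjugate_by (madj u) B) \<in> conjugate_by u ` {B \<in> Herm. P B}" by (rule imageI)
    then show "B \<in> conjugate_by u ` {B \<in> Herm. P B}" by (simp only: conjugate_by_madj_cancel[OF n])
  qed (use P u conjugate_by_Herm[OF n] in auto)
qed

text \<open>The set where \<open>g\<close> is at most its mean is exactly invariant, so it has
  measure 0 or 1. Either way \<open>g\<close> lies on one side of its mean almost everywhere, which
  is possible only with equality.\<close>

lemma invariant_function_constant:
  fixes g :: "cmat \<Rightarrow> real"
  assumes erg: "U_ergodic M" and g[measurable]: "g \<in> borel_measurable M" and gi: "integrable M g"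
    and inv: "\<And>B u. B \<in> Herm \<Longrightarrow> u \<in> U_fin \<Longrightarrow> g (conjugate_by u B) = g B"
  shows "AE B in M. g B = (LINT B|M. g B)"
proof -
  define c where "c = (LINT B|M. g B)"
  define Y where "Y = {B \<in> Herm. g B \<le> c}"
  have Y[measurable]: "Y \<in> sets M"
  proof -
    have "{B \<in> space M. g B \<le> c} \<in> sets M" by measurable
    then show ?thesis by (simp add: Y_def space_M)
  qed
  have "conjugate_by u ` Y = Y" if "u \<in> U_fin" for u
    unfolding Y_def by (rule conjugate_image_invariant[OF that]) (simp add: inv)
  then have "measure M Y = 0 \<or> measure M Y = 1" using erg Y unfolding U_ergodic_def by simp
  then show ?thesis
  proof
    assume "measure M Y = 0"
    then have "AE B in M. B \<notin> Y" using Y by (intro AE_I[of _ _ Y]) (auto simp: emeasure_eq_measure)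
    moreover have "AE B in M. B \<in> Herm" by (rule AE_Herm)
    ultimately have gt: "AE B in M. g B > c" by eventually_elim (auto simp: Y_def)
    have "(LINT B|M. g B - c) = 0" using gi by (simp add: c_def prob_space)
    moreover have "(LINT B|M. g B - c) = 0 \<longleftrightarrow> (AE B in M. g B - c = 0)"
      by (rule integral_nonneg_eq_0_iff_AE) (use gi gt in auto)
    ultimately have "AE B in M. g B - c = 0" by simp
    with gt have "AE B in M. False" by eventually_elim simp
    then show ?thesis by eventually_elim simp
  next
    assume "measure M Y = 1"
    then have "AE B in M. B \<in> Y" using prob_eq_1[OF Y] by simp
    then have le: "AE B in M. g B \<le> c" by eventually_elim (auto simp: Y_def)
    have "(LINT B|M. c - g B) = 0" using gi by (simp add: c_def prob_space)
    moreover have "(LINT B|M. c - g B) = 0 \<longleftrightarrow> (AE B in M. c - g B = 0)"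
      by (rule integral_nonneg_eq_0_iff_AE) (use gi le in auto)
    ultimately have "AE B in M. c - g B = 0" by simp
    then show ?thesis unfolding c_def[symmetric] by eventually_elim simp
  qed
qed

text \<open>A unitary in \<open>U(k)\<close> moves only the first \<open>k\<close> of the \<open>4\<^sup>m\<close> blocks. Hence \<^const>\<open>lim\<close> of the averages is
  invariant everywhere, even where they diverge and \<^const>\<open>lim\<close> has an unspecified value.\<close>

lemma block_average_conjugate:
  assumes n: "n > 0" and A: "A \<in> Herm_n n" and u: "u \<in> U_fin" and B: "B \<in> Herm"
  shows "(\<lambda>m. block_average n A m (conjugate_by u B) - block_average n A m B) \<longlonglongrightarrow> 0"
proof -
  obtain k where k: "u \<in> U_n k" using u by (auto simp: U_fin_def)
  have cB: "conjugate_by u B \<in> Herm" by (rule conjugate_by_Herm[OF k B])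
  define e where "e = (\<lambda>b. phase (shiftm (Suc b * n) A) (conjugate_by u B) - phase (shiftm (Suc b * n) A) B)"
  have e0: "e b = 0" if "k \<le> b" for b
  proof -
    have "k \<le> b * n" using that n by (metis One_nat_def Suc_leI le_trans mult_le_mono2 mult.right_neutral)
    then have "conjugate_by (madj u) (shiftm (Suc b * n) A) = shiftm (Suc b * n) A"
      by (intro conjugate_by_disjoint[OF U_n_madj[OF k]]) (auto simp: shiftm_def)
    then show ?thesis by (simp only: e_def phase_conjugate(2)[OF u shift_Herm_fin[OF A]] diff_self)
  qed
  have e2: "norm (e b) \<le> 2" for b
    using norm_triangle_ineq4[of "phase (shiftm (Suc b * n) A) (conjugate_by u B)" "phase (shiftm (Suc b * n) A) B"]
      norm_phase[OF shift_Herm_fin[OF A] cB] norm_phase[OF shift_Herm_fin[OF A] B] by (simp add: e_def)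
  have "norm (block_average n A m (conjugate_by u B) - block_average n A m B) \<le> (2 * real k) * (1 / 4) ^ m" for m
  proof -
    have "block_average n A m (conjugate_by u B) - block_average n A m B = (\<Sum>b<4 ^ m. (1 / 4 ^ m) *\<^sub>R e b)"
      by (simp only: block_average_def e_def sum_subtractf scaleR_diff_right)
    also have "norm \<dots> \<le> (\<Sum>b<4 ^ m. (1 / 4 ^ m) * norm (e b))"
      by (rule order_trans[OF norm_sum]) simp
    also have "\<dots> \<le> (\<Sum>b<4 ^ m. if b \<in> {..<k} then (1 / 4 ^ m) * 2 else 0)"
      using e0 e2 by (intro sum_mono) (auto intro!: divide_right_mono)
    also have "\<dots> = (\<Sum>b\<in>{..<4 ^ m} \<inter> {..<k}. (1 / 4 ^ m) * 2)" by (simp only: sum.inter_restrict[OF finite_lessThan])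
    also have "\<dots> \<le> (\<Sum>b<k. (1 / 4 ^ m) * 2)" by (intro sum_mono2) auto
    finally show ?thesis by (simp add: power_divide mult.commute)
  qed
  then have ev: "\<forall>\<^sub>F m in sequentially. norm (block_average n A m (conjugate_by u B) - block_average n A m B) \<le> (2 * real k) * (1 / 4) ^ m"
    by simp
  have "(\<lambda>m. (2 * real k) * (1 / 4) ^ m) \<longlonglongrightarrow> 0"
    by (rule tendsto_mult_right_zero, rule LIMSEQ_realpow_zero) simp_all
  then show ?thesis by (rule Lim_null_comparison[OF ev])
qed

text \<open>The pointwise limit is invariant, hence constant by ergodicity; all averages have mean
  \<open>char_fun M A\<close>, so dominated convergence gives the constant.\<close>

lemma block_average_tendsto:
  assumes erg: "U_ergodic M" and n: "n > 0" and A: "A \<in> Herm_n n"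
  shows "AE B in M. (\<lambda>m. block_average n A m B) \<longlonglongrightarrow> char_fun M A"
proof -
  define \<psi> where "\<psi> = (\<lambda>B. lim (\<lambda>m. block_average n A m B))"
  have [measurable]: "\<psi> \<in> borel_measurable M" unfolding \<psi>_def
    using block_average_M[OF A] by (intro borel_measurable_lim_metric)
  have AE_lim: "AE B in M. (\<lambda>m. block_average n A m B) \<longlonglongrightarrow> \<psi> B"
    using block_average_converges[OF n A] by eventually_elim (simp add: \<psi>_def convergent_LIMSEQ_iff)
  have AE_H: "AE B in M. B \<in> Herm" by (rule AE_Herm)
  have bnd: "AE B in M. norm (\<psi> B) \<le> 1"
    using AE_lim AE_H
  proof eventually_elim
    case (elim B)
    then show ?case using norm_block_average[OF A] by (intro LIMSEQ_le_const2[OF tendsto_norm]) auto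
  qed
  have \<psi>i: "integrable M \<psi>" by (rule integrable_const_bound[OF bnd]) measurable
  have inv: "\<psi> (conjugate_by u B) = \<psi> B" if "B \<in> Herm" "u \<in> U_fin" for B u
  proof -
    note d = block_average_conjugate[OF n A that(2,1)]
    have "(\<lambda>m. block_average n A m (conjugate_by u B)) \<longlonglongrightarrow> L \<longleftrightarrow> (\<lambda>m. block_average n A m B) \<longlonglongrightarrow> L" for L
      using tendsto_add[OF _ d, of "\<lambda>m. block_average n A m B" L] tendsto_diff[OF _ d, of "\<lambda>m. block_average n A m (conjugate_by u B)" L]
      by auto
    then show ?thesis unfolding \<psi>_def lim_def by simp
  qed
  have "AE B in M. Re (\<psi> B) = (LINT B|M. Re (\<psi> B))"
    by (rule invariant_function_constant[OF erg]) (use \<psi>i in \<open>auto simp: inv intro: integrable_Re\<close>)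
  moreover have "AE B in M. Im (\<psi> B) = (LINT B|M. Im (\<psi> B))"
    by (rule invariant_function_constant[OF erg]) (use \<psi>i in \<open>auto simp: inv intro: integrable_Im\<close>)
  ultimately have const: "AE B in M. \<psi> B = Complex (LINT B|M. Re (\<psi> B)) (LINT B|M. Im (\<psi> B))"
    by eventually_elim (simp add: complex_eq_iff)
  define w where "w = Complex (LINT B|M. Re (\<psi> B)) (LINT B|M. Im (\<psi> B))"
  have w: "AE B in M. (\<lambda>m. block_average n A m B) \<longlonglongrightarrow> w"
    using AE_lim const by eventually_elim (simp add: w_def)
  have "(\<lambda>m. LINT B|M. block_average n A m B) \<longlonglongrightarrow> (LINT B|M. w)"
    by (rule integral_dominated_convergence[where w = "\<lambda>_. 1"])
       (use w block_average_M[OF A] norm_block_average[OF A] space_M in auto)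
  moreover have "(LINT B|M. block_average n A m B) = char_fun M A" for m
  proof -
    have "(LINT B|M. block_average n A m B) = (\<Sum>b<4 ^ m. (1 / 4 ^ m) *\<^sub>R (LINT B|M. phase (shiftm (Suc b * n) A) B))"
      unfolding block_average_def
      by (subst Bochner_Integration.integral_sum) (auto intro!: integrable_scaleR_right phase_integrable shift_Herm_fin[OF A] simp del: mult_Suc)
    also have "\<dots> = (\<Sum>b<4 ^ m :: nat. (1 / 4 ^ m) *\<^sub>R char_fun M A)"
      by (simp only: char_fun_eq[symmetric] char_fun_block[OF n A])
    also have "\<dots> = char_fun M A" by (simp add: scaleR_conv_of_real)
    finally show ?thesis .
  qed
  ultimately have "w = char_fun M A" by (simp add: prob_space LIMSEQ_const_iff)
  then show ?thesis using w by simp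
qed

definition multiplicative :: bool where
  "multiplicative \<longleftrightarrow> (\<forall>n A A'. n > 0 \<longrightarrow> A \<in> Herm_n n \<longrightarrow> A' \<in> Herm_n n \<longrightarrow>
     char_fun M (madd A (shiftm n A')) = char_fun M A * char_fun M A')"

lemma multiplicativeD:
  "multiplicative \<Longrightarrow> n > 0 \<Longrightarrow> A \<in> Herm_n n \<Longrightarrow> A' \<in> Herm_n n \<Longrightarrow>
     char_fun M (madd A (shiftm n A')) = char_fun M A * char_fun M A'"
  by (simp add: multiplicative_def)

text \<open>\<open>phase A\<close> lives in block 0 and the averages for \<open>A'\<close> in the
  later blocks. Every term of the averaged product has the same integral, while in the limit the
  average becomes a constant and leaves the integral.\<close>

theorem ergodic_imp_multiplicative:
  assumes erg: "U_ergodic M"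
  shows multiplicative
  unfolding multiplicative_def
proof (intro allI impI)
  fix n A A' assume n: "n > 0" and A: "A \<in> Herm_n n" "A' \<in> Herm_n n"
  have Af: "A \<in> Herm_fin" using A by (blast intro: Herm_finI)
  have "(\<lambda>m. LINT B|M. phase A B * block_average n A' m B) \<longlonglongrightarrow> (LINT B|M. phase A B * char_fun M A')"
  proof (rule integral_dominated_convergence[where w = "\<lambda>_. 1"])
    show "AE B in M. (\<lambda>m. phase A B * block_average n A' m B) \<longlonglongrightarrow> phase A B * char_fun M A'"
      using block_average_tendsto[OF erg n A(2)] by eventually_elim (intro tendsto_intros)
    show "AE B in M. norm (phase A B * block_average n A' m B) \<le> 1" for m
      using AE_space by eventually_elim (simp add: space_M norm_mult norm_phase[OF Af] norm_block_average[OF A(2)])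
  qed (use block_average_M[OF A(2)] phase_M[OF Af] in auto)
  moreover have "(LINT B|M. phase A B * block_average n A' m B) = char_fun M (madd A (shiftm n A'))" for m
  proof -
    note sh = shift_Herm_fin[OF A(2)]
    have p: "phase A B * phase (shiftm (Suc b * n) A') B = phase (madd A (shiftm (Suc b * n) A')) B" for b B
      by (rule phase_madd[OF Af sh, symmetric])
    have m: "madd A (shiftm (Suc b * n) A') \<in> Herm_fin" for b
      using shiftm_Herm_n[OF A(2), of "Suc b * n"] A(1)
      by (intro Herm_finI[of _ "Suc b * n + n"] madd_Herm_n) (auto elim: Herm_n_mono)
    have "(LINT B|M. phase A B * block_average n A' m B)
        = (LINT B|M. (\<Sum>b<4 ^ m. (1 / 4 ^ m) *\<^sub>R phase (madd A (shiftm (Suc b * n) A')) B))"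
      by (simp only: block_average_def sum_distrib_left mult_scaleR_right p)
    also have "\<dots> = (\<Sum>b<4 ^ m. (1 / 4 ^ m) *\<^sub>R (LINT B|M. phase (madd A (shiftm (Suc b * n) A')) B))"
      by (subst Bochner_Integration.integral_sum) (auto intro!: integrable_scaleR_right phase_integrable m simp del: mult_Suc)
    also have "\<dots> = (\<Sum>b<4 ^ m :: nat. (1 / 4 ^ m) *\<^sub>R char_fun M (madd A (shiftm n A')))"
      using char_fun_blocks[OF n A, of 0 "Suc b" for b] by (simp add: char_fun_eq)
    also have "\<dots> = char_fun M (madd A (shiftm n A'))" by (simp add: scaleR_conv_of_real)
    finally show ?thesis .
  qed
  ultimately have "char_fun M (madd A (shiftm n A')) = (LINT B|M. phase A B * char_fun M A')"
    by (simp add: LIMSEQ_const_iff)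
  then show "char_fun M (madd A (shiftm n A')) = char_fun M A * char_fun M A'" by (simp add: char_fun_eq)
qed

text \<open>For an invariant set \<open>Y\<close>, the averages show that conditioning on \<open>Y\<close> does not change the
  characteristic function, so \<open>Y\<close> is independent of itself.\<close>

theorem multiplicative_imp_ergodic:
  assumes mult: multiplicative
  shows "U_ergodic M"
proof -
  have conv: "AE B in M. (\<lambda>m. block_average n A m B) \<longlonglongrightarrow> char_fun M A" if n: "n > 0" and A: "A \<in> Herm_n n" for n A
  proof -
    define f where "f = char_fun M A"
    define V where "V = (\<lambda>b B. phase (shiftm (Suc b * n) A) B - f)"
    note sh = shift_Herm_fin[OF A]
    have E: "(LINT B|M. phase (shiftm (Suc b * n) A) B) = f" for b
      unfolding f_def char_fun_eq[symmetric] by (rule char_fun_block[OF n A])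
    have i: "integrable M (phase (shiftm (Suc b * n) A))" for b by (rule phase_integrable[OF sh])
    have mA: "mscale (-1) A \<in> Herm_n n" using mscale_Herm_n[OF A, of "-1"] by simp
    have "char_fun M (mscale (-1) A) = (LINT B|M. cnj (phase A B))"
      unfolding char_fun_eq using phase_neg[OF Herm_finI[OF A]]
      by (intro Bochner_Integration.integral_cong) (auto simp: space_M)
    also have "\<dots> = cnj f" using phase_integrable[OF Herm_finI[OF A]] by (simp add: f_def char_fun_eq)
    \<comment> \<open>Multiplicativity turns the common covariance into the product of the means, so
      the centred phases \<open>V\<close> of distinct blocks are uncorrelated.\<close>
    finally have f': "char_fun M (madd A (shiftm n (mscale (-1) A))) = f * cnj f"
      by (simp only: multiplicativeD[OF mult n A mA] f_def)
    have ex: "V b B * cnj (V b' B) = phase (shiftm (Suc b * n) A) B * cnj (phase (shiftm (Suc b' * n) A) B)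
        - (cnj f * phase (shiftm (Suc b * n) A) B + f * cnj (phase (shiftm (Suc b' * n) A) B)) + f * cnj f" for b b' B
      by (simp add: V_def algebra_simps)
    have ic: "integrable M (\<lambda>B. cnj (phase (shiftm (Suc b * n) A) B))" for b using i by simp
    have int: "integrable M (\<lambda>B. V b B * cnj (V b' B))" for b b'
      unfolding ex by (intro Bochner_Integration.integrable_add Bochner_Integration.integrable_diff phase_cov(1)[OF n A]
        integrable_mult_right i ic integrable_const)
    have cov: "(LINT B|M. V b B * cnj (V b' B)) = (if b = b' then 1 - f * cnj f else 0)" for b b'
    proof -
      have "(LINT B|M. V b B * cnj (V b' B))
          = (LINT B|M. phase (shiftm (Suc b * n) A) B * cnj (phase (shiftm (Suc b' * n) A) B))
            - (cnj f * (LINT B|M. phase (shiftm (Suc b * n) A) B) + f * (LINT B|M. cnj (phase (shiftm (Suc b' * n) A) B))) + f * cnj f"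
        unfolding ex using phase_cov(1)[OF n A, of "Suc b" "Suc b'"] i[of b] ic[of b']
        by (simp add: prob_space del: mult_Suc integral_cnj)
      also have "(LINT B|M. cnj (phase (shiftm (Suc b' * n) A) B)) = cnj f" using E by simp
      finally show ?thesis unfolding E phase_cov(2)[OF n A] f'
        by (cases "b = b'") (simp_all add: algebra_simps del: mult_Suc)
    qed
    note L = complex_L2_sum[OF finite_lessThan int cov]
    have nf: "norm f \<le> 1" unfolding f_def by (rule norm_char_fun_le[OF Herm_finI[OF A]])
    have avg: "block_average n A m B - f = (\<Sum>b<4 ^ m. (1 / 4 ^ m) *\<^sub>R V b B)" for m B
      by (simp only: block_average_def V_def sum_subtractf scaleR_diff_right) (simp add: scaleR_conv_of_real)
    have "AE B in M. summable (\<lambda>m. norm (block_average n A m B - f))"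
    proof (rule AE_summable_of_L2_geometric)
      show "(\<lambda>B. block_average n A m B - f) \<in> borel_measurable M" for m using block_average_M[OF A] by measurable
      show "integrable M (\<lambda>B. (norm (block_average n A m B - f))\<^sup>2)" for m unfolding avg by (rule L(1))
      fix m
      have "complex_of_real (LINT B|M. (norm (block_average n A m B - f))\<^sup>2) = (1 - f * cnj f) * of_real (\<Sum>b<4 ^ m :: nat. (1 / 4 ^ m)\<^sup>2)"
        unfolding avg L(2) by simp
      also have "\<dots> = complex_of_real ((1 - (norm f)\<^sup>2) * (1 / 4) ^ m)"
        by (simp add: complex_norm_square[symmetric] power_divide power2_eq_square del: of_real_power) 
      finally have "(LINT B|M. (norm (block_average n A m B - f))\<^sup>2) = (1 - (norm f)\<^sup>2) * (1 / 4) ^ m"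
        by (simp only: of_real_eq_iff)
      then show "(LINT B|M. (norm (block_average n A m B - f))\<^sup>2) \<le> 1 * (1 / 4) ^ m"
        by (simp add: mult_left_le_one_le)
    qed
    then show ?thesis
    proof eventually_elim
      case (elim B)
      have "(\<lambda>m. block_average n A m B - f) \<longlonglongrightarrow> 0" by (rule tendsto_norm_zero_cancel[OF summable_LIMSEQ_zero[OF elim]])
      then show ?case by (simp add: LIM_zero_iff f_def)
    qed
  qed
  show ?thesis unfolding U_ergodic_def
  proof (intro ballI impI)
    fix Y assume Y[measurable]: "Y \<in> sets M" and inv: "\<forall>u\<in>U_fin. measure M (sym_diff (conjugate_by u ` Y) Y) = 0"
    have YH: "Y \<subseteq> Herm" using sets.sets_into_space[OF Y] by (simp add: space_M)
    have ind_inv: "AE B in M. indicator Y (conjugate_by u B) = (indicator Y B :: real)" if u: "u \<in> U_fin" for u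
    proof -
      obtain n where n: "u \<in> U_n n" using u by (auto simp: U_fin_def)
      have u': "madj u \<in> U_fin" using U_n_madj[OF n] by (auto simp: U_fin_def)
      \<comment> \<open>The hypothesis on \<open>Y\<close> speaks of images; applied to the adjoint
        it speaks of the preimage under \<open>u\<close>, which is what the indicator of
        \<open>Y\<close> composed with the conjugation describes.\<close>
      have im: "conjugate_by (madj u) ` Y = conjugate_by u -` Y \<inter> space M"
      proof (intro equalityI subsetI)
        fix B assume "B \<in> conjugate_by u -` Y \<inter> space M"
        then show "B \<in> conjugate_by (madj u) ` Y"
          using conjugate_by_madj_cancel(1)[OF n, of B] by (intro image_eqI[of _ _ "conjugate_by u B"]) auto
      qed (use conjugate_by_madj_cancel(2)[OF n] conjugate_by_Herm[OF U_n_madj[OF n]] YH space_M in auto)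
      have [measurable]: "conjugate_by u -` Y \<inter> space M \<in> sets M"
        by (rule measurable_sets[OF conjugate_measurable[OF u] Y])
      have "measure M (sym_diff (conjugate_by u -` Y \<inter> space M) Y) = 0"
        using inv u' unfolding im[symmetric] by blast
      then have "AE B in M. B \<notin> sym_diff (conjugate_by u -` Y \<inter> space M) Y"
        by (intro AE_I[of _ _ "sym_diff (conjugate_by u -` Y \<inter> space M) Y"]) (auto simp: emeasure_eq_measure)
      then show ?thesis using AE_space by eventually_elim (auto simp: indicator_def)
    qed
    define I where "I = (\<lambda>A. LINT B|M. indicator Y B *\<^sub>R phase A B)"
    have I_conj: "I (conjugate_by u A) = I A" if u: "u \<in> U_fin" and A: "A \<in> Herm_fin" for u A
    proof -
      note pc = phase_conjugate[OF u A]
      have "I (conjugate_by u A) = (LINT B|M. indicator Y (conjugate_by u B) *\<^sub>R phase (conjugate_by u A) (conjugate_by u B))"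
        unfolding I_def using integral_conjugate[OF u, of "\<lambda>B. indicator Y B *\<^sub>R phase (conjugate_by u A) B"] phase_M[OF pc(3)] by simp
      also have "\<dots> = (LINT B|M. indicator Y (conjugate_by u B) *\<^sub>R phase A B)"
      proof -
        obtain n where n: "u \<in> U_n n" using u by (auto simp: U_fin_def)
        show ?thesis unfolding pc(1) conjugate_by_madj_cancel(1)[OF n] ..
      qed
      also have "\<dots> = I A"
        unfolding I_def
      proof (rule integral_cong_AE)
        show "AE B in M. indicator Y (conjugate_by u B) *\<^sub>R phase A B = indicator Y B *\<^sub>R phase A B"
          using ind_inv[OF u] by eventually_elim simp
        show "(\<lambda>B. indicator Y (conjugate_by u B) *\<^sub>R phase A B) \<in> borel_measurable M"
          using phase_M[OF A] measurable_compose[OF conjugate_measurable[OF u] borel_measurable_indicator[OF Y]] by measurable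
      qed (use phase_M[OF A] in measurable)
      finally show ?thesis .
    qed
    \<comment> \<open>All translates of \<open>A\<close> have the same integral over
      \<open>Y\<close>, so \<open>I A\<close> is the integral over \<open>Y\<close> of the averages,
      and these converge to the constant \<open>char_fun M A\<close>.\<close>
    have I_eq: "I A = measure M Y *\<^sub>R char_fun M A" if Af: "A \<in> Herm_fin" for A
    proof -
      obtain n where "A \<in> Herm_n n" using Af by (auto simp: Herm_fin_def)
      then have n: "Suc n > 0" "A \<in> Herm_n (Suc n)" by (auto intro: Herm_n_mono)
      have "(\<lambda>m. LINT B|M. indicator Y B *\<^sub>R block_average (Suc n) A m B) \<longlonglongrightarrow> (LINT B|M. indicator Y B *\<^sub>R char_fun M A)"
      proof (rule integral_dominated_convergence[where w = "\<lambda>_. 1"])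
        show "AE B in M. (\<lambda>m. indicator Y B *\<^sub>R block_average (Suc n) A m B) \<longlonglongrightarrow> indicator Y B *\<^sub>R char_fun M A"
          using conv[OF n] by eventually_elim (intro tendsto_intros)
        show "AE B in M. norm (indicator Y B *\<^sub>R block_average (Suc n) A m B) \<le> 1" for m
          using AE_space by eventually_elim (auto simp: space_M norm_block_average[OF n(2)] indicator_def)
      qed (use block_average_M[OF n(2)] in auto)
      moreover have "(LINT B|M. indicator Y B *\<^sub>R block_average (Suc n) A m B) = I A" for m
      proof -
        note sh = shift_Herm_fin[OF n(2)]
        have ii: "integrable M (\<lambda>B. indicator Y B *\<^sub>R phase A B)" if "A \<in> Herm_fin" for A
          using phase_integrable[OF that] Y by (rule integrable_mult_indicator[rotated])
        have Ib: "I (shiftm (Suc b * Suc n) A) = I A" for b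
        proof -
          obtain \<sigma> k where s: "\<sigma> permutes {..<k}" "\<sigma> 0 = Suc b" using exists_permutation_01[of "Suc b" 0] by auto
          obtain u where u: "u \<in> U_n (k * Suc n)" "\<And>A b. A \<in> Herm_n (Suc n) \<Longrightarrow> conjugate_by u (shiftm (b * Suc n) A) = shiftm (\<sigma> b * Suc n) A"
            using block_permutation[OF n(1) s(1)] by blast
          show ?thesis using I_conj[of u A] u(2)[OF n(2), of 0] s(2) u(1) Af by (auto simp: U_fin_def)
        qed
        have "(LINT B|M. indicator Y B *\<^sub>R block_average (Suc n) A m B)
            = (LINT B|M. (\<Sum>b<4 ^ m. (1 / 4 ^ m) *\<^sub>R (indicator Y B *\<^sub>R phase (shiftm (Suc b * Suc n) A) B)))"
          by (simp only: block_average_def scaleR_sum_right scaleR_left_commute)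
        also have "\<dots> = (\<Sum>b<4 ^ m. (1 / 4 ^ m) *\<^sub>R I (shiftm (Suc b * Suc n) A))"
          unfolding I_def integral_scaleR_right[symmetric]
          by (rule Bochner_Integration.integral_sum, rule integrable_scaleR_right, rule ii, rule sh)
        also have "\<dots> = I A" by (simp only: Ib) (simp add: scaleR_conv_of_real)
        finally show ?thesis .
      qed
      ultimately have "I A = (LINT B|M. indicator Y B *\<^sub>R char_fun M A)" by (simp add: LIMSEQ_const_iff)
      also have "\<dots> = measure M Y *\<^sub>R char_fun M A"
      proof -
        have "integrable M (indicator Y :: cmat \<Rightarrow> real)" by (rule integrable_const_bound[of _ 1]) auto
        moreover have "(LINT B|M. indicator Y B :: real) = measure M Y"
          by (simp add: sets.Int_space_eq2)
        ultimately show ?thesis by (simp only: integral_scaleR_left)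
      qed
      finally show ?thesis .
    qed
    show "measure M Y = 0 \<or> measure M Y = 1"
    proof (rule disjCI)
      assume "measure M Y \<noteq> 1"
      show "measure M Y = 0"
      proof (rule ccontr)
        assume "measure M Y \<noteq> 0"
        then have pos: "measure M Y > 0" by (simp add: zero_less_measure_iff)
        define w where "w = (\<lambda>B. indicator Y B / measure M Y)"
        have [measurable]: "w \<in> borel_measurable M" unfolding w_def by measurable
        have w0: "0 \<le> w B" for B by (simp add: w_def)
        \<comment> \<open>\<open>N\<close> is \<open>M\<close> conditioned on \<open>Y\<close>. It
          has the characteristic function of \<open>M\<close>, hence equals \<open>M\<close>, yet it
          gives no mass to the complement of \<open>Y\<close>.\<close>
        define N where "N = density M (\<lambda>B. ennreal (w B))"
        have pN: "prob_space N"
        proof (rule prob_spaceI)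
          have "emeasure N (space N) = (\<integral>\<^sup>+ B. ennreal (w B) \<partial>M)"
            unfolding N_def by (simp add: emeasure_density cong: nn_integral_cong)
          also have "\<dots> = ennreal (LINT B|M. w B)"
            by (rule nn_integral_eq_integral)
               (auto simp: w0 w_def emeasure_eq_measure intro!: integrable_real_indicator integrable_divide)
          also have "(LINT B|M. w B) = 1" using pos YH by (simp add: w_def space_M Int_absorb2)
          finally show "emeasure N (space N) = 1" by simp
        qed
        have N: "borel_prob_on_Herm N" using pN sets_M by (simp add: borel_prob_on_Herm_def N_def)
        have "char_fun N A = char_fun M A" if A: "A \<in> Herm_fin" for A
        proof -
          have "char_fun N A = (LINT B|M. w B *\<^sub>R phase A B)"
            unfolding char_fun_def N_def phase_def[symmetric] by (rule integral_density) (use phase_M[OF A] w0 in auto)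
          also have "\<dots> = (1 / measure M Y) *\<^sub>R I A"
            unfolding I_def w_def integral_scaleR_right[symmetric] by (simp add: divide_inverse mult.commute)
          also have "\<dots> = char_fun M A" using pos by (simp add: I_eq[OF A])
          finally show ?thesis .
        qed
        then have "N = M" by (rule char_fun_unique[OF N borel_prob])
        moreover have "emeasure N (space M - Y) = 0"
          unfolding N_def by (subst emeasure_density) (auto simp: w_def indicator_def nn_integral_0_iff_AE)
        ultimately have "measure M (space M - Y) = 0" by (simp add: measure_def)
        then have "measure M Y = 1" using prob_compl[OF Y] by simp
        with \<open>measure M Y \<noteq> 1\<close> show False by simp
      qed
    qed
  qed
qed

end

section \<open>Corners tested on Gaussian vectors\<close>

definition corner :: "nat \<Rightarrow> cmat \<Rightarrow> cmat" where
  "corner N A = (\<lambda>i j. if i < N \<and> j < N then A i j else 0)"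

text \<open>The quadratic form of the \<open>N x N\<close> corner of \<open>B\<close> at the vector
  \<open>v\<close>.\<close>

definition quad :: "nat \<Rightarrow> (nat \<Rightarrow> complex) \<Rightarrow> cmat \<Rightarrow> complex" where
  "quad N v B = (\<Sum>i<N. \<Sum>k<N. v i * cnj (v k) * B k i)"

lemma corner_Herm_n: "A \<in> Herm \<Longrightarrow> corner N A \<in> Herm_n N"
  using Herm_cnj[of A] by (auto simp: Herm_n_def corner_def intro!: HermI)

lemma trace_corner_outer: "B \<in> Herm \<Longrightarrow> mtrace (mmul (corner N B) (outer v)) = quad N v B"
proof -
  assume B: "B \<in> Herm"
  have "mtrace (mmul (corner N B) (outer v)) = (\<Sum>i<N. \<Sum>k<N. B i k * (v k * cnj (v i)))"
    unfolding trace_eq_sum[OF corner_Herm_n[OF B]] by (simp add: corner_def outer_def)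
  also have "\<dots> = quad N v B" unfolding quad_def by (subst sum.swap) (simp add: mult_ac)
  finally show ?thesis .
qed

text \<open>Two readings of \<open>quad\<close> drive this section. Pairing the corner of
  \<open>B\<close> with \<open>outer v\<close> makes it a Gaussian quadratic form for fixed
  \<open>B\<close>; pairing the finite matrix \<open>corner N (outer v)\<close> with
  \<open>B\<close> makes its exponential an integrand of \<open>char_fun\<close> for fixed
  \<open>v\<close>.\<close>

lemma phase_scaled_outer: "phase (mscale (of_real c) (corner N (outer v))) B = exp (\<i> * (of_real c * quad N v B))"
proof -
  have "mtrace (mmul (mscale (of_real c) (corner N (outer v))) B) = of_real c * quad N v B"
    unfolding trace_eq_sum[OF mscale_Herm_n[OF corner_Herm_n[OF outer_Herm]]]
    by (simp add: mscale_def corner_def outer_def quad_def sum_distrib_left mult.assoc)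
  then show ?thesis by (simp add: phase_def)
qed

lemma conjugate_corner_outer:
  assumes u: "u \<in> U_n N"
  shows "conjugate_by u (corner N (outer v)) = corner N (outer (\<lambda>i. \<Sum>k<N. u i k * v k))"
proof (intro ext)
  fix i j
  show "conjugate_by u (corner N (outer v)) i j = corner N (outer (\<lambda>i. \<Sum>k<N. u i k * v k)) i j"
  proof (cases "i < N \<and> j < N")
    case True
    then have "conjugate_by u (corner N (outer v)) i j = (\<Sum>k<N. \<Sum>l<N. (u i k * v k) * cnj (u j l * v l))"
      by (subst conjugate_by_eq_sum[OF u order.refl]) (auto simp: corner_def outer_def mult_ac)
    then show ?thesis using True by (simp add: corner_def outer_def sum_product)
  next
    case False
    then show ?thesis using Herm_nD(1)[OF conjugate_by_Herm_n[OF u corner_Herm_n[OF outer_Herm]], of i j v]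
      by (auto simp: corner_def)
  qed
qed

lemma corner_outer_cong: "(\<And>i. i < N \<Longrightarrow> v i = w i) \<Longrightarrow> corner N (outer v) = corner N (outer w)"
  by (intro ext) (simp add: corner_def outer_def)

lemma diag1_Herm_n: "n > 0 \<Longrightarrow> diag1 a \<in> Herm_n n"
  by (auto simp: Herm_n_def diag1_def intro!: HermI)

lemma unitary_to_first_axis:
  assumes N: "N > 0"
  shows "\<exists>u\<in>U_n N. conjugate_by u (corner N (outer v)) = diag1 (\<Sum>i<N. (cmod (v i))\<^sup>2)"
proof (cases "(\<Sum>i<N. (cmod (v i))\<^sup>2) = 0")
  case True
  then have "v i = 0" if "i < N" for i
    using that by (subst (asm) sum_nonneg_eq_0_iff) auto
  then have "corner N (outer v) = diag1 0" by (intro ext) (auto simp: corner_def outer_def diag1_def)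
  then show ?thesis using True by (intro bexI[of _ mone]) auto
next
  case False
  define s where "s = (\<Sum>i<N. (cmod (v i))\<^sup>2)"
  have s: "s > 0" using False unfolding s_def by (simp add: order_less_le sum_nonneg)
  define w where "w = (\<lambda>i. if i < N then v i / sqrt s else 0)"
  have cs: "complex_of_real (sqrt s) * complex_of_real (sqrt s) = of_real s"
    using s by (simp flip: of_real_mult)
  have "(\<Sum>i<N. w i * cnj (w i)) = (\<Sum>i<N. of_real ((cmod (v i))\<^sup>2) / of_real s)"
    by (rule sum.cong[OF refl]) (simp add: w_def complex_norm_square cs del: of_real_power)
  also have "\<dots> = of_real s / of_real s" unfolding s_def by (simp flip: sum_divide_distrib)
  finally have w1: "(\<Sum>i<N. w i * cnj (w i)) = 1" using s by simp
  obtain u where u: "u \<in> U_n N" "\<And>i. u i 0 = w i"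
    using unitary_with_column[OF N _ w1] by (auto simp: w_def)
  note u' = U_n_madj[OF u(1)]
  have z: "(\<Sum>k<N. madj u i k * v k) = (if i = 0 then of_real (sqrt s) else 0)" if i: "i < N" for i
  proof -
    have "(\<Sum>k<N. madj u i k * v k) = (\<Sum>k<N. madj u i k * u k 0) * of_real (sqrt s)"
      using s by (simp add: sum_distrib_right u(2) w_def)
    also have "(\<Sum>k<N. madj u i k * u k 0) = mmul (madj u) u i 0"
      by (rule mmul_blkL[OF U_n_blk[OF u'] order.refl i, symmetric])
    finally show ?thesis using u(1) by (simp add: U_n_def mone_def)
  qed
  have "corner N (outer (\<lambda>i. if i = 0 then of_real (sqrt s) else 0)) = diag1 s"
    using N cs by (intro ext) (auto simp: corner_def outer_def diag1_def)
  moreover have "corner N (outer (\<lambda>i. \<Sum>k<N. madj u i k * v k)) = corner N (outer (\<lambda>i. if i = 0 then of_real (sqrt s) else 0))"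
    by (rule corner_outer_cong) (rule z)
  ultimately have "conjugate_by (madj u) (corner N (outer v)) = diag1 s"
    unfolding conjugate_corner_outer[OF u'] by (simp only:)
  then show ?thesis using u' by (auto simp: s_def)
qed

text \<open>The reflection is taken with the normalised tail of \<open>v\<close> as column 1. The
  tail vanishes at 0, so the first axis is fixed by the last clause of
  \<open>unitary_with_column\<close>, and the \<open>diag1\<close> part survives for every
  \<open>c\<close>.\<close>

lemma unitary_tail_to_second_axis:
  assumes N: "N \<ge> 2"
  shows "\<exists>u\<in>U_n N. \<forall>c e. conjugate_by u (madd (diag1 c) (mscale (of_real e) (corner N (outer v))))
      = madd (diag1 c) (mscale (of_real e) (corner 2 (outer (\<lambda>i. if i = 0 then v 0 else of_real (sqrt ((\<Sum>i<N. (cmod (v i))\<^sup>2) - (cmod (v 0))\<^sup>2))))))"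
proof -
  define s where "s = (\<Sum>i<N. (cmod (v i))\<^sup>2) - (cmod (v 0))\<^sup>2"
  have s_eq: "s = (\<Sum>i\<in>{..<N} - {0}. (cmod (v i))\<^sup>2)"
    unfolding s_def using N by (subst sum.remove[of _ 0]) auto
  have s0: "s \<ge> 0" unfolding s_eq by (intro sum_nonneg) auto
  have cs: "complex_of_real (sqrt s) * complex_of_real (sqrt s) = of_real s"
    using s0 by (simp flip: of_real_mult)
  have main: "\<exists>u\<in>U_n N. u 0 0 = 1 \<and> (\<forall>k. k \<noteq> 0 \<longrightarrow> u 0 k = 0 \<and> u k 0 = 0) \<and>
      (\<forall>i<N. (\<Sum>k<N. u i k * v k) = (if i = 0 then v 0 else if i = 1 then of_real (sqrt s) else 0))"
  proof (cases "s = 0")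
    case True
    then have "v i = 0" if "i < N" "i \<noteq> 0" for i
      using that unfolding s_eq by (subst (asm) sum_nonneg_eq_0_iff) auto
    moreover have "mone 0 0 = 1 \<and> (\<forall>k. k \<noteq> 0 \<longrightarrow> mone 0 k = 0 \<and> mone k 0 = 0)" by (simp add: mone_def)
    moreover have "(\<Sum>k<N. mone i k * v k) = v i" if "i < N" for i
      using that by (simp add: mone_def if_distrib[of "\<lambda>x. x * _"] cong: if_cong)
    ultimately show ?thesis using True by (intro bexI[OF _ mone_U_n]) auto
  next
    case False
    then have s: "s > 0" using s0 by simp
    define w where "w = (\<lambda>i. if i < N \<and> i \<noteq> 0 then v i / sqrt s else 0)"
    have "(\<Sum>i<N. w i * cnj (w i)) = (\<Sum>i\<in>{..<N} - {0}. of_real ((cmod (v i))\<^sup>2) / of_real s)"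
      by (rule sum.mono_neutral_cong_right) (auto simp: w_def complex_norm_square cs simp del: of_real_power)
    also have "\<dots> = of_real s / of_real s" unfolding s_eq by (simp flip: sum_divide_distrib)
    finally have w1: "(\<Sum>i<N. w i * cnj (w i)) = 1" using s by simp
    have "1 < N" using N by simp
    then obtain u where u: "u \<in> U_n N" "\<And>i. u i 1 = w i"
      and u0: "\<And>i j. w i = 0 \<Longrightarrow> i \<noteq> 1 \<Longrightarrow> u i j = mone i j \<and> u j i = mone j i"
      using unitary_with_column[OF _ _ w1, of 1] by (auto simp: w_def)
    note u' = U_n_madj[OF u(1)]
    have w0: "w 0 = 0" by (simp add: w_def)
    have m0: "madj u 0 k = mone 0 k" "madj u k 0 = mone k 0" for k
      using u0[OF w0, of k] by (auto simp: madj_def mone_def)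
    have "(\<Sum>k<N. madj u i k * v k) = (if i = 0 then v 0 else if i = 1 then of_real (sqrt s) else 0)" if i: "i < N" for i
    proof (cases "i = 0")
      case True
      then show ?thesis using N by (simp add: m0 mone_def if_distrib[of "\<lambda>x. x * _"] cong: if_cong)
    next
      case False
      have "(\<Sum>k<N. madj u i k * v k) = (\<Sum>k<N. madj u i k * u k 1 * of_real (sqrt s))"
      proof (rule sum.cong[OF refl])
        fix k assume "k \<in> {..<N}"
        then show "madj u i k * v k = madj u i k * u k 1 * of_real (sqrt s)"
          using s False m0(2)[of i] by (cases "k = 0") (simp_all only: u(2), auto simp: w_def mone_def)
      qed
      also have "\<dots> = mmul (madj u) u i 1 * of_real (sqrt s)"
        by (simp add: mmul_blkL[OF U_n_blk[OF u'] order.refl i] sum_distrib_right)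
      finally show ?thesis using u(1) False by (simp add: U_n_def mone_def)
    qed
    then show ?thesis using u' m0 by (intro bexI[OF _ u']) (auto simp: mone_def)
  qed
  then obtain u where u: "u \<in> U_n N" "u 0 0 = 1" "\<And>k. k \<noteq> 0 \<Longrightarrow> u 0 k = 0 \<and> u k 0 = 0"
    "\<And>i. i < N \<Longrightarrow> (\<Sum>k<N. u i k * v k) = (if i = 0 then v 0 else if i = 1 then of_real (sqrt s) else 0)" by blast
  have "corner N (outer (\<lambda>i. \<Sum>k<N. u i k * v k)) = corner N (outer (\<lambda>i. if i = 0 then v 0 else if i = 1 then of_real (sqrt s) else 0))"
    by (rule corner_outer_cong) (rule u(4))
  also have "\<dots> = corner 2 (outer (\<lambda>i. if i = 0 then v 0 else of_real (sqrt s)))"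
    using N by (intro ext) (auto simp: corner_def outer_def)
  finally have c: "conjugate_by u (corner N (outer v)) = corner 2 (outer (\<lambda>i. if i = 0 then v 0 else of_real (sqrt s)))"
    unfolding conjugate_corner_outer[OF u(1)] .
  have d: "conjugate_by u (diag1 c) = diag1 c" for c
  proof (intro ext)
    fix i j
    define K where "K = max N (max (Suc i) (Suc j))"
    have K: "N \<le> K" "i < K" "j < K" "0 < K" by (auto simp: K_def)
    have "conjugate_by u (diag1 c) i j = (\<Sum>k<K. if k = 0 then u i 0 * of_real c * cnj (u j 0) else 0)"
      unfolding conjugate_by_eq_sum[OF u(1) K(1-3)] diag1_def
      by (rule sum.cong[OF refl]) (use K in \<open>auto simp: if_distrib[of "\<lambda>x. _ * x"] if_distrib[of "\<lambda>x. x * _"] cong: if_cong\<close>)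
    also have "\<dots> = u i 0 * of_real c * cnj (u j 0)" using K by simp
    also have "\<dots> = diag1 c i j" using u(2) u(3)[of i] u(3)[of j] by (auto simp: diag1_def)
    finally show "conjugate_by u (diag1 c) i j = diag1 c i j" .
  qed
  have sc: "conjugate_by u (mscale e A) = mscale e (conjugate_by u A)" for e A
    unfolding mscale_def by (rule conjugate_by_scale[OF u(1)])
  show ?thesis
    by (rule bexI[OF _ u(1)]) (simp only: conjugate_by_madd[OF u(1)] sc c d s_def[symmetric] simp_thms)
qed

section \<open>Restriction to H(1) and pairs of Gaussian vectors\<close>

context invariant_measure
begin

definition F1 :: "real \<Rightarrow> complex" where "F1 a = char_fun M (diag1 a)"

lemma phase_diag1: "phase (diag1 a) B = exp (\<i> * (of_real a * B 0 0))"
  unfolding phase_def trace_eq_sum[OF diag1_Herm_n[OF lessI]] by (simp add: diag1_def)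

text \<open>On \<open>Herm\<close> the corner entry is a real random variable, so the continuity and
  conjugation symmetry of \<open>F1\<close> are those of an ordinary characteristic
  function.\<close>

lemma F1_eq_char: "F1 = char (distr M borel (\<lambda>B. Re (B 0 0)))"
proof
  fix a
  have "F1 a = (LINT B|M. iexp (a * Re (B 0 0)))"
    unfolding F1_def char_fun_eq
  proof (rule Bochner_Integration.integral_cong[OF refl])
    fix B assume "B \<in> space M"
    then have "B 0 0 = of_real (Re (B 0 0))" using Herm_cnj[of B 0 0] by (simp add: space_M complex_eq_iff)
    then show "phase (diag1 a) B = iexp (a * Re (B 0 0))" unfolding phase_diag1 by (metis of_real_mult)
  qed
  then show "F1 a = char (distr M borel (\<lambda>B. Re (B 0 0))) a"
    by (simp add: char_def integral_distr)
qed

lemma F1_0 [simp]: "F1 0 = 1"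
  by (simp add: F1_def char_fun_eq phase_diag1 prob_space)

lemma continuous_F1: "continuous_on UNIV F1"
proof -
  interpret D: real_distribution "distr M borel (\<lambda>B. Re (B 0 0))"
    by (auto simp: real_distribution_def real_distribution_axioms_def intro!: prob_space_distr)
  show ?thesis unfolding F1_eq_char by (simp add: continuous_on_eq_continuous_at D.isCont_char)
qed

lemma F1_uminus: "F1 (- a) = cnj (F1 a)"
  unfolding F1_eq_char char_def by (simp add: exp_cnj flip: Bochner_Integration.integral_cnj)

lemma norm_phase_quad:
  assumes "B \<in> Herm" shows "norm (exp (\<i> * (of_real c * quad N v B))) = 1"
  unfolding phase_scaled_outer[symmetric]
  by (rule norm_phase[OF Herm_finI[OF mscale_Herm_n[OF corner_Herm_n[OF outer_Herm]]] assms])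

lemma mat_phase_continuous:
  assumes K: "\<And>m. K m \<in> Herm_n n" "L \<in> Herm_n n" and lim: "\<And>i j. (\<lambda>m. K m i j) \<longlonglongrightarrow> L i j"
  shows "(\<lambda>m. char_fun M (K m)) \<longlonglongrightarrow> char_fun M L"
  unfolding char_fun_eq
proof (rule integral_dominated_convergence[where w = "\<lambda>_. 1"])
  show "AE B in M. (\<lambda>m. phase (K m) B) \<longlonglongrightarrow> phase L B"
    unfolding phase_def trace_eq_sum[OF K(1)] trace_eq_sum[OF K(2)] by (intro AE_I2 tendsto_intros lim)
  show "AE B in M. norm (phase (K m) B) \<le> 1" for m
    using AE_Herm by eventually_elim (simp add: norm_phase[OF Herm_finI[OF K(1)]])
qed (use K in \<open>auto intro!: phase_M Herm_finI\<close>)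

end

lemma borel_measurable_cnj_compose [measurable (raw)]:
  assumes "f \<in> borel_measurable M" shows "(\<lambda>x. cnj (f x)) \<in> borel_measurable M"
  by (rule measurable_compose[OF assms borel_measurable_continuous_onI]) (intro continuous_intros)

context invariant_measure
begin

declare entry_M [measurable del]

definition outer_pair_char :: "nat \<Rightarrow> real \<Rightarrow> real \<Rightarrow> (nat \<Rightarrow> complex) \<Rightarrow> (nat \<Rightarrow> complex) \<Rightarrow> complex" where
  "outer_pair_char N a b v w = (LINT B|M. exp (\<i> * (of_real a * quad N v B)) * exp (\<i> * (of_real b * quad N w B)))"

lemma outer_pair_char_eq:
  "outer_pair_char N a b v w = char_fun M (madd (mscale (of_real a) (corner N (outer v))) (mscale (of_real b) (corner N (outer w))))"
proof -
  have H: "mscale (of_real c) (corner N (outer v)) \<in> Herm_fin" for c v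
    by (rule Herm_finI[OF mscale_Herm_n[OF corner_Herm_n[OF outer_Herm]]])
  show ?thesis unfolding outer_pair_char_def char_fun_eq phase_madd[OF H H] phase_scaled_outer ..
qed

lemma char_fun_conjugate_n: "u \<in> U_n n \<Longrightarrow> A \<in> Herm_n m \<Longrightarrow> char_fun M (conjugate_by u A) = char_fun M A"
  by (rule char_fun_conjugate) (auto simp: U_fin_def intro: Herm_finI)

text \<open>The two-dimensional form of a pair: \<open>z\<close> is the component of the second
  vector along the first axis and \<open>r\<close> the squared length of its remaining part.\<close>

definition reduced :: "real \<Rightarrow> real \<Rightarrow> complex \<Rightarrow> real \<Rightarrow> cmat" where
  "reduced c e z r = madd (diag1 c) (mscale (of_real e) (corner 2 (outer (\<lambda>i. if i = 0 then z else of_real (sqrt r)))))"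

lemma reduced_Herm_n: "reduced c e z r \<in> Herm_n 2"
  unfolding reduced_def by (intro madd_Herm_n mscale_Herm_n corner_Herm_n outer_Herm diag1_Herm_n) simp

definition sqnorm :: "nat \<Rightarrow> (nat \<times> nat \<Rightarrow> real) \<Rightarrow> real" where
  "sqnorm N \<omega> = (\<Sum>i<N. (cmod (xi i \<omega>))\<^sup>2)"

abbreviation xis :: "(nat \<times> nat \<Rightarrow> real) \<Rightarrow> nat \<Rightarrow> complex" where
  "xis \<omega> \<equiv> \<lambda>i. xi i \<omega>"

lemma quad_xi_measurable [measurable]:
  "(\<lambda>x. quad N (xis (snd x)) (fst x)) \<in> borel_measurable (M \<Otimes>\<^sub>M gauss)"
proof -
  have [measurable]: "(\<lambda>x. fst x i j) \<in> borel_measurable (M \<Otimes>\<^sub>M gauss)" for i j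
    by (rule measurable_compose[OF measurable_fst entry_M])
  have [measurable]: "(\<lambda>x. xi i (snd x)) \<in> borel_measurable (M \<Otimes>\<^sub>M gauss)" for i
    by (rule measurable_compose[OF measurable_snd xi_measurable_gauss])
  show ?thesis unfolding quad_def by measurable
qed

lemma quad_M [measurable]: "quad N v \<in> borel_measurable M"
proof -
  note entry_M [measurable]
  show ?thesis unfolding quad_def[abs_def] by measurable
qed

lemma quad_gauss [measurable]: "(\<lambda>\<omega>. quad N (xis \<omega>) B) \<in> borel_measurable gauss"
  unfolding quad_def by measurable

lemma pair_MG: "pair_sigma_finite M gauss"
  by (intro pair_sigma_finite.intro prob_space_imp_sigma_finite prob_space_axioms prob_space_gauss)

lemma diag1_char_measurable:
  "(\<lambda>\<omega>. char_fun M (madd (diag1 c) (mscale (of_real e) (corner N (outer (xis \<omega>)))))) \<in> borel_measurable (PiM UNIV (\<lambda>_. borel))"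
proof -
  have d: "diag1 c \<in> Herm_fin" by (rule Herm_finI[OF diag1_Herm_n[OF lessI]])
  have H: "mscale (of_real e) (corner N (outer v)) \<in> Herm_fin" for v
    by (rule Herm_finI[OF mscale_Herm_n[OF corner_Herm_n[OF outer_Herm]]])
  have [measurable]: "(\<lambda>x. snd x i j) \<in> borel_measurable (PiM UNIV (\<lambda>_. borel) \<Otimes>\<^sub>M M)" for i j
    by (rule measurable_compose[OF measurable_snd entry_M])
  have [measurable]: "(\<lambda>x. xi i (fst x)) \<in> borel_measurable (PiM UNIV (\<lambda>_. borel) \<Otimes>\<^sub>M M)" for i
    by (rule measurable_compose[OF measurable_fst xi_measurable])
  have "(\<lambda>x. exp (\<i> * (of_real c * snd x 0 0)) * exp (\<i> * (of_real e * quad N (xis (fst x)) (snd x))))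
      \<in> borel_measurable (PiM UNIV (\<lambda>_. borel) \<Otimes>\<^sub>M M)"
    unfolding quad_def by measurable
  then show ?thesis
    unfolding char_fun_eq phase_madd[OF d H] phase_scaled_outer phase_diag1
    by (intro borel_measurable_lebesgue_integral) (simp add: case_prod_beta)
qed

text \<open>For fixed \<open>v\<close>, a unitary taking \<open>v\<close> to a multiple of the first basis vector does not change the law
  of the Gaussian vector. A second unitary fixes the first axis and compresses the Gaussian vector to
  two coordinates, so that everything takes place in \<open>H(2)\<close>.\<close>

lemma outer_pair_char_reduce:
  assumes N: "N \<ge> 2"
  shows "(LINT \<omega>|gauss. outer_pair_char N c e v (xis \<omega>))
     = (LINT \<omega>|gauss. char_fun M (reduced (c * (\<Sum>i<N. (cmod (v i))\<^sup>2)) e (xi 0 \<omega>) (sqnorm N \<omega> - (cmod (xi 0 \<omega>))\<^sup>2)))"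
proof -
  have N0: "N > 0" using N by simp
  obtain u where u: "u \<in> U_n N" "conjugate_by u (corner N (outer v)) = diag1 (\<Sum>i<N. (cmod (v i))\<^sup>2)"
    using unitary_to_first_axis[OF N0] by blast
  have sc: "conjugate_by u (mscale e A) = mscale e (conjugate_by u A)" for e A
    unfolding mscale_def by (rule conjugate_by_scale[OF u(1)])
  define s where "s = c * (\<Sum>i<N. (cmod (v i))\<^sup>2)"
  define h where "h = (\<lambda>\<omega>. char_fun M (madd (diag1 s) (mscale (of_real e) (corner N (outer (xis \<omega>))))))"
  \<comment> \<open>Conjugation by \<open>u\<close> puts \<open>v\<close> on the first axis and
    multiplies the Gaussian vector by \<open>u\<close>, which amounts to rotating the sample point;
    \<open>gauss_integral_rotate\<close> then drops the rotation.\<close>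
  have 1: "outer_pair_char N c e v (xis \<omega>) = h (rotate_coords N u \<omega>)" for \<omega>
  proof -
    have "outer_pair_char N c e v (xis \<omega>)
        = char_fun M (conjugate_by u (madd (mscale (of_real c) (corner N (outer v))) (mscale (of_real e) (corner N (outer (xis \<omega>))))))"
      unfolding outer_pair_char_eq
      by (rule char_fun_conjugate_n[OF u(1), where m = N, symmetric])
         (intro madd_Herm_n mscale_Herm_n corner_Herm_n outer_Herm)
    also have "conjugate_by u (madd (mscale (of_real c) (corner N (outer v))) (mscale (of_real e) (corner N (outer (xis \<omega>)))))
        = madd (mscale (of_real c) (diag1 (\<Sum>i<N. (cmod (v i))\<^sup>2))) (mscale (of_real e) (corner N (outer (\<lambda>i. \<Sum>k<N. u i k * xi k \<omega>))))"
      unfolding conjugate_by_madd[OF u(1)] sc u(2) conjugate_corner_outer[OF u(1), of "xis \<omega>"] ..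
    also have "corner N (outer (\<lambda>i. \<Sum>k<N. u i k * xi k \<omega>)) = corner N (outer (xis (rotate_coords N u \<omega>)))"
      by (rule corner_outer_cong) (simp add: xi_rotate)
    also have "mscale (of_real c) (diag1 (\<Sum>i<N. (cmod (v i))\<^sup>2)) = diag1 s"
      by (intro ext) (simp add: mscale_def diag1_def s_def)
    finally show ?thesis by (simp add: h_def)
  qed
  have "(LINT \<omega>|gauss. outer_pair_char N c e v (xis \<omega>)) = (LINT \<omega>|gauss. h \<omega>)"
    unfolding 1 by (rule gauss_integral_rotate[OF u(1)]) (unfold h_def, rule diag1_char_measurable)
  also have "\<dots> = (LINT \<omega>|gauss. char_fun M (reduced s e (xi 0 \<omega>) (sqnorm N \<omega> - (cmod (xi 0 \<omega>))\<^sup>2)))"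
  proof (rule Bochner_Integration.integral_cong[OF refl])
    fix \<omega>
    obtain t where t: "t \<in> U_n N" "\<And>c e. conjugate_by t (madd (diag1 c) (mscale (of_real e) (corner N (outer (xis \<omega>)))))
      = madd (diag1 c) (mscale (of_real e) (corner 2 (outer (\<lambda>i. if i = 0 then xi 0 \<omega> else of_real (sqrt ((\<Sum>i<N. (cmod (xi i \<omega>))\<^sup>2) - (cmod (xi 0 \<omega>))\<^sup>2))))))"
      using unitary_tail_to_second_axis[OF N, of "xis \<omega>"] by blast
    have "madd (diag1 s) (mscale (of_real e) (corner N (outer (xis \<omega>)))) \<in> Herm_n N"
      using N0 by (intro madd_Herm_n mscale_Herm_n corner_Herm_n outer_Herm diag1_Herm_n)
    from char_fun_conjugate_n[OF t(1) this]
    show "h \<omega> = char_fun M (reduced s e (xi 0 \<omega>) (sqnorm N \<omega> - (cmod (xi 0 \<omega>))\<^sup>2))"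
      unfolding h_def reduced_def sqnorm_def t(2) by simp
  qed
  finally show ?thesis by (simp add: s_def)
qed

lemma norm_outer_pair_char: "norm (outer_pair_char N a b v w) \<le> 1"
  unfolding outer_pair_char_eq
  by (rule norm_char_fun_le) (intro Herm_finI[of _ N] madd_Herm_n mscale_Herm_n corner_Herm_n outer_Herm)

lemma char_fun_two:
  assumes mult: multiplicative
  shows "char_fun M (madd (diag1 a) (shiftm 1 (diag1 b))) = F1 a * F1 b"
  unfolding F1_def by (rule multiplicativeD[OF mult]) (auto intro: diag1_Herm_n)

text \<open>After scaling by \<open>4 ^ m\<close> the first-axis entry of the rank one matrix tends
  to zero, its off-diagonal entries are of order \<open>1 / 2 ^ m\<close>, and the remaining
  diagonal entry tends to \<open>b\<close>. This is the asymptotic orthogonality of the two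
  vectors.\<close>

lemma reduced_limit:
  assumes c: "c \<longlonglongrightarrow> a" and p: "p \<longlonglongrightarrow> 1" 
  shows "(\<lambda>m. char_fun M (reduced (c m) (b / 4 ^ m) z (p m * 4 ^ m - (cmod z)\<^sup>2))) \<longlonglongrightarrow> char_fun M (madd (diag1 a) (shiftm 1 (diag1 b)))"
proof (rule mat_phase_continuous[where n = 2])
  show "reduced (c m) (b / 4 ^ m) z (p m * 4 ^ m - (cmod z)\<^sup>2) \<in> Herm_n 2" for m by (rule reduced_Herm_n)
  show "madd (diag1 a) (shiftm 1 (diag1 b)) \<in> Herm_n 2"
    using shiftm_Herm_n[OF diag1_Herm_n[of 1 b], of 1] by (intro madd_Herm_n diag1_Herm_n) (auto simp: numeral_2_eq_2)
  fix i j :: nat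
  define q where "q = (\<lambda>m. 1 / 4 ^ m :: real)"
  have q: "q \<longlonglongrightarrow> 0" unfolding q_def using LIMSEQ_realpow_zero[of "1/4"] by (simp add: power_divide)
  define r where "r = (\<lambda>m. p m * 4 ^ m - (cmod z)\<^sup>2)"
  have qr: "(\<lambda>m. q m * r m) \<longlonglongrightarrow> 1"
  proof -
    have "(\<lambda>m. p m - q m * (cmod z)\<^sup>2) \<longlonglongrightarrow> 1 - 0 * (cmod z)\<^sup>2" by (intro tendsto_intros p q)
    moreover have "p m - q m * (cmod z)\<^sup>2 = q m * r m" for m by (simp add: q_def r_def field_simps)
    ultimately show ?thesis by simp
  qed
  have qsr: "(\<lambda>m. q m * sqrt (r m)) \<longlonglongrightarrow> 0"
  proof -
    have "(\<lambda>m. sqrt (q m) * sqrt (q m * r m)) \<longlonglongrightarrow> sqrt 0 * sqrt 1" by (intro tendsto_intros q qr)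
    moreover have "sqrt (q m) * sqrt (q m * r m) = q m * sqrt (r m)" for m
      by (simp add: q_def real_sqrt_divide)
    ultimately show ?thesis by simp
  qed
  \<comment> \<open>The square of \<open>sqrt (r m)\<close> is \<open>r m\<close> only when the
    latter is nonnegative, which holds for large \<open>m\<close>.\<close>
  have ev: "\<forall>\<^sub>F m in sequentially. 0 < q m * r m" using qr by (rule order_tendstoD) simp
  have qr': "(\<lambda>m. q m * (sqrt (r m) * sqrt (r m))) \<longlonglongrightarrow> 1"
  proof (rule Lim_transform_eventually[OF qr])
    show "\<forall>\<^sub>F m in sequentially. q m * r m = q m * (sqrt (r m) * sqrt (r m))"
      using ev
    proof eventually_elim
      case (elim m)
      then have "0 < r m" by (simp add: q_def zero_less_divide_iff zero_less_mult_iff)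
      then show ?case by simp
    qed
  qed
  have rm: "p m * 4 ^ m - (cmod z)\<^sup>2 = r m" for m by (simp add: r_def)
  have bq: "b / 4 ^ m = b * q m" for m by (simp add: q_def)
  have C: "(\<lambda>m. complex_of_real (c m)) \<longlonglongrightarrow> of_real a" by (intro tendsto_intros c)
  have L0: "(\<lambda>m. complex_of_real (b * q m) * (z * cnj z)) \<longlonglongrightarrow> 0"
  proof -
    have "(\<lambda>m. complex_of_real (b * q m) * (z * cnj z)) \<longlonglongrightarrow> of_real (b * 0) * (z * cnj z)" by (intro tendsto_intros q)
    then show ?thesis by simp
  qed
  have L1: "(\<lambda>m. complex_of_real (b * q m) * (y * of_real (sqrt (r m)))) \<longlonglongrightarrow> 0" for y
  proof -
    have "(\<lambda>m. complex_of_real (b * (q m * sqrt (r m))) * y) \<longlonglongrightarrow> of_real (b * 0) * y" by (intro tendsto_intros qsr)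
    then show ?thesis by (simp add: mult_ac)
  qed
  have L2: "(\<lambda>m. complex_of_real (b * q m) * (of_real (sqrt (r m)) * of_real (sqrt (r m)))) \<longlonglongrightarrow> of_real b"
  proof -
    have "(\<lambda>m. complex_of_real (b * (q m * (sqrt (r m) * sqrt (r m))))) \<longlonglongrightarrow> of_real (b * 1)" by (intro tendsto_intros qr')
    then show ?thesis by (simp add: mult.assoc del: real_sqrt_mult_self)
  qed
  have e: "reduced (c m) (b / 4 ^ m) z (p m * 4 ^ m - (cmod z)\<^sup>2) i j
      = (if i = 0 \<and> j = 0 then of_real (c m) + of_real (b * q m) * (z * cnj z)
         else if i = 0 \<and> j = 1 then of_real (b * q m) * (z * of_real (sqrt (r m)))
         else if i = 1 \<and> j = 0 then of_real (b * q m) * (cnj z * of_real (sqrt (r m)))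
         else if i = 1 \<and> j = 1 then of_real (b * q m) * (of_real (sqrt (r m)) * of_real (sqrt (r m))) else 0)" for m
    unfolding bq rm
    by (auto simp: reduced_def madd_def diag1_def mscale_def corner_def outer_def mult_ac simp del: real_sqrt_mult_self of_real_mult)
  have l: "madd (diag1 a) (shiftm 1 (diag1 b)) i j = (if i = 0 \<and> j = 0 then of_real a else if i = 1 \<and> j = 1 then of_real b else 0)"
    by (auto simp: madd_def diag1_def shiftm_def)
  have L00: "(\<lambda>m. complex_of_real (c m) + of_real (b * q m) * (z * cnj z)) \<longlonglongrightarrow> of_real a"
    using tendsto_add[OF C L0] by simp
  consider "i = 0 \<and> j = 0" | "i = 0 \<and> j = 1" | "i = 1 \<and> j = 0" | "i = 1 \<and> j = 1" | "i > 1 \<or> j > 1" by linarith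
  then show "(\<lambda>m. reduced (c m) (b / 4 ^ m) z (p m * 4 ^ m - (cmod z)\<^sup>2) i j) \<longlonglongrightarrow> madd (diag1 a) (shiftm 1 (diag1 b)) i j"
  proof cases
    case 1 then show ?thesis unfolding e l using L00 by simp
  next
    case 2 then show ?thesis unfolding e l using L1[of z] by simp
  next
    case 3 then show ?thesis unfolding e l using L1[of "cnj z"] by simp
  next
    case 4 then show ?thesis unfolding e l using L2 by (simp del: real_sqrt_mult_self of_real_mult)
  next
    case 5 then show ?thesis unfolding e l by auto
  qed
qed

text \<open>Dominated convergence twice: first in the second vector, with the first one fixed among
  those satisfying the law of large numbers, then in the first vector. The reduction to H(2) needs
  \<open>2 \<le> 4 ^ m\<close>, so it starts at \<open>m = 1\<close>.\<close>

theorem gauss_pair_limit: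
  assumes mult: multiplicative
  shows "(\<lambda>m. LINT \<omega>|gauss. LINT \<omega>'|gauss. outer_pair_char (4 ^ m) (a / 4 ^ m) (b / 4 ^ m) (xis \<omega>) (xis \<omega>')) \<longlonglongrightarrow> F1 a * F1 b"
proof -
  interpret G: prob_space gauss by (rule prob_space_gauss)
  have mQ: "(\<lambda>x. exp (\<i> * (of_real c * quad N (xis (fst (fst x))) (snd x))) * exp (\<i> * (of_real e * quad N (xis (snd (fst x))) (snd x))))
      \<in> borel_measurable ((gauss \<Otimes>\<^sub>M gauss) \<Otimes>\<^sub>M M)" for c e :: real and N
  proof -
    have [measurable]: "(\<lambda>x. snd x i j) \<in> borel_measurable ((gauss \<Otimes>\<^sub>M gauss) \<Otimes>\<^sub>M M)" for i j
      by (rule measurable_compose[OF measurable_snd entry_M])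
    show ?thesis unfolding quad_def by measurable
  qed
  have mP: "(\<lambda>x. outer_pair_char N c e (xis (fst x)) (xis (snd x))) \<in> borel_measurable (gauss \<Otimes>\<^sub>M gauss)" for N c e
    unfolding outer_pair_char_def using mQ[of c N e]
    by (intro borel_measurable_lebesgue_integral) (simp add: case_prod_beta)
  have mP2: "(\<lambda>\<omega>'. outer_pair_char N c e v (xis \<omega>')) \<in> borel_measurable gauss" for N c e v
  proof -
    have "(\<lambda>x. exp (\<i> * (of_real c * quad N v (snd x))) * exp (\<i> * (of_real e * quad N (xis (fst x)) (snd x))))
      \<in> borel_measurable (gauss \<Otimes>\<^sub>M M)"
    proof -
      have [measurable]: "(\<lambda>x. snd x i j) \<in> borel_measurable (gauss \<Otimes>\<^sub>M M)" for i j
        by (rule measurable_compose[OF measurable_snd entry_M])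
      show ?thesis unfolding quad_def by measurable
    qed
    then show ?thesis unfolding outer_pair_char_def
      by (intro borel_measurable_lebesgue_integral) (simp add: case_prod_beta)
  qed
  have m1: "(\<lambda>\<omega>. LINT \<omega>'|gauss. outer_pair_char N c e (xis \<omega>) (xis \<omega>')) \<in> borel_measurable gauss" for N c e
    using mP[of N c e] by (intro G.borel_measurable_lebesgue_integral) (simp add: case_prod_beta)
  have n1: "norm (LINT \<omega>'|gauss. outer_pair_char N c e v (xis \<omega>')) \<le> 1" for N c e v
  proof -
    have "norm (LINT \<omega>'|gauss. outer_pair_char N c e v (xis \<omega>')) \<le> (LINT \<omega>'|gauss. norm (outer_pair_char N c e v (xis \<omega>')))"
      by (rule integral_norm_bound)
    also have "\<dots> \<le> (LINT \<omega>'|gauss. 1)"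
      using mP2[of N c e v] by (intro integral_mono G.integrable_const_bound[of _ 1]) (auto simp: norm_outer_pair_char)
    finally show ?thesis by (simp add: G.prob_space[unfolded space_gauss])
  qed
  define L where "L = char_fun M (madd (diag1 a) (shiftm 1 (diag1 b)))"
  define p where "p = (\<lambda>m \<omega>. sqnorm (4 ^ m) \<omega> / 4 ^ m)"
  have LLN: "AE \<omega> in gauss. (\<lambda>m. p m \<omega>) \<longlonglongrightarrow> 1"
    unfolding p_def sqnorm_def by (rule gauss_norm_LLN)
  have mR: "(\<lambda>\<omega>'. char_fun M (reduced c e (xi 0 \<omega>') (sqnorm N \<omega>' - (cmod (xi 0 \<omega>'))\<^sup>2))) \<in> borel_measurable gauss" for c e N
  proof -
    have [measurable]: "(\<lambda>x. snd x i j) \<in> borel_measurable (gauss \<Otimes>\<^sub>M M)" for i j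
      by (rule measurable_compose[OF measurable_snd entry_M])
    have "(\<lambda>x. exp (\<i> * (\<Sum>i<2. \<Sum>k<2. reduced c e (xi 0 (fst x)) (sqnorm N (fst x) - (cmod (xi 0 (fst x)))\<^sup>2) i k * snd x k i)))
        \<in> borel_measurable (gauss \<Otimes>\<^sub>M M)"
      unfolding reduced_def madd_def mscale_def corner_def outer_def diag1_def sqnorm_def by measurable
    then show ?thesis unfolding char_fun_def trace_eq_sum[OF reduced_Herm_n]
      by (intro borel_measurable_lebesgue_integral) (simp add: case_prod_beta)
  qed
  have inner: "(\<lambda>m. LINT \<omega>'|gauss. outer_pair_char (4 ^ m) (a / 4 ^ m) (b / 4 ^ m) (xis \<omega>) (xis \<omega>')) \<longlonglongrightarrow> L"
    if c: "(\<lambda>m. p m \<omega>) \<longlonglongrightarrow> 1" for \<omega>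
  proof -
    have "(\<lambda>m. LINT \<omega>'|gauss. char_fun M (reduced (a * p m \<omega>) (b / 4 ^ m) (xi 0 \<omega>') (sqnorm (4 ^ m) \<omega>' - (cmod (xi 0 \<omega>'))\<^sup>2)))
        \<longlonglongrightarrow> (LINT \<omega>'|gauss. L)"
    proof (rule integral_dominated_convergence[where w = "\<lambda>_. 1"])
      have ca: "(\<lambda>m. a * p m \<omega>) \<longlonglongrightarrow> a" using tendsto_mult_left[OF c, of a] by simp
      show "AE \<omega>' in gauss. (\<lambda>m. char_fun M (reduced (a * p m \<omega>) (b / 4 ^ m) (xi 0 \<omega>') (sqnorm (4 ^ m) \<omega>' - (cmod (xi 0 \<omega>'))\<^sup>2))) \<longlonglongrightarrow> L"
        using LLN
      proof eventually_elim
        case (elim \<omega>')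
        have "sqnorm (4 ^ m) \<omega>' = p m \<omega>' * 4 ^ m" for m by (simp add: p_def)
        then show ?case unfolding L_def using reduced_limit[OF ca elim, of b "xi 0 \<omega>'"] by simp
      qed
    qed (auto simp: mR norm_char_fun_le[OF Herm_finI[OF reduced_Herm_n]])
    moreover have "\<forall>\<^sub>F m in sequentially. (LINT \<omega>'|gauss. char_fun M (reduced (a * p m \<omega>) (b / 4 ^ m) (xi 0 \<omega>') (sqnorm (4 ^ m) \<omega>' - (cmod (xi 0 \<omega>'))\<^sup>2)))
        = (LINT \<omega>'|gauss. outer_pair_char (4 ^ m) (a / 4 ^ m) (b / 4 ^ m) (xis \<omega>) (xis \<omega>'))"
    proof (rule eventually_sequentiallyI[of 1])
      fix m :: nat assume "1 \<le> m"
      then have "(4 :: nat) ^ 1 \<le> 4 ^ m" by (intro power_increasing) auto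
      then have "(2 :: nat) \<le> 4 ^ m" by simp
      from outer_pair_char_reduce[OF this]
      show "(LINT \<omega>'|gauss. char_fun M (reduced (a * p m \<omega>) (b / 4 ^ m) (xi 0 \<omega>') (sqnorm (4 ^ m) \<omega>' - (cmod (xi 0 \<omega>'))\<^sup>2)))
        = (LINT \<omega>'|gauss. outer_pair_char (4 ^ m) (a / 4 ^ m) (b / 4 ^ m) (xis \<omega>) (xis \<omega>'))"
        by (simp add: p_def sqnorm_def)
    qed
    ultimately have "(\<lambda>m. LINT \<omega>'|gauss. outer_pair_char (4 ^ m) (a / 4 ^ m) (b / 4 ^ m) (xis \<omega>) (xis \<omega>')) \<longlonglongrightarrow> (LINT \<omega>'|gauss. L)"
      by (rule Lim_transform_eventually)
    then show ?thesis by (simp add: G.prob_space[unfolded space_gauss])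
  qed
  have "(\<lambda>m. LINT \<omega>|gauss. LINT \<omega>'|gauss. outer_pair_char (4 ^ m) (a / 4 ^ m) (b / 4 ^ m) (xis \<omega>) (xis \<omega>')) \<longlonglongrightarrow> (LINT \<omega>|gauss. L)"
  proof (rule integral_dominated_convergence[where w = "\<lambda>_. 1"])
    show "AE \<omega> in gauss. (\<lambda>m. LINT \<omega>'|gauss. outer_pair_char (4 ^ m) (a / 4 ^ m) (b / 4 ^ m) (xis \<omega>) (xis \<omega>')) \<longlonglongrightarrow> L"
      using LLN by eventually_elim (rule inner)
  qed (auto simp: m1 n1)
  then show ?thesis unfolding L_def char_fun_two[OF mult] by (simp add: G.prob_space[unfolded space_gauss])
qed

end

section \<open>The Gaussian transform of a corner and its concentration\<close>

context invariant_measure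
begin

definition G :: "nat \<Rightarrow> real \<Rightarrow> cmat \<Rightarrow> complex" where
  "G N a B = (LINT \<omega>|gauss. exp (\<i> * (of_real a * quad N (xis \<omega>) B)))"

text \<open>The numbers \<open>d\<close> are the eigenvalues of the corner and are chosen before
  \<open>a\<close>; the limit theorem needs the same array for every \<open>a\<close>.\<close>

lemma G_eq_prod:
  assumes B: "B \<in> Herm"
  shows "\<exists>d :: nat \<Rightarrow> real. \<forall>a. G N a B = (\<Prod>k<N. 1 / (1 - \<i> * of_real (a * d k)))"
proof -
  obtain u d where u: "u \<in> U_n N" and d: "\<And>k. N \<le> k \<Longrightarrow> d k = (0 :: real)"
    and c: "corner N B = conjugate_by u (diagm (\<lambda>k. of_real (d k)))"
    using Herm_n_diagonalise[OF corner_Herm_n[OF B, of N]] by blast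
  have "G N a B = (\<Prod>k<N. 1 / (1 - \<i> * of_real (a * d k)))" for a
  proof -
    have s: "mscale (of_real a) (corner N B) = conjugate_by u (diagm (\<lambda>k. of_real (a * d k)))"
      unfolding c conjd_mscale[OF u] by simp
    have "mtrace (mmul (mscale (of_real a) (corner N B)) (outer v)) = of_real a * quad N v B" for v
    proof -
      have "mtrace (mmul (mscale (of_real a) (corner N B)) (outer v)) = of_real a * mtrace (mmul (corner N B) (outer v))"
        unfolding trace_eq_sum[OF mscale_Herm_n[OF corner_Herm_n[OF B]]] trace_eq_sum[OF corner_Herm_n[OF B]]
        by (simp add: mscale_def sum_distrib_left mult.assoc)
      then show ?thesis by (simp add: trace_corner_outer[OF B])
    qed
    then show ?thesis unfolding G_def
      using gauss_quadratic_char[OF u _ s] d by simp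
  qed
  then show ?thesis by blast
qed

lemma phase_pair_measurable:
  "(\<lambda>x. exp (\<i> * (of_real a * quad N (xis (snd x)) (fst x)))) \<in> borel_measurable (M \<Otimes>\<^sub>M gauss)"
  by measurable

lemma sigma_finite_gauss: "sigma_finite_measure gauss"
  by (rule prob_space_imp_sigma_finite[OF prob_space_gauss])

lemma G_M [measurable]: "G N a \<in> borel_measurable M"
  unfolding G_def[abs_def] using phase_pair_measurable[of a N]
  by (intro sigma_finite_measure.borel_measurable_lebesgue_integral[OF sigma_finite_gauss]) (simp add: case_prod_beta)

lemma norm_G: "B \<in> Herm \<Longrightarrow> norm (G N a B) \<le> 1"
proof -
  interpret G: prob_space gauss by (rule prob_space_gauss)
  assume B: "B \<in> Herm"
  have "norm (G N a B) \<le> (LINT \<omega>|gauss. norm (exp (\<i> * (of_real a * quad N (xis \<omega>) B))))"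
    unfolding G_def by (rule integral_norm_bound)
  then show ?thesis by (simp only: norm_phase_quad[OF B]) (simp add: G.prob_space[unfolded space_gauss])
qed

lemma cnj_G: "B \<in> Herm \<Longrightarrow> cnj (G N a B) = G N (- a) B"
proof -
  assume B: "B \<in> Herm"
  have "cnj (exp (\<i> * (of_real a * quad N v B))) = exp (\<i> * (of_real (- a) * quad N v B))" for v
  proof -
    have "cnj (quad N v B) = quad N v B"
    proof -
      have "cnj (quad N v B) = (\<Sum>i<N. \<Sum>k<N. v k * cnj (v i) * B i k)"
        unfolding quad_def using Herm_cnj[OF B] by (simp add: mult_ac)
      then show ?thesis unfolding quad_def by (subst (asm) sum.swap)
    qed
    then show ?thesis by (simp add: exp_cnj)
  qed
  then show ?thesis unfolding G_def by (simp flip: Bochner_Integration.integral_cnj)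
qed

lemma integrable_MG_bounded:
  fixes f :: "cmat \<times> (nat \<times> nat \<Rightarrow> real) \<Rightarrow> complex"
  assumes "f \<in> borel_measurable (M \<Otimes>\<^sub>M gauss)" "\<And>B \<omega>. B \<in> Herm \<Longrightarrow> norm (f (B, \<omega>)) \<le> 1"
  shows "integrable (M \<Otimes>\<^sub>M gauss) f"
proof -
  interpret pair_prob_space M gauss
    by (intro pair_prob_space.intro pair_sigma_finite.intro prob_space_imp_sigma_finite prob_space_axioms prob_space_gauss)
  show ?thesis
    by (rule P.integrable_const_bound[of _ 1]) (use assms in \<open>auto simp: space_pair_measure space_M\<close>)
qed

text \<open>A product of two Gaussian averages is an average over two independent Gaussian vectors;
  exchanging them with the integral over \<open>B\<close> produces the characteristic function at a
  matrix of rank at most two.\<close>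

lemma integral_G_product:
  "(LINT B|M. G N a B * G N b B)
     = (LINT \<omega>|gauss. LINT \<omega>'|gauss. outer_pair_char N a b (xis \<omega>) (xis \<omega>'))"
proof -
  interpret pair_sigma_finite M gauss by (rule pair_MG)
  define e where "e = (\<lambda>a B \<omega>. exp (\<i> * (complex_of_real a * quad N (xis \<omega>) B)))"
  have em: "(\<lambda>x. e a (fst x) (snd x)) \<in> borel_measurable (M \<Otimes>\<^sub>M gauss)" for a
    unfolding e_def by (rule phase_pair_measurable)
  have eM: "e a B \<in> borel_measurable gauss" for a B unfolding e_def[abs_def] by measurable
  have eM2: "(\<lambda>B. e a B \<omega>) \<in> borel_measurable M" for a \<omega> unfolding e_def by measurable
  have e1: "B \<in> Herm \<Longrightarrow> norm (e a B \<omega>) = 1" for a B \<omega> unfolding e_def by (rule norm_phase_quad)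
  have "(LINT B|M. G N a B * G N b B) = (LINT B|M. LINT \<omega>|gauss. e a B \<omega> * G N b B)"
    by (simp add: G_def[of N a] e_def)
  also have "\<dots> = (LINT \<omega>|gauss. LINT B|M. e a B \<omega> * G N b B)"
  proof (rule Fubini_integral[symmetric], rule integrable_MG_bounded)
    have "(\<lambda>x. G N b (fst x)) \<in> borel_measurable (M \<Otimes>\<^sub>M gauss)" by (rule measurable_compose[OF measurable_fst G_M])
    then show "(\<lambda>(B, \<omega>). e a B \<omega> * G N b B) \<in> borel_measurable (M \<Otimes>\<^sub>M gauss)"
      using em[of a] by (simp add: case_prod_beta)
    show "norm (case (B, \<omega>) of (B, \<omega>) \<Rightarrow> e a B \<omega> * G N b B) \<le> 1" if "B \<in> Herm" for B \<omega>
      using e1[OF that] norm_G[OF that] by (simp add: norm_mult)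
  qed
  also have "\<dots> = (LINT \<omega>|gauss. LINT \<omega>'|gauss. outer_pair_char N a b (xis \<omega>) (xis \<omega>'))"
  proof (rule Bochner_Integration.integral_cong[OF refl])
    fix \<omega>
    have "(LINT B|M. e a B \<omega> * G N b B) = (LINT B|M. LINT \<omega>'|gauss. e a B \<omega> * e b B \<omega>')"
      by (simp add: G_def[of N b] e_def)
    also have "\<dots> = (LINT \<omega>'|gauss. LINT B|M. e a B \<omega> * e b B \<omega>')"
    proof (rule Fubini_integral[symmetric], rule integrable_MG_bounded)
      have "(\<lambda>x. e a (fst x) \<omega>) \<in> borel_measurable (M \<Otimes>\<^sub>M gauss)" by (rule measurable_compose[OF measurable_fst eM2])
      then show "(\<lambda>(B, \<omega>'). e a B \<omega> * e b B \<omega>') \<in> borel_measurable (M \<Otimes>\<^sub>M gauss)"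
        using em[of b] by (simp add: case_prod_beta)
      show "norm (case (B, \<omega>') of (B, \<omega>') \<Rightarrow> e a B \<omega> * e b B \<omega>') \<le> 1" if "B \<in> Herm" for B \<omega>'
        using e1[OF that] by (simp add: norm_mult)
    qed
    finally show "(LINT B|M. e a B \<omega> * G N b B) = (LINT \<omega>'|gauss. outer_pair_char N a b (xis \<omega>) (xis \<omega>'))"
      by (simp add: outer_pair_char_def e_def)
  qed
  finally show ?thesis .
qed

lemma G_zero: "G N 0 B = 1"
proof -
  interpret G: prob_space gauss by (rule prob_space_gauss)
  show ?thesis by (simp add: G_def G.prob_space[unfolded space_gauss])
qed

text \<open>Conjugating \<open>G\<close> changes the sign of \<open>a\<close>. So
  \<open>gauss_pair_limit\<close> with \<open>b = - a\<close> is the second moment and with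
  \<open>b = 0\<close> the mean, and the limits cancel in the variance.\<close>

theorem G_L2_limit:
  assumes mult: multiplicative
  shows "(\<lambda>m. LINT B|M. (norm (G (4 ^ m) (a / 4 ^ m) B - F1 a))\<^sup>2) \<longlonglongrightarrow> 0"
proof -
  define g where "g = (\<lambda>m B. G (4 ^ m) (a / 4 ^ m) B)"
  define g' where "g' = (\<lambda>m B. G (4 ^ m) ((- a) / 4 ^ m) B)"
  note lim = gauss_pair_limit[OF mult, folded integral_G_product]
  have 1: "(\<lambda>m. LINT B|M. g m B * g' m B) \<longlonglongrightarrow> F1 a * cnj (F1 a)"
    using lim[of a "- a"] by (simp add: g_def g'_def F1_uminus)
  have 2: "(\<lambda>m. LINT B|M. g m B) \<longlonglongrightarrow> F1 a"
    using lim[of a 0] by (simp add: g_def G_zero)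
  have 3: "(\<lambda>m. LINT B|M. g' m B) \<longlonglongrightarrow> cnj (F1 a)"
    using lim[of "- a" 0] by (simp add: g'_def G_zero F1_uminus)
  have gi: "integrable M (g m)" "integrable M (g' m)" "integrable M (\<lambda>B. g m B * g' m B)" for m
    using norm_G unfolding g_def g'_def
    by (auto intro!: integrable_const_bound[of _ 1] simp: space_M norm_mult mult_le_one)
  have "complex_of_real (LINT B|M. (norm (g m B - F1 a))\<^sup>2)
      = (LINT B|M. g m B * g' m B) - (cnj (F1 a) * (LINT B|M. g m B) + F1 a * (LINT B|M. g' m B)) + F1 a * cnj (F1 a)" for m
  proof -
    have "complex_of_real (LINT B|M. (norm (g m B - F1 a))\<^sup>2) = (LINT B|M. complex_of_real ((norm (g m B - F1 a))\<^sup>2))"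
      by (rule integral_complex_of_real[symmetric])
    also have "\<dots> = (LINT B|M. g m B * g' m B - (cnj (F1 a) * g m B + F1 a * g' m B) + F1 a * cnj (F1 a))"
    proof (rule Bochner_Integration.integral_cong[OF refl])
      fix B assume "B \<in> space M"
      then have "g' m B = cnj (g m B)" unfolding g_def g'_def by (subst cnj_G) (auto simp: space_M)
      then show "complex_of_real ((norm (g m B - F1 a))\<^sup>2) = g m B * g' m B - (cnj (F1 a) * g m B + F1 a * g' m B) + F1 a * cnj (F1 a)"
        by (simp add: complex_norm_square algebra_simps del: of_real_power)
    qed
    also have "\<dots> = (LINT B|M. g m B * g' m B) - (cnj (F1 a) * (LINT B|M. g m B) + F1 a * (LINT B|M. g' m B)) + F1 a * cnj (F1 a)"
      using gi by (simp add: prob_space)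
    finally show ?thesis .
  qed
  moreover have "(\<lambda>m. (LINT B|M. g m B * g' m B) - (cnj (F1 a) * (LINT B|M. g m B) + F1 a * (LINT B|M. g' m B)) + F1 a * cnj (F1 a))
      \<longlonglongrightarrow> F1 a * cnj (F1 a) - (cnj (F1 a) * F1 a + F1 a * cnj (F1 a)) + F1 a * cnj (F1 a)"
    by (intro tendsto_intros 1 2 3)
  ultimately have "(\<lambda>m. complex_of_real (LINT B|M. (norm (g m B - F1 a))\<^sup>2)) \<longlonglongrightarrow> of_real 0"
    by simp
  then show ?thesis unfolding tendsto_of_real_iff g_def .
qed

text \<open>For each \<open>k\<close> the mean square errors at the first \<open>k + 1\<close>
  rationals are added up. The mean of the sum is below \<open>1 / Suc k\<close> for some
  \<open>m\<close>, so one Hermitian matrix is good at all these points, and its corner eigenvalues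
  feed the limit theorem.\<close>

theorem multiplicative_imp_F_param:
  assumes mult: multiplicative
  shows "\<exists>\<gamma>1 \<gamma>2 x. \<gamma>2 \<ge> 0 \<and> summable (\<lambda>k. (x k)\<^sup>2) \<and> F1 = F_param \<gamma>1 \<gamma>2 x"
proof -
  define q :: "nat \<Rightarrow> real" where "q = (\<lambda>j. of_rat (from_nat j))"
  define ok where "ok = (\<lambda>k m B. B \<in> Herm \<and> (\<forall>j\<le>k. (norm (G (4 ^ m) (q j / 4 ^ m) B - F1 (q j)))\<^sup>2 < 1 / Suc k))"
  have "\<exists>m B. B \<in> Herm \<and> (\<forall>j\<le>k. (norm (G (4 ^ m) (q j / 4 ^ m) B - F1 (q j)))\<^sup>2 < 1 / Suc k)" for k
  proof -
    define S where "S = (\<lambda>m B. \<Sum>j\<le>k. (norm (G (4 ^ m) (q j / 4 ^ m) B - F1 (q j)))\<^sup>2)"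
    have i: "integrable M (\<lambda>B. (norm (G (4 ^ m) (q j / 4 ^ m) B - F1 (q j)))\<^sup>2)" for m j
    proof (rule integrable_const_bound[of _ "2\<^sup>2"])
      show "AE B in M. norm ((norm (G (4 ^ m) (q j / 4 ^ m) B - F1 (q j)))\<^sup>2) \<le> 2\<^sup>2"
        using AE_Herm
      proof eventually_elim
        case (elim B)
        have "norm (F1 (q j)) \<le> 1" unfolding F1_def by (rule norm_char_fun_le[OF Herm_finI[OF diag1_Herm_n[OF lessI]]])
        then have "norm (G (4 ^ m) (q j / 4 ^ m) B - F1 (q j)) \<le> 2"
          using norm_triangle_ineq4[of "G (4 ^ m) (q j / 4 ^ m) B" "F1 (q j)"] norm_G[OF elim, of "4 ^ m" "q j / 4 ^ m"] by linarith
        then have "(norm (G (4 ^ m) (q j / 4 ^ m) B - F1 (q j)))\<^sup>2 \<le> 2\<^sup>2" by (intro power_mono) auto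
        then show ?case by simp
      qed
    qed measurable
    have "(\<lambda>m. LINT B|M. S m B) \<longlonglongrightarrow> (\<Sum>j\<le>k. 0)"
      unfolding S_def by (subst Bochner_Integration.integral_sum[OF i]) (intro tendsto_sum G_L2_limit[OF mult])
    then have "\<forall>\<^sub>F m in sequentially. (LINT B|M. S m B) < 1 / Suc k"
      by (rule order_tendstoD) simp
    then obtain m where m: "(LINT B|M. S m B) < 1 / Suc k" by (auto simp: eventually_sequentially)
    have "\<exists>B\<in>Herm. S m B < 1 / Suc k"
    proof (rule ccontr)
      assume "\<not> (\<exists>B\<in>Herm. S m B < 1 / Suc k)"
      then have "1 / Suc k \<le> S m B" if "B \<in> Herm" for B using that by (auto simp: not_less)
      then have "AE B in M. 1 / Suc k \<le> S m B" by (intro AE_I2) (simp add: space_M)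
      moreover have "integrable M (S m)" unfolding S_def by (intro Bochner_Integration.integrable_sum i)
      ultimately have "(LINT B|M. 1 / Suc k) \<le> (LINT B|M. S m B)" by (intro integral_mono_AE) auto
      then show False using m by (simp add: prob_space)
    qed
    then obtain B where B: "B \<in> Herm" "S m B < 1 / Suc k" by blast
    have "(norm (G (4 ^ m) (q j / 4 ^ m) B - F1 (q j)))\<^sup>2 < 1 / Suc k" if "j \<le> k" for j
    proof -
      have "(norm (G (4 ^ m) (q j / 4 ^ m) B - F1 (q j)))\<^sup>2 \<le> S m B"
        unfolding S_def by (rule member_le_sum) (use that in auto)
      then show ?thesis using B(2) by simp
    qed
    then show ?thesis using B(1) by blast
  qed
  then have ex: "\<exists>m B. ok k m B" for k by (simp add: ok_def)
  then obtain m B where mB: "\<And>k. ok k (m k) (B k)" by metis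
  have B: "B k \<in> Herm" for k using mB[of k] by (simp add: ok_def)
  have small: "(norm (G (4 ^ m k) (q j / 4 ^ m k) (B k) - F1 (q j)))\<^sup>2 < 1 / Suc k" if "j \<le> k" for j k
    using mB[of k] that by (simp add: ok_def)
  have "\<forall>k. \<exists>d :: nat \<Rightarrow> real. \<forall>a. G (4 ^ m k) a (B k) = (\<Prod>j<(4::nat) ^ m k. 1 / (1 - \<i> * of_real (a * d j)))"
    using G_eq_prod[OF B] by blast
  from choice[OF this] obtain d where d: "\<And>k a. G (4 ^ m k) a (B k) = (\<Prod>j<(4::nat) ^ m k. 1 / (1 - \<i> * of_real (a * d k j)))"
    by blast
  \<comment> \<open>The factor \<open>1 / 4 ^ m\<close> in the argument of \<open>G\<close> is moved
    into the eigenvalues.\<close>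
  define lam where "lam = (\<lambda>k j. d k j / 4 ^ m k)"
  show ?thesis
  proof (rule limit_of_exponential_products[OF continuous_F1 F1_0])
    fix a :: real assume "a \<in> \<rat>"
    then obtain r where "a = of_rat r" by (auto elim: Rats_cases)
    then obtain j where j: "a = q j" unfolding q_def by (metis from_nat_to_nat)
    have "(\<lambda>k. (norm (G (4 ^ m k) (a / 4 ^ m k) (B k) - F1 a))\<^sup>2) \<longlonglongrightarrow> 0"
    proof (rule tendsto_sandwich[OF _ _ tendsto_const])
      show "\<forall>\<^sub>F k in sequentially. (norm (G (4 ^ m k) (a / 4 ^ m k) (B k) - F1 a))\<^sup>2 \<le> 1 / Suc k"
        using small unfolding j by (intro eventually_sequentiallyI[of j]) (auto intro: less_imp_le)
      show "(\<lambda>k. 1 / real (Suc k)) \<longlonglongrightarrow> 0" using LIMSEQ_inverse_real_of_nat by (simp add: inverse_eq_divide)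
    qed auto
    then have "(\<lambda>k. sqrt ((norm (G (4 ^ m k) (a / 4 ^ m k) (B k) - F1 a))\<^sup>2)) \<longlonglongrightarrow> sqrt 0"
      by (rule tendsto_real_sqrt)
    then have "(\<lambda>k. norm (G (4 ^ m k) (a / 4 ^ m k) (B k) - F1 a)) \<longlonglongrightarrow> 0" by simp
    then have "(\<lambda>k. G (4 ^ m k) (a / 4 ^ m k) (B k) - F1 a) \<longlonglongrightarrow> 0" by (rule tendsto_norm_zero_cancel)
    then have "(\<lambda>k. G (4 ^ m k) (a / 4 ^ m k) (B k)) \<longlonglongrightarrow> F1 a" by (simp add: LIM_zero_iff)
    then show "(\<lambda>k. \<Prod>j<4 ^ m k. 1 / (1 - \<i> * of_real (a * lam k j))) \<longlonglongrightarrow> F1 a"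
      by (simp add: d lam_def)
  qed
qed

lemma char_fun_diagm:
  assumes mult: multiplicative
  shows "char_fun M (diagm (\<lambda>k. if k < n then of_real (d k) else 0)) = (\<Prod>k<n. F1 (d k))"
proof (induction n)
  case 0
  have "diagm (\<lambda>k. if k < 0 then of_real (d k) else 0) = diag1 0" by (intro ext) (simp add: diagm_def diag1_def)
  then show ?case using F1_0 by (simp add: F1_def)
next
  case (Suc n)
  let ?D = "\<lambda>n. diagm (\<lambda>k. if k < n then of_real (d k) else 0)"
  show ?case
  proof (cases "n = 0")
    case True
    have "?D (Suc n) = diag1 (d 0)" using True by (intro ext) (simp add: diagm_def diag1_def)
    then show ?thesis using True by (simp add: F1_def)
  next
    case False
    have "?D n \<in> Herm_n n" by (auto simp: Herm_n_def diagm_def intro!: HermI)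
    moreover have "?D (Suc n) = madd (?D n) (shiftm n (diag1 (d n)))"
      by (intro ext) (auto simp: diagm_def madd_def shiftm_def diag1_def less_Suc_eq)
    ultimately show ?thesis using False Suc.IH multiplicativeD[OF mult, of n "?D n" "diag1 (d n)"] diag1_Herm_n[of n]
      by (simp add: F1_def)
  qed
qed

lemma char_fun_spectral:
  assumes mult: multiplicative
    and u: "u \<in> U_n n" and d: "\<And>k. n \<le> k \<Longrightarrow> d k = (0 :: real)"
  shows "char_fun M (conjugate_by u (diagm (\<lambda>k. of_real (d k)))) = (\<Prod>k<n. F1 (d k))"
proof -
  have e: "diagm (\<lambda>k. of_real (d k)) = diagm (\<lambda>k. if k < n then of_real (d k) else 0)"
    using d by (intro ext) (auto simp: diagm_def)
  have "diagm (\<lambda>k. of_real (d k)) \<in> Herm_n n" using d by (auto simp: Herm_n_def diagm_def intro!: HermI)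
  then show ?thesis using char_fun_conjugate_n[OF u] char_fun_diagm[OF mult] by (simp add: e)
qed

end

section \<open>Construction of the measures\<close>

definition Omega :: "(nat \<Rightarrow> nat \<times> nat \<Rightarrow> real) measure" where
  "Omega = PiM UNIV (\<lambda>_. gauss)"

lemma product_prob_space_gauss: "product_prob_space (\<lambda>_. gauss)"
  by (auto simp: product_prob_space_def product_sigma_finite_def product_prob_space_axioms_def
      prob_space_gauss prob_space_imp_sigma_finite)

lemma prob_space_Omega: "prob_space Omega"
  unfolding Omega_def by (rule prob_space_PiM) (rule prob_space_gauss)

lemma Omega_integral_prod:
  fixes f :: "nat \<Rightarrow> (nat \<times> nat \<Rightarrow> real) \<Rightarrow> 'b :: {real_normed_field, banach, second_countable_topology}"
  assumes "finite J" "\<And>k. k \<in> J \<Longrightarrow> integrable gauss (f k)"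
  shows "integrable Omega (\<lambda>\<omega>. \<Prod>k\<in>J. f k (\<omega> k))"
    "(LINT \<omega>|Omega. (\<Prod>k\<in>J. f k (\<omega> k))) = (\<Prod>k\<in>J. integral\<^sup>L gauss (f k))"
  using product_prob_space.integral_prod_coordinates[OF product_prob_space_gauss, of J UNIV f] assms
  unfolding Omega_def by auto

lemma Omega_component_measurable: "(\<lambda>\<omega>. \<omega> k) \<in> measurable Omega gauss"
  unfolding Omega_def by measurable

lemma outer_coord_measurable: "outer_coord p \<in> borel_measurable gauss"
  using outer_coord_moments(1) by (rule borel_measurable_integrable)

text \<open>Coordinate \<open>p\<close> of a partial sum of the random matrix. Component 0 of the
  sample supplies the Gaussian Hermitian matrix and component \<open>Suc k\<close> the
  \<open>k\<close>-th Gaussian vector.\<close>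

definition approx :: "real \<Rightarrow> real \<Rightarrow> (nat \<Rightarrow> real) \<Rightarrow> nat \<Rightarrow> nat \<times> nat \<Rightarrow> (nat \<Rightarrow> nat \<times> nat \<Rightarrow> real) \<Rightarrow> real" where
  "approx \<gamma>1 \<gamma>2 x K p \<omega> = \<gamma>1 * hcoord mone p + sqrt \<gamma>2 * \<omega> 0 p + (\<Sum>k<K. x k * outer_coord p (\<omega> (Suc k)))"

lemma approx_measurable [measurable]: "approx \<gamma>1 \<gamma>2 x K p \<in> borel_measurable Omega"
proof -
  have [measurable]: "(\<lambda>\<omega>. \<omega> 0 p) \<in> borel_measurable Omega"
    by (rule measurable_compose[OF Omega_component_measurable gauss_coord_measurable])
  have [measurable]: "(\<lambda>\<omega>. outer_coord p (\<omega> (Suc k))) \<in> borel_measurable Omega" for k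
    by (rule measurable_compose[OF Omega_component_measurable outer_coord_measurable])
  show ?thesis unfolding approx_def[abs_def] by measurable
qed

lemma outer_coord_orthogonal:
  "integrable Omega (\<lambda>\<omega>. outer_coord p (\<omega> (Suc k)) * outer_coord p (\<omega> (Suc l)))"
  "(LINT \<omega>|Omega. outer_coord p (\<omega> (Suc k)) * outer_coord p (\<omega> (Suc l)))
     = (if k = l then LINT \<omega>|gauss. (outer_coord p \<omega>)\<^sup>2 else 0)"
proof -
  have "integrable Omega (\<lambda>\<omega>. outer_coord p (\<omega> (Suc k)) * outer_coord p (\<omega> (Suc l))) \<and>
    (LINT \<omega>|Omega. outer_coord p (\<omega> (Suc k)) * outer_coord p (\<omega> (Suc l)))
     = (if k = l then LINT \<omega>|gauss. (outer_coord p \<omega>)\<^sup>2 else 0)"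
  proof (cases "k = l")
    case True
    then show ?thesis
      using Omega_integral_prod[of "{Suc k}" "\<lambda>_ \<omega>. (outer_coord p \<omega>)\<^sup>2"] outer_coord_moments(3)
      by (simp add: power2_eq_square)
  next
    case False
    then show ?thesis
      using Omega_integral_prod[of "{Suc k, Suc l}" "\<lambda>_. outer_coord p"] outer_coord_moments(1,2)
      by simp
  qed
  then show "integrable Omega (\<lambda>\<omega>. outer_coord p (\<omega> (Suc k)) * outer_coord p (\<omega> (Suc l)))"
    "(LINT \<omega>|Omega. outer_coord p (\<omega> (Suc k)) * outer_coord p (\<omega> (Suc l)))
     = (if k = l then LINT \<omega>|gauss. (outer_coord p \<omega>)\<^sup>2 else 0)" by blast+
qed

text \<open>The terms of the series are orthogonal with mean squares proportional to the squares of
  \<open>x k\<close>. The subsequence \<open>K\<close> groups them into increments with geometric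
  mean squares.\<close>

lemma approx_converges:
  assumes K: "mono K" "\<And>m. (\<Sum>k=K m..<K (Suc m). (x k)\<^sup>2) \<le> (1 / 4) ^ m"
  shows "AE \<omega> in Omega. \<forall>p. convergent (\<lambda>m. approx \<gamma>1 \<gamma>2 x (K m) p \<omega>)"
  unfolding AE_all_countable
proof
  fix p
  interpret O: prob_space Omega by (rule prob_space_Omega)
  define c where "c = (LINT \<omega>|gauss. (outer_coord p \<omega>)\<^sup>2)"
  have c0: "0 \<le> c" by (simp add: c_def)
  define D where "D = (\<lambda>m \<omega>. \<Sum>k=K m..<K (Suc m). x k * outer_coord p (\<omega> (Suc k)))"
  have D: "D m \<omega> = approx \<gamma>1 \<gamma>2 x (K (Suc m)) p \<omega> - approx \<gamma>1 \<gamma>2 x (K m) p \<omega>" for m \<omega>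
  proof -
    have "{..<K (Suc m)} = {..<K m} \<union> {K m..<K (Suc m)}" "{..<K m} \<inter> {K m..<K (Suc m)} = {}"
      using monoD[OF K(1), of m "Suc m"] by auto
    then have "(\<Sum>k<K (Suc m). x k * outer_coord p (\<omega> (Suc k))) = (\<Sum>k<K m. x k * outer_coord p (\<omega> (Suc k))) + D m \<omega>"
      unfolding D_def by (simp add: sum.union_disjoint)
    then show ?thesis by (simp add: approx_def)
  qed
  have "AE \<omega> in Omega. summable (\<lambda>m. norm (D m \<omega>))"
  proof (rule O.AE_summable_of_L2_geometric)
    show "D m \<in> borel_measurable Omega" for m unfolding D[abs_def] by measurable
    note L = orthogonal_sum_square[OF outer_coord_orthogonal[of p, folded c_def], of "{K m..<K (Suc m)}" x for m]
    show "integrable Omega (\<lambda>\<omega>. (norm (D m \<omega>))\<^sup>2)" for m unfolding D_def using L(1)[of m] by simp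
    show "(LINT \<omega>|Omega. (norm (D m \<omega>))\<^sup>2) \<le> c * (1 / 4) ^ m" for m
      unfolding D_def using L(2)[of m] mult_left_mono[OF K(2)[of m] c0] by simp
  qed
  then show "AE \<omega> in Omega. convergent (\<lambda>m. approx \<gamma>1 \<gamma>2 x (K m) p \<omega>)"
  proof eventually_elim
    case (elim \<omega>)
    then have "summable (\<lambda>m. D m \<omega>)" by (rule summable_norm_cancel)
    then have "convergent (\<lambda>m. \<Sum>k<m. D k \<omega>)" by (simp add: summable_iff_convergent)
    then have "convergent (\<lambda>m. approx \<gamma>1 \<gamma>2 x (K m) p \<omega> - approx \<gamma>1 \<gamma>2 x (K 0) p \<omega>)"
      unfolding D using sum_lessThan_telescope[of "\<lambda>m. approx \<gamma>1 \<gamma>2 x (K m) p \<omega>"] by simp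
    then show ?case by (simp add: convergent_diff_const_right_iff)
  qed
qed

lemma exists_fast_subsequence:
  fixes x :: "nat \<Rightarrow> real"
  assumes x: "summable (\<lambda>k. (x k)\<^sup>2)"
  shows "\<exists>K. mono K \<and> (\<forall>m. m \<le> K m) \<and> (\<forall>m. (\<Sum>k=K m..<K (Suc m). (x k)\<^sup>2) \<le> (1 / 4) ^ m)"
proof -
  have "\<exists>N. \<forall>a\<ge>N. \<forall>b. (\<Sum>k=a..<b. (x k)\<^sup>2) \<le> (1 / 4) ^ m" for m :: nat
  proof -
    have "(1 / 4 :: real) ^ m > 0" by simp
    then obtain N where c: "\<And>a b. a \<ge> N \<Longrightarrow> norm (\<Sum>k=a..<b. (x k)\<^sup>2) < (1 / 4) ^ m"
      using x unfolding summable_Cauchy by blast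
    have "(\<Sum>k=a..<b. (x k)\<^sup>2) \<le> (1 / 4) ^ m" if "N \<le> a" for a b
    proof -
      have "(\<Sum>k=a..<b. (x k)\<^sup>2) \<le> norm (\<Sum>k=a..<b. (x k)\<^sup>2)" by simp
      also have "\<dots> \<le> (1 / 4) ^ m" using c[OF that] by (rule less_imp_le)
      finally show ?thesis .
    qed
    then show ?thesis by blast
  qed
  then have "\<forall>m. \<exists>N. \<forall>a\<ge>N. \<forall>b. (\<Sum>k=a..<b. (x k)\<^sup>2) \<le> (1 / 4) ^ m" by blast
  from choice[OF this] obtain N where N: "\<And>m a b. N m \<le> a \<Longrightarrow> (\<Sum>k=a..<b. (x k)\<^sup>2) \<le> (1 / 4) ^ m" by blast
  \<comment> \<open>Summing the thresholds gives monotonicity and \<open>N m \<le> K m\<close>; the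
    extra \<open>m\<close> sends \<open>K\<close> to infinity even if the thresholds vanish.\<close>
  define K where "K = (\<lambda>m. m + (\<Sum>i\<le>m. N i))"
  have "N m \<le> K m" for m
    using member_le_sum[of m "{..m}" N] unfolding K_def by simp
  moreover have "mono K" unfolding mono_iff_le_Suc K_def by simp
  moreover have "m \<le> K m" for m by (simp add: K_def)
  ultimately show ?thesis using N by blast
qed

text \<open>\<open>hcoord\<close> is isometric for the trace form, so the variance of the Gaussian
  part becomes the trace of the square of \<open>A\<close>.\<close>

lemma sum_hcoord:
  assumes "A \<in> Herm_n n"
  shows "complex_of_real (\<Sum>p\<in>{..<n}\<times>{..<n}. hcoord A p * hcoord mone p) = mtrace A"
    "complex_of_real (\<Sum>p\<in>{..<n}\<times>{..<n}. (hcoord A p)\<^sup>2) = mtrace (mmul A A)"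
    "complex_of_real (\<Sum>p\<in>{..<n}\<times>{..<n}. hcoord A p * outer_coord p \<omega>) = mtrace (mmul A (outer (\<lambda>i. xi i \<omega>))) - mtrace A"
proof -
  have m: "mone \<in> Herm" by (rule HermI) (simp add: mone_def)
  show 1: "complex_of_real (\<Sum>p\<in>{..<n}\<times>{..<n}. hcoord A p * hcoord mone p) = mtrace A"
    using trace_eq_hcoord[OF assms m] by simp
  show "complex_of_real (\<Sum>p\<in>{..<n}\<times>{..<n}. (hcoord A p)\<^sup>2) = mtrace (mmul A A)"
    using trace_eq_hcoord[OF assms Herm_nD(2)[OF assms]] by (simp add: power2_eq_square)
  show "complex_of_real (\<Sum>p\<in>{..<n}\<times>{..<n}. hcoord A p * outer_coord p \<omega>) = mtrace (mmul A (outer (\<lambda>i. xi i \<omega>))) - mtrace A"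
    unfolding 1[symmetric] trace_eq_hcoord[OF assms outer_Herm] outer_coord_def
    by (simp add: right_diff_distrib sum_subtractf)
qed

text \<open>For fixed \<open>A\<close> the exponent splits into a constant, a Gaussian linear form
  in component 0 and one centred quadratic form for each further component; independence under
  \<open>Omega\<close> factorises the integral.\<close>

lemma approx_char:
  assumes u: "u \<in> U_n n" and d: "\<And>k. n \<le> k \<Longrightarrow> d k = (0::real)" and \<gamma>2: "\<gamma>2 \<ge> 0"
  defines "A \<equiv> conjugate_by u (diagm (\<lambda>k. of_real (d k)))"
  shows "(LINT \<omega>|Omega. iexp (\<Sum>p\<in>{..<n}\<times>{..<n}. hcoord A p * approx \<gamma>1 \<gamma>2 x K p \<omega>))
    = (\<Prod>j<n. exp (\<i> * \<gamma>1 * d j - \<gamma>2 * (d j)\<^sup>2 / 2) * (\<Prod>k<K. exp (- (\<i> * x k * d j)) / (1 - \<i> * x k * d j)))"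
proof -
  interpret G: prob_space gauss by (rule prob_space_gauss)
  have "diagm (\<lambda>k. of_real (d k)) \<in> Herm_n n" using d by (auto simp: Herm_n_def diagm_def intro!: HermI)
  then have A: "A \<in> Herm_n n" unfolding A_def by (rule conjugate_by_Herm_n[OF u])
  define J where "J = {..<n} \<times> {..<n}"
  have fJ: "finite J" by (simp add: J_def)
  have trA: "mtrace A = (\<Sum>k<n. of_real (d k))" "mtrace (mmul A A) = (\<Sum>k<n. of_real (d k) * of_real (d k))"
    unfolding A_def using d by (auto simp: conjd_mmul[OF u] intro!: conjd_mtrace[OF u])
  define f where "f = (\<lambda>k \<eta>. case k of 0 \<Rightarrow> iexp (sqrt \<gamma>2 * (\<Sum>p\<in>J. hcoord A p * \<eta> p))
      | Suc k \<Rightarrow> iexp (x k * (\<Sum>p\<in>J. hcoord A p * outer_coord p \<eta>)))"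
  have fm: "f k \<in> borel_measurable gauss" for k
  proof (cases k)
    case 0
    then show ?thesis unfolding f_def by simp measurable
  next
    case (Suc l)
    note outer_coord_measurable [measurable]
    show ?thesis unfolding f_def Suc nat.case by measurable
  qed
  have fi: "integrable gauss (f k)" for k
  proof (rule G.integrable_const_bound[of _ 1, OF _ fm])
    show "AE \<eta> in gauss. norm (f k \<eta>) \<le> 1" by (cases k) (simp_all add: f_def)
  qed
  have split: "iexp (\<Sum>p\<in>J. hcoord A p * approx \<gamma>1 \<gamma>2 x K p \<omega>)
      = exp (\<i> * \<gamma>1 * mtrace A) * (\<Prod>k<Suc K. f k (\<omega> k))" for \<omega>
  proof -
    have "(\<Sum>p\<in>J. hcoord A p * approx \<gamma>1 \<gamma>2 x K p \<omega>)
        = \<gamma>1 * (\<Sum>p\<in>J. hcoord A p * hcoord mone p) + sqrt \<gamma>2 * (\<Sum>p\<in>J. hcoord A p * \<omega> 0 p)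
          + (\<Sum>p\<in>J. \<Sum>k<K. x k * (hcoord A p * outer_coord p (\<omega> (Suc k))))"
      by (simp add: approx_def distrib_left sum.distrib sum_distrib_left mult_ac)
    also have "(\<Sum>p\<in>J. \<Sum>k<K. x k * (hcoord A p * outer_coord p (\<omega> (Suc k))))
        = (\<Sum>k<K. x k * (\<Sum>p\<in>J. hcoord A p * outer_coord p (\<omega> (Suc k))))"
      by (subst sum.swap) (simp only: sum_distrib_left)
    finally have e: "\<i> * complex_of_real (\<Sum>p\<in>J. hcoord A p * approx \<gamma>1 \<gamma>2 x K p \<omega>)
        = \<i> * \<gamma>1 * mtrace A + \<i> * complex_of_real (sqrt \<gamma>2 * (\<Sum>p\<in>J. hcoord A p * \<omega> 0 p))
          + (\<Sum>k<K. \<i> * complex_of_real (x k * (\<Sum>p\<in>J. hcoord A p * outer_coord p (\<omega> (Suc k)))))"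
      unfolding sum_hcoord(1)[OF A, symmetric] J_def[symmetric]
      by (simp only: of_real_add of_real_mult of_real_sum distrib_left sum_distrib_left mult.assoc)
    show ?thesis
      unfolding e prod.lessThan_Suc_shift exp_add exp_sum[OF finite_lessThan] by (simp add: f_def)
  qed
  have f0: "integral\<^sup>L gauss (f 0) = exp (- \<gamma>2 * mtrace (mmul A A) / 2)"
  proof -
    have "integral\<^sup>L gauss (f 0) = (LINT \<eta>|gauss. iexp (\<Sum>p\<in>J. (sqrt \<gamma>2 * hcoord A p) * \<eta> p))"
      by (simp add: f_def sum_distrib_left mult.assoc)
    also have "\<dots> = exp (- of_real ((\<Sum>p\<in>J. (sqrt \<gamma>2 * hcoord A p)\<^sup>2) / 2))" by (rule gauss_char[OF fJ])
    also have "(\<Sum>p\<in>J. (sqrt \<gamma>2 * hcoord A p)\<^sup>2) = \<gamma>2 * (\<Sum>p\<in>J. (hcoord A p)\<^sup>2)"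
      using \<gamma>2 by (simp add: power_mult_distrib sum_distrib_left)
    finally show ?thesis unfolding sum_hcoord(2)[OF A, symmetric] J_def[symmetric] by simp
  qed
  have fS: "integral\<^sup>L gauss (f (Suc k)) = (\<Prod>j<n. exp (- (\<i> * x k * d j)) / (1 - \<i> * x k * d j))" for k
  proof -
    have s: "mscale (of_real (x k)) A = conjugate_by u (diagm (\<lambda>j. of_real (x k * d j)))"
      unfolding A_def conjd_mscale[OF u] by simp
    have "f (Suc k) \<eta> = exp (- (\<i> * x k * mtrace A)) * exp (\<i> * mtrace (mmul (mscale (of_real (x k)) A) (outer (\<lambda>i. xi i \<eta>))))" for \<eta>
    proof -
      have "mtrace (mmul (mscale (of_real (x k)) A) (outer (\<lambda>i. xi i \<eta>))) = of_real (x k) * mtrace (mmul A (outer (\<lambda>i. xi i \<eta>)))"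
        unfolding trace_eq_sum[OF mscale_Herm_n[OF A]] trace_eq_sum[OF A] by (simp add: mscale_def sum_distrib_left mult.assoc)
      then show ?thesis unfolding f_def J_def
        by (simp add: sum_hcoord(3)[OF A] exp_add[symmetric] algebra_simps del: of_real_sum)
    qed
    then have fe: "f (Suc k) = (\<lambda>\<eta>. exp (- (\<i> * x k * mtrace A)) * exp (\<i> * mtrace (mmul (mscale (of_real (x k)) A) (outer (\<lambda>i. xi i \<eta>)))))"
      by (rule ext)
    have "integral\<^sup>L gauss (f (Suc k)) = exp (- (\<i> * x k * mtrace A)) * (\<Prod>j<n. 1 / (1 - \<i> * of_real (x k * d j)))"
      unfolding fe using gauss_quadratic_char[OF u _ s] d by simp
    also have "exp (- (\<i> * x k * mtrace A)) = (\<Prod>j<n. exp (- (\<i> * x k * d j)))"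
      unfolding trA by (simp add: sum_distrib_left sum_negf flip: exp_sum)
    finally show ?thesis by (simp add: prod.distrib[symmetric] mult.assoc)
  qed
  have "(LINT \<omega>|Omega. iexp (\<Sum>p\<in>{..<n}\<times>{..<n}. hcoord A p * approx \<gamma>1 \<gamma>2 x K p \<omega>))
      = exp (\<i> * \<gamma>1 * mtrace A) * (LINT \<omega>|Omega. (\<Prod>k<Suc K. f k (\<omega> k)))"
    unfolding J_def[symmetric] split by (rule integral_mult_right_zero)
  also have "\<dots> = exp (\<i> * \<gamma>1 * mtrace A) * (\<Prod>k<Suc K. integral\<^sup>L gauss (f k))"
    by (simp only: Omega_integral_prod(2)[OF finite_lessThan fi])
  also have "\<dots> = (exp (\<i> * \<gamma>1 * mtrace A) * exp (- \<gamma>2 * mtrace (mmul A A) / 2)) *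
      (\<Prod>j<n. \<Prod>k<K. exp (- (\<i> * x k * d j)) / (1 - \<i> * x k * d j))"
    unfolding prod.lessThan_Suc_shift f0 fS by (subst prod.swap) (simp add: mult.assoc)
  also have "exp (\<i> * \<gamma>1 * mtrace A) * exp (- \<gamma>2 * mtrace (mmul A A) / 2) = (\<Prod>j<n. exp (\<i> * \<gamma>1 * d j - \<gamma>2 * (d j)\<^sup>2 / 2))"
    unfolding trA exp_sum[OF finite_lessThan, symmetric] exp_add[symmetric]
    by (intro arg_cong[where f = exp]) (simp add: sum_subtractf sum_distrib_left sum_divide_distrib sum_negf power2_eq_square)
  finally show ?thesis by (simp add: prod.distrib)
qed

text \<open>The characteristic function is described on diagonalised matrices, which exhaust
  \<open>Herm_fin\<close>; invariance and multiplicativity are both read off this form.\<close>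

theorem exists_measure:
  assumes \<gamma>2: "\<gamma>2 \<ge> 0" and x: "summable (\<lambda>k. (x k)\<^sup>2)"
  shows "\<exists>M. borel_prob_on_Herm M \<and> (\<forall>n. \<forall>u\<in>U_n n. \<forall>d :: nat \<Rightarrow> real. (\<forall>k\<ge>n. d k = 0) \<longrightarrow>
    char_fun M (conjugate_by u (diagm (\<lambda>k. of_real (d k)))) = (\<Prod>k<n. F_param \<gamma>1 \<gamma>2 x (d k)))"
proof -
  interpret O: prob_space Omega by (rule prob_space_Omega)
  obtain K where K: "mono K" "\<And>m. m \<le> K m" "\<And>m. (\<Sum>k=K m..<K (Suc m). (x k)\<^sup>2) \<le> (1 / 4) ^ m"
    using exists_fast_subsequence[OF x] by blast
  \<comment> \<open>\<open>lim\<close> is measurable whatever its value where the series diverges,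
    and \<open>hmat\<close> is Hermitian for every argument, so no exceptional set has to be
    removed.\<close>
  define b where "b = (\<lambda>\<omega> p. lim (\<lambda>m. approx \<gamma>1 \<gamma>2 x (K m) p \<omega>))"
  have bm[measurable]: "(\<lambda>\<omega>. b \<omega> p) \<in> borel_measurable Omega" for p
    unfolding b_def by (intro borel_measurable_lim_metric) measurable
  have b_lim: "AE \<omega> in Omega. \<forall>p. (\<lambda>m. approx \<gamma>1 \<gamma>2 x (K m) p \<omega>) \<longlonglongrightarrow> b \<omega> p"
    using approx_converges[OF K(1,3), of \<gamma>1 \<gamma>2] by eventually_elim (simp add: b_def convergent_LIMSEQ_iff)
  have "b \<in> measurable Omega (PiM UNIV (\<lambda>_. borel))" by (rule measurable_PiM_single') auto
  then have "(\<lambda>\<omega>. hmat (b \<omega>)) \<in> measurable Omega borel" by (rule measurable_compose[OF _ hmat_measurable])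
  then have hb: "(\<lambda>\<omega>. hmat (b \<omega>)) \<in> measurable Omega (restrict_space borel Herm)"
    by (intro measurable_restrict_space2) auto
  define M where "M = distr Omega (restrict_space borel Herm) (\<lambda>\<omega>. hmat (b \<omega>))"
  have M: "borel_prob_on_Herm M" unfolding borel_prob_on_Herm_def M_def
    using O.prob_space_distr[OF hb] by simp
  interpret M: hermitian_measure M
    by (intro hermitian_measure.intro hermitian_measure_axioms.intro M borel_prob_on_HermD(1)[OF M])
  have "char_fun M (conjugate_by u (diagm (\<lambda>k. of_real (d k)))) = (\<Prod>k<n. F_param \<gamma>1 \<gamma>2 x (d k))"
    if u: "u \<in> U_n n" and d: "\<forall>k\<ge>n. d k = (0::real)" for n u d
  proof -
    define A where "A = conjugate_by u (diagm (\<lambda>k. of_real (d k)))"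
    have "diagm (\<lambda>k. of_real (d k)) \<in> Herm_n n" using d by (auto simp: Herm_n_def diagm_def intro!: HermI)
    then have A: "A \<in> Herm_n n" unfolding A_def by (rule conjugate_by_Herm_n[OF u])
    define J where "J = {..<n} \<times> {..<n}"
    have "phase A \<in> borel_measurable M" by (rule M.phase_M[OF Herm_finI[OF A]])
    then have pm: "phase A \<in> borel_measurable (restrict_space borel Herm)"
      using measurable_cong_sets[OF borel_prob_on_HermD(3)[OF M] refl] by auto
    have "char_fun M A = (LINT \<omega>|Omega. phase A (hmat (b \<omega>)))"
      unfolding M.char_fun_eq unfolding M_def by (rule integral_distr[OF hb pm])
    also have "\<dots> = (LINT \<omega>|Omega. iexp (\<Sum>p\<in>J. hcoord A p * b \<omega> p))"
      unfolding phase_def trace_eq_hcoord[OF A hmat_Herm] hcoord_hmat J_def ..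
    finally have c: "char_fun M A = (LINT \<omega>|Omega. iexp (\<Sum>p\<in>J. hcoord A p * b \<omega> p))" .
    have "(\<lambda>m. LINT \<omega>|Omega. iexp (\<Sum>p\<in>J. hcoord A p * approx \<gamma>1 \<gamma>2 x (K m) p \<omega>))
        \<longlonglongrightarrow> (LINT \<omega>|Omega. iexp (\<Sum>p\<in>J. hcoord A p * b \<omega> p))"
    proof (rule integral_dominated_convergence[where w = "\<lambda>_. 1"])
      show "AE \<omega> in Omega. (\<lambda>m. iexp (\<Sum>p\<in>J. hcoord A p * approx \<gamma>1 \<gamma>2 x (K m) p \<omega>)) \<longlonglongrightarrow> iexp (\<Sum>p\<in>J. hcoord A p * b \<omega> p)"
        using b_lim by eventually_elim (intro tendsto_intros, blast)
    qed (auto simp del: of_real_sum)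
    moreover have "(\<lambda>m. LINT \<omega>|Omega. iexp (\<Sum>p\<in>J. hcoord A p * approx \<gamma>1 \<gamma>2 x (K m) p \<omega>)) \<longlonglongrightarrow> (\<Prod>k<n. F_param \<gamma>1 \<gamma>2 x (d k))"
    proof -
      have Kt: "filterlim K at_top sequentially"
        using K(2) by (intro filterlim_at_top_mono[OF filterlim_ident]) simp
      have "(LINT \<omega>|Omega. iexp (\<Sum>p\<in>J. hcoord A p * approx \<gamma>1 \<gamma>2 x (K m) p \<omega>))
          = (\<Prod>j<n. exp (\<i> * \<gamma>1 * d j - \<gamma>2 * (d j)\<^sup>2 / 2) * (\<Prod>k<K m. exp (- (\<i> * x k * d j)) / (1 - \<i> * x k * d j)))" for m
        unfolding A_def J_def by (rule approx_char[OF u _ \<gamma>2]) (use d in auto)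
      moreover have "(\<lambda>m. \<Prod>j<n. exp (\<i> * \<gamma>1 * d j - \<gamma>2 * (d j)\<^sup>2 / 2) * (\<Prod>k<K m. exp (- (\<i> * x k * d j)) / (1 - \<i> * x k * d j)))
          \<longlonglongrightarrow> (\<Prod>j<n. F_param \<gamma>1 \<gamma>2 x (d j))"
        unfolding F_param_def
        by (intro tendsto_prod tendsto_mult tendsto_const filterlim_compose[OF param_prod_tendsto[OF x] Kt])
      ultimately show ?thesis by simp
    qed
    ultimately show ?thesis unfolding c A_def[symmetric] by (rule LIMSEQ_unique)
  qed
  then show ?thesis using M by blast
qed

section \<open>Classification\<close>

lemma f_param_spectral:
  assumes "u \<in> U_n n" "\<And>k. n \<le> k \<Longrightarrow> d k = (0 :: real)" "summable (\<lambda>k. (x k)\<^sup>2)"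
  shows "f_param \<gamma>1 \<gamma>2 x (conjugate_by u (diagm (\<lambda>k. of_real (d k)))) = (\<Prod>k<n. F_param \<gamma>1 \<gamma>2 x (d k))"
  by (rule f_param_eq_prod[OF assms(1,2) param_prod_tendsto[OF assms(3)]])

lemma f_param_diag1:
  assumes "summable (\<lambda>k. (x k)\<^sup>2)"
  shows "f_param \<gamma>1 \<gamma>2 x (diag1 a) = F_param \<gamma>1 \<gamma>2 x a"
proof -
  define d where "d = (\<lambda>k :: nat. if k = 0 then a else 0)"
  have "diag1 a = conjugate_by mone (diagm (\<lambda>k. of_real (d k)))"
    by (simp add: fun_eq_iff diag1_def diagm_def d_def)
  moreover have "f_param \<gamma>1 \<gamma>2 x (conjugate_by mone (diagm (\<lambda>k. of_real (d k)))) = (\<Prod>k<1. F_param \<gamma>1 \<gamma>2 x (d k))"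
    by (rule f_param_spectral[OF mone_U_n _ assms]) (simp add: d_def)
  ultimately show ?thesis by (simp add: d_def)
qed

theorem ergodic_char_fun:
  assumes M: "borel_prob_on_Herm M" and inv: "U_invariant M" and erg: "U_ergodic M"
  shows "\<exists>\<gamma>1 \<gamma>2 x. \<gamma>2 \<ge> 0 \<and> summable (\<lambda>k. (x k)\<^sup>2) \<and> (\<forall>A\<in>Herm_fin. char_fun M A = f_param \<gamma>1 \<gamma>2 x A)"
proof -
  interpret invariant_measure M
    by (intro invariant_measure.intro hermitian_measure.intro hermitian_measure_axioms.intro
        invariant_measure_axioms.intro M inv borel_prob_on_HermD(1)[OF M])
  have mult: multiplicative by (rule ergodic_imp_multiplicative[OF erg])
  obtain \<gamma>1 \<gamma>2 x where p: "\<gamma>2 \<ge> 0" "summable (\<lambda>k. (x k)\<^sup>2)" "F1 = F_param \<gamma>1 \<gamma>2 x"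
    using multiplicative_imp_F_param[OF mult] by blast
  have "char_fun M A = f_param \<gamma>1 \<gamma>2 x A" if "A \<in> Herm_fin" for A
  proof -
    from that obtain n where "A \<in> Herm_n n" by (auto simp: Herm_fin_def)
    then obtain u d where u: "u \<in> U_n n" and d: "\<And>k. n \<le> k \<Longrightarrow> d k = (0 :: real)"
      and A: "A = conjugate_by u (diagm (\<lambda>k. of_real (d k)))"
      using Herm_n_diagonalise by blast
    have "char_fun M A = (\<Prod>k<n. F1 (d k))" unfolding A by (rule char_fun_spectral[OF mult u]) (rule d)
    also have "\<dots> = f_param \<gamma>1 \<gamma>2 x A" unfolding A p(3) by (rule f_param_spectral[OF u _ p(2), symmetric]) (rule d)
    finally show ?thesis .
  qed
  then show ?thesis using p(1,2) by blast
qed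

text \<open>Conjugation changes the diagonalising unitary but not the eigenvalues, which gives
  invariance. A block sum combines the eigenvalues of its blocks, which gives multiplicativity and
  hence ergodicity.\<close>

theorem exists_ergodic:
  assumes \<gamma>2: "\<gamma>2 \<ge> 0" and x: "summable (\<lambda>k. (x k)\<^sup>2)"
  shows "\<exists>M. borel_prob_on_Herm M \<and> U_invariant M \<and> U_ergodic M \<and> (\<forall>A\<in>Herm_fin. char_fun M A = f_param \<gamma>1 \<gamma>2 x A)"
proof -
  define F where "F = F_param \<gamma>1 \<gamma>2 x"
  obtain M where M: "borel_prob_on_Herm M"
    and c: "\<And>n u d. u \<in> U_n n \<Longrightarrow> (\<And>k. n \<le> k \<Longrightarrow> d k = (0 :: real)) \<Longrightarrow>
      char_fun M (conjugate_by u (diagm (\<lambda>k. of_real (d k)))) = (\<Prod>k<n. F (d k))"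
    using exists_measure[OF \<gamma>2 x, of \<gamma>1] unfolding F_def by blast
  interpret H: hermitian_measure M
    by (intro hermitian_measure.intro hermitian_measure_axioms.intro M borel_prob_on_HermD(1)[OF M])
  have F0: "F 0 = 1" by (simp add: F_def F_param_def)
  have conj: "char_fun M (conjugate_by v A) = char_fun M A" if v: "v \<in> U_fin" and A: "A \<in> Herm_fin" for v A
  proof -
    from v A obtain m n where "v \<in> U_n m" "A \<in> Herm_n n" by (auto simp: U_fin_def Herm_fin_def)
    then have v': "v \<in> U_n (max m n)" and A': "A \<in> Herm_n (max m n)" by (auto intro: U_n_mono Herm_n_mono)
    obtain u d where u: "u \<in> U_n (max m n)" and d: "\<And>k. max m n \<le> k \<Longrightarrow> d k = (0 :: real)"
      and Ad: "A = conjugate_by u (diagm (\<lambda>k. of_real (d k)))"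
      using Herm_n_diagonalise[OF A'] by blast
    show ?thesis unfolding Ad conjugate_by_mmul[OF v' u]
      using c[OF U_n_mmul[OF v' u] d] c[OF u d] by simp
  qed
  have inv: "U_invariant M" unfolding U_invariant_def
  proof
    fix v assume v: "v \<in> U_fin"
    then obtain m where m: "v \<in> U_n m" by (auto simp: U_fin_def)
    have v': "madj v \<in> U_fin" using U_n_madj[OF m] by (auto simp: U_fin_def)
    note cm = H.conjugate_measurable[OF v]
    show "distr M M (conjugate_by v) = M"
    proof (rule char_fun_unique[OF _ M])
      show "borel_prob_on_Herm (distr M M (conjugate_by v))"
        using M H.prob_space_distr[OF cm] by (simp add: borel_prob_on_Herm_def)
      fix A assume A: "A \<in> Herm_fin"
      have "char_fun (distr M M (conjugate_by v)) A = (LINT B|M. phase A (conjugate_by v B))"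
        unfolding char_fun_def phase_def[symmetric] by (rule integral_distr[OF cm H.phase_M[OF A]])
      also have "\<dots> = char_fun M (conjugate_by (madj v) A)"
        unfolding H.char_fun_eq phase_conjugate(2)[OF v A] ..
      also have "\<dots> = char_fun M A" by (rule conj[OF v' A])
      finally show "char_fun (distr M M (conjugate_by v)) A = char_fun M A" .
    qed
  qed
  interpret invariant_measure M by (intro invariant_measure.intro H.hermitian_measure_axioms invariant_measure_axioms.intro inv)
  have multiplicative unfolding multiplicative_def
  proof (intro allI impI)
    fix n :: nat and A A' assume n: "n > 0" and A: "A \<in> Herm_n n" and A': "A' \<in> Herm_n n"
    obtain u d where u: "u \<in> U_n n" and d: "\<And>k. n \<le> k \<Longrightarrow> d k = (0 :: real)"
      and Ad: "A = conjugate_by u (diagm (\<lambda>k. of_real (d k)))"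
      using Herm_n_diagonalise[OF A] by blast
    obtain v d' where v: "v \<in> U_n n" and d': "\<And>k. n \<le> k \<Longrightarrow> d' k = (0 :: real)"
      and Ad': "A' = conjugate_by v (diagm (\<lambda>k. of_real (d' k)))"
      using Herm_n_diagonalise[OF A'] by blast
    define D where "D = diagm (\<lambda>k. of_real (d k))"
    define D' where "D' = diagm (\<lambda>k. of_real (d' k))"
    have D: "D \<in> Herm_n n" "D' \<in> Herm_n n"
      using d d' by (auto simp: D_def D'_def Herm_n_def diagm_def intro!: HermI)
    have fin: "madd X (shiftm n Y) \<in> Herm_fin" "madd (shiftm n Y) X \<in> Herm_fin" if "X \<in> Herm_n n" "Y \<in> Herm_n n" for X Y
      using that by (auto intro!: Herm_finI[of _ "n + n"] madd_Herm_n shiftm_Herm_n intro: Herm_n_mono)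
    have fixd: "conjugate_by w (shiftm n X) = shiftm n X" if "w \<in> U_n n" for w X
      by (rule conjugate_by_disjoint[OF that]) (auto simp: shiftm_def)
    \<comment> \<open>A unitary in \<open>U_n n\<close> reaches the first block only. So
      \<open>A\<close> is diagonalised there, the two blocks are exchanged, and \<open>A'\<close> is
      then diagonalised in the same place.\<close>
    define \<sigma> where "\<sigma> = Transposition.transpose 0 (1 :: nat)"
    have "\<sigma> permutes {..<2}" unfolding \<sigma>_def by (rule permutes_swap_id) auto
    then obtain s where s: "s \<in> U_n (2 * n)" "\<And>X b. X \<in> Herm_n n \<Longrightarrow> conjugate_by s (shiftm (b * n) X) = shiftm (\<sigma> b * n) X"
      using block_permutation[OF n] by blast
    have swap: "conjugate_by s (madd X (shiftm n Y)) = madd (shiftm n X) Y" if "X \<in> Herm_n n" "Y \<in> Herm_n n" for X Y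
      using s(2)[OF that(1), of 0] s(2)[OF that(2), of 1] by (simp add: conjugate_by_madd[OF s(1)] \<sigma>_def)
    have U: "u \<in> U_fin" "v \<in> U_fin" "s \<in> U_fin" using u v s(1) by (auto simp: U_fin_def)
    have "char_fun M (madd A (shiftm n A')) = char_fun M (conjugate_by u (madd D (shiftm n A')))"
      by (simp add: conjugate_by_madd[OF u] fixd[OF u] Ad D_def)
    also have "\<dots> = char_fun M (madd D (shiftm n A'))" by (rule conj[OF U(1) fin(1)[OF D(1) A']])
    also have "\<dots> = char_fun M (conjugate_by s (madd D (shiftm n A')))" by (rule conj[OF U(3) fin(1)[OF D(1) A'], symmetric])
    also have "\<dots> = char_fun M (madd (shiftm n D) A')" by (simp only: swap[OF D(1) A'])
    also have "madd (shiftm n D) A' = conjugate_by v (madd (shiftm n D) D')"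
      unfolding conjugate_by_madd[OF v] fixd[OF v] Ad' D'_def ..
    also have "char_fun M \<dots> = char_fun M (madd (shiftm n D) D')" by (rule conj[OF U(2) fin(2)[OF D(2,1)]])
    also have "madd (shiftm n D) D' = conjugate_by mone (diagm (\<lambda>k. of_real (if k < n then d' k else d (k - n))))"
      using d' by (auto simp: fun_eq_iff madd_def shiftm_def D_def D'_def diagm_def)
    also have "char_fun M \<dots> = (\<Prod>k<n + n. F (if k < n then d' k else d (k - n)))"
      by (rule c[OF mone_U_n]) (use d in auto)
    also have "\<dots> = (\<Prod>k<n. F (d' k)) * (\<Prod>k<n. F (d k))"
    proof -
      have "{..<n + n} = {..<n} \<union> {n..<n + n}" "{..<n} \<inter> {n..<n + n} = {}" by auto
      then have "(\<Prod>k<n + n. F (if k < n then d' k else d (k - n)))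
          = (\<Prod>k<n. F (if k < n then d' k else d (k - n))) * (\<Prod>k=n..<n + n. F (if k < n then d' k else d (k - n)))"
        by (simp only: prod.union_disjoint finite_lessThan finite_atLeastLessThan)
      also have "(\<Prod>k=n..<n + n. F (if k < n then d' k else d (k - n))) = (\<Prod>k<n. F (d k))"
        by (rule prod.reindex_bij_witness[of _ "\<lambda>k. k + n" "\<lambda>k. k - n"]) auto
      finally show ?thesis by simp
    qed
    also have "(\<Prod>k<n. F (d k)) = char_fun M A" unfolding Ad by (rule c[OF u, symmetric]) (rule d)
    also have "(\<Prod>k<n. F (d' k)) = char_fun M A'" unfolding Ad' by (rule c[OF v, symmetric]) (rule d')
    also have "char_fun M A' * char_fun M A = char_fun M A * char_fun M A'" by (rule mult.commute)
    finally show "char_fun M (madd A (shiftm n A')) = char_fun M A * char_fun M A'" .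
  qed
  then have erg: "U_ergodic M" by (rule multiplicative_imp_ergodic)
  have "char_fun M A = f_param \<gamma>1 \<gamma>2 x A" if "A \<in> Herm_fin" for A
  proof -
    from that obtain n where "A \<in> Herm_n n" by (auto simp: Herm_fin_def)
    then obtain u d where u: "u \<in> U_n n" and d: "\<And>k. n \<le> k \<Longrightarrow> d k = (0 :: real)"
      and A: "A = conjugate_by u (diagm (\<lambda>k. of_real (d k)))"
      using Herm_n_diagonalise by blast
    have "char_fun M A = (\<Prod>k<n. F (d k))" unfolding A by (rule c[OF u]) (rule d)
    also have "\<dots> = f_param \<gamma>1 \<gamma>2 x A" unfolding A F_def by (rule f_param_spectral[OF u _ x, symmetric]) (rule d)
    finally show ?thesis .
  qed
  then show ?thesis using M inv erg by blast
qed

theorem theorem2p9: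
  shows "class_F1 = {F_param \<gamma>1 \<gamma>2 x | \<gamma>1 \<gamma>2 x. \<gamma>2 \<ge> 0 \<and> summable (\<lambda>k. (x k)\<^sup>2)} \<and>
         class_F = {\<lambda>A\<in>Herm_fin. f_param \<gamma>1 \<gamma>2 x A | \<gamma>1 \<gamma>2 x.
                      \<gamma>2 \<ge> 0 \<and> summable (\<lambda>k. (x k)\<^sup>2)}"
proof -
  have F: "class_F = {\<lambda>A\<in>Herm_fin. f_param \<gamma>1 \<gamma>2 x A | \<gamma>1 \<gamma>2 x. \<gamma>2 \<ge> 0 \<and> summable (\<lambda>k. (x k)\<^sup>2)}"
  proof (intro equalityI subsetI)
    fix f assume "f \<in> class_F"
    then obtain M where f: "f = (\<lambda>A\<in>Herm_fin. char_fun M A)" and M: "borel_prob_on_Herm M" "U_invariant M" "U_ergodic M"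
      unfolding class_F_def by blast
    obtain \<gamma>1 \<gamma>2 x where p: "\<gamma>2 \<ge> 0" "summable (\<lambda>k. (x k)\<^sup>2)" and e: "\<forall>A\<in>Herm_fin. char_fun M A = f_param \<gamma>1 \<gamma>2 x A"
      using ergodic_char_fun[OF M] by blast
    have "f = (\<lambda>A\<in>Herm_fin. f_param \<gamma>1 \<gamma>2 x A)" unfolding f using e by (intro restrict_ext) blast
    then show "f \<in> {\<lambda>A\<in>Herm_fin. f_param \<gamma>1 \<gamma>2 x A | \<gamma>1 \<gamma>2 x. \<gamma>2 \<ge> 0 \<and> summable (\<lambda>k. (x k)\<^sup>2)}"
      using p by blast
  next
    fix f assume "f \<in> {\<lambda>A\<in>Herm_fin. f_param \<gamma>1 \<gamma>2 x A | \<gamma>1 \<gamma>2 x. \<gamma>2 \<ge> 0 \<and> summable (\<lambda>k. (x k)\<^sup>2)}"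
    then obtain \<gamma>1 \<gamma>2 x where p: "\<gamma>2 \<ge> 0" "summable (\<lambda>k. (x k)\<^sup>2)" and f: "f = (\<lambda>A\<in>Herm_fin. f_param \<gamma>1 \<gamma>2 x A)"
      by blast
    obtain M where M: "borel_prob_on_Herm M" "U_invariant M" "U_ergodic M" and e: "\<forall>A\<in>Herm_fin. char_fun M A = f_param \<gamma>1 \<gamma>2 x A"
      using exists_ergodic[OF p, of \<gamma>1] by blast
    have "f = (\<lambda>A\<in>Herm_fin. char_fun M A)" unfolding f using e by (intro restrict_ext) simp
    then show "f \<in> class_F" unfolding class_F_def using M by blast
  qed
  have d: "diag1 a \<in> Herm_fin" for a by (rule Herm_finI[OF diag1_Herm_n[OF lessI]])
  have F1: "(\<lambda>a. (\<lambda>A\<in>Herm_fin. f_param \<gamma>1 \<gamma>2 x A) (diag1 a)) = F_param \<gamma>1 \<gamma>2 x" if "summable (\<lambda>k. (x k)\<^sup>2)" for \<gamma>1 \<gamma>2 x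
    using d f_param_diag1[OF that] by (simp add: fun_eq_iff)
  have "class_F1 = {F_param \<gamma>1 \<gamma>2 x | \<gamma>1 \<gamma>2 x. \<gamma>2 \<ge> 0 \<and> summable (\<lambda>k. (x k)\<^sup>2)}"
    unfolding class_F1_def F using F1 by (intro equalityI subsetI; clarsimp; metis)
  then show ?thesis using F by blast
qed

end
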